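(* Let $p\in\mathbb{N}=\{1,2,\ldots\}$ and let $J$ be a $p$-periodic Jacobi matrix with diagonal entries $b_j\in\mathbb{R}$ and off-diagonal entries $a_j>0$, $j\in\mathbb{Z}$. Let $|\gamma|$ be the length of the maximal gap in the spectrum of $J$, and let $\omega_a$, $\omega_b$ be the variations of the sequences $\{a_j\}_{j\in\mathbb{Z}}$ and $\{b_j\}_{j\in\mathbb{Z}}$. Then $$\omega_b\le \frac{p(p-1)}{2}\,|\gamma|, \qquad \omega_a\le p^2\sqrt{p}\,|\gamma|.$$ Furthermore, $$\omega_b+\omega_a\ge \frac{|\gamma|}{4}.$$
   Context: A Jacobi matrix $J$ is a two-sided infinite tridiagonal real symmetric matrix determined by sequences $\{a_j\}_{j\in\mathbb{Z}}$, $a_j>0$, and $\{b_j\}_{j\in\mathbb{Z}}$, $b_j\in\mathbb{R}$, acting on sequences by $(Jy)_n=a_{n-1}y_{n-1}+b_ny_n+a_ny_{n+1}$, $n\in\mathbb{Z}$. It is periodic of period $p$ ($p$-periodic) if $a_{j+p}=a_j$ and $b_{j+p}=b_j$ for all $j\in\mathbb{Z}$ ($p$ is not required to be the minimal period; constant matrices are viewed as periodic of any period $p\in\mathbb{N}$). Such $J$ defines a bounded self-adjoint operator on the Hilbert space $\ell^2(\mathbb{Z})$. The spectrum of a $p$-periodic Jacobi matrix is a union of $p$ closed intervals (bands), some of which may merge: $$\sigma(J)=\bigcup_{j=0}^{p-1}[\mu_j^+,\mu_{j+1}^-],\qquad \mu_0^+<\mu_1^-\le\mu_1^+<\mu_2^-\le\cdots<\mu_{p-1}^-\le\mu_{p-1}^+<\mu_p^-.$$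 The (interior) gaps are $\gamma_j=(\mu_j^-,\mu_j^+)$, $j=1,\ldots,p-1$, of length $|\gamma_j|=\mu_j^+-\mu_j^-\ge 0$; a gap with $\mu_j^-=\mu_j^+$ is called closed and is counted as a gap of zero length. The length of the maximal gap is $|\gamma|=\max_{1\le j\le p-1}|\gamma_j|$ (with $|\gamma|=0$ if $p=1$, when there are no interior gaps). For a bounded real sequence $c=\{c_j\}_{j\in\mathbb{Z}}$, its variation is $\omega_c:=\sup_{i,j\in\mathbb{Z}}(c_i-c_j)$. *)

theory Defs
  imports "HOL-Analysis.Analysis"
begin

section \<open>The Hilbert space of square-summable two-sided sequences\<close>

definition ell2 :: "(int \<Rightarrow> complex) set" where
  "ell2 = {y. (\<lambda>n. (cmod (y n))\<^sup>2) summable_on UNIV}"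

definition ell2_norm :: "(int \<Rightarrow> complex) \<Rightarrow> real" where
  "ell2_norm y = sqrt (\<Sum>\<^sub>\<infinity>n. (cmod (y n))\<^sup>2)"

definition bounded_operator_ell2 :: "((int \<Rightarrow> complex) \<Rightarrow> (int \<Rightarrow> complex)) \<Rightarrow> bool" where
  "bounded_operator_ell2 T \<longleftrightarrow>
     (\<forall>x\<in>ell2. T x \<in> ell2) \<and>
     (\<forall>x\<in>ell2. \<forall>y\<in>ell2. T (\<lambda>n. x n + y n) = (\<lambda>n. T x n + T y n)) \<and>
     (\<forall>c. \<forall>x\<in>ell2. T (\<lambda>n. c * x n) = (\<lambda>n. c * T x n)) \<and>
     (\<exists>C. \<forall>x\<in>ell2. ell2_norm (T x) \<le> C * ell2_norm x)"

text \<open>The spectrum of an operator that is everywhere defined on \<^const>\<open>ell2\<close>: \<open>z\<close> is in the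
  resolvent set iff \<open>T - z\<close> has a bounded two-sided inverse \<open>R\<close>.\<close>

definition spectrum_ell2 :: "((int \<Rightarrow> complex) \<Rightarrow> (int \<Rightarrow> complex)) \<Rightarrow> complex set" where
  "spectrum_ell2 T = {z. \<not> (\<exists>R. bounded_operator_ell2 R \<and>
     (\<forall>y\<in>ell2. R (\<lambda>n. T y n - z * y n) = y \<and> (\<lambda>n. T (R y) n - z * R y n) = y))}"


section \<open>Jacobi matrices, bands and gaps\<close>

definition jacobi :: "(int \<Rightarrow> real) \<Rightarrow> (int \<Rightarrow> real) \<Rightarrow> (int \<Rightarrow> complex) \<Rightarrow> (int \<Rightarrow> complex)" where
  "jacobi a b y = (\<lambda>n. of_real (a (n - 1)) * y (n - 1) + of_real (b n) * y n
                        + of_real (a n) * y (n + 1))"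

definition periodic :: "nat \<Rightarrow> (int \<Rightarrow> real) \<Rightarrow> bool" where
  "periodic p c \<longleftrightarrow> (\<forall>j. c (j + int p) = c j)"

definition variation :: "(int \<Rightarrow> real) \<Rightarrow> real" where
  "variation c = (SUP (i, j)\<in>UNIV. c i - c j)"

text \<open>\<open>S\<close> is the union of the \<open>p\<close> bands \<open>[u j, l (j + 1)]\<close>, \<open>j = 0, \<dots>, p - 1\<close>. Here \<open>l j\<close> and
  \<open>u j\<close> are the lower and upper end points \<open>\<mu>\<^sub>j\<^sup>-\<close> and \<open>\<mu>\<^sub>j\<^sup>+\<close> of the \<open>j\<close>-th gap, which is
  interior when \<open>1 \<le> j < p\<close>; the values \<open>l 0\<close> and \<open>u p\<close> play no role.\<close>

definition band_edges :: "nat \<Rightarrow> complex set \<Rightarrow> (nat \<Rightarrow> real) \<Rightarrow> (nat \<Rightarrow> real) \<Rightarrow> bool" where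
  "band_edges p S l u \<longleftrightarrow>
     S = (\<Union>j<p. of_real ` {u j..l (Suc j)}) \<and>
     (\<forall>j<p. u j < l (Suc j)) \<and>
     (\<forall>j\<in>{1..<p}. l j \<le> u j)"

text \<open>Closed gaps contribute the length \<open>0\<close>; inserting \<open>0\<close> only matters when there are no
  interior gaps.\<close>

definition max_gap_length :: "nat \<Rightarrow> (nat \<Rightarrow> real) \<Rightarrow> (nat \<Rightarrow> real) \<Rightarrow> real" where
  "max_gap_length p l u = Max (insert 0 ((\<lambda>j. u j - l j) ` {1..<p}))"

text \<open>If some gaps are closed, the set \<open>S\<close> does not determine the points at which neighbouring
  bands touch, but it does determine the maximal gap length, see \<open>max_gap_eq\<close> below.\<close>

definition max_gap :: "nat \<Rightarrow> complex set \<Rightarrow> real" where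
  "max_gap p S = (THE g. \<exists>l u. band_edges p S l u \<and> g = max_gap_length p l u)"

lemma band_edges_mono:
  assumes B: "band_edges p S l u" and "j < p"
  shows "i < j \<Longrightarrow> l (Suc i) \<le> u j"
  using \<open>j < p\<close>
proof (induction j)
  case 0
  then show ?case by simp
next
  case (Suc j)
  have g: "l (Suc j) \<le> u (Suc j)"
    using B Suc.prems unfolding band_edges_def by auto
  show ?case
  proof (cases "i = j")
    case True
    then show ?thesis using g by simp
  next
    case False
    then have "l (Suc i) \<le> u j" using Suc by simp
    moreover have "u j < l (Suc j)"
      using B Suc.prems unfolding band_edges_def by auto
    ultimately show ?thesis using g by linarith
  qed
qed

lemma band_edges_mem:
  assumes "band_edges p S l u"
  shows "complex_of_real x \<in> S \<longleftrightarrow> (\<exists>j<p. u j \<le> x \<and> x \<le> l (Suc j))"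
  using assms unfolding band_edges_def by (auto simp: image_iff)

lemma max_gap_length_nonneg: "0 \<le> max_gap_length p l u"
  unfolding max_gap_length_def by (intro Max_ge) auto

lemma max_gap_length_le:
  assumes B: "band_edges p S l u" and B': "band_edges p S l' u'"
  shows "max_gap_length p l u \<le> max_gap_length p l' u'"
proof -
  have "u j - l j \<le> max_gap_length p l' u'" if j: "j \<in> {1..<p}" for j
  proof (cases "l j < u j")
    case False
    then show ?thesis using max_gap_length_nonneg[of p l' u'] by linarith
  next
    case True
    obtain j0 where j0: "j = Suc j0" using j by (cases j) auto
    have band: "u j0 < l j" "u j < l (Suc j)"
      using B j j0 unfolding band_edges_def by auto
    have lS: "complex_of_real (l j) \<in> S"
      unfolding band_edges_mem[OF B] using band j j0 by (auto intro!: exI[of _ j0])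
    have uS: "complex_of_real (u j) \<in> S"
      unfolding band_edges_mem[OF B] using band j by (auto intro!: exI[of _ j])
    have gap: "complex_of_real x \<notin> S" if x: "l j < x" "x < u j" for x
    proof
      assume "complex_of_real x \<in> S"
      then obtain k where k: "k < p" "u k \<le> x" "x \<le> l (Suc k)"
        unfolding band_edges_mem[OF B] by blast
      show False
      proof (cases "k < j")
        case True
        have "l (Suc k) \<le> l j"
        proof (cases "k = j0")
          case False
          then have "l (Suc k) \<le> u j0" using True j0 j band_edges_mono[OF B, of j0 k] by simp
          moreover have "u j0 < l j" using B j j0 unfolding band_edges_def by auto
          ultimately show ?thesis by linarith
        qed (simp add: j0)
        then show False using k x by linarith
      next
        case False
        have "u j \<le> u k"
        proof (cases "k = j")
          case False
          then have "l (Suc j) \<le> u k" using \<open>\<not> k < j\<close> k band_edges_mono[OF B, of k j] by simp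
          moreover have "u j < l (Suc j)" using B j unfolding band_edges_def by auto
          ultimately show ?thesis by linarith
        qed simp
        then show False using k x by linarith
      qed
    qed
    obtain k where k: "k < p" "u' k \<le> l j" "l j \<le> l' (Suc k)"
      using lS unfolding band_edges_mem[OF B'] by blast
    have eq: "l' (Suc k) = l j"
    proof (rule ccontr)
      assume "l' (Suc k) \<noteq> l j"
      then have lt: "l j < min (l' (Suc k)) (u j)" using k True by simp
      then obtain x where x: "l j < x" "x < min (l' (Suc k)) (u j)" using dense by blast
      then have "complex_of_real x \<in> S"
        unfolding band_edges_mem[OF B'] using k by (auto intro!: exI[of _ k])
      then show False using gap x by simp
    qed
    obtain m where m: "m < p" "u' m \<le> u j" "u j \<le> l' (Suc m)"
      using uS unfolding band_edges_mem[OF B'] by blast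
    have "k < m"
    proof (rule ccontr)
      assume "\<not> k < m"
      moreover have "m \<noteq> k" using m eq True by auto
      ultimately have "l' (Suc m) \<le> u' k" using band_edges_mono[OF B', of k m] k by simp
      then show False using m k True by linarith
    qed
    then have Sk: "Suc k < p" using m by simp
    have edge: "l' (Suc k) \<le> u' (Suc k)" "u' (Suc k) < l' (Suc (Suc k))"
      using B' Sk unfolding band_edges_def by auto
    have "u j \<le> u' (Suc k)"
    proof (rule ccontr)
      assume "\<not> u j \<le> u' (Suc k)"
      then have "u' (Suc k) < min (l' (Suc (Suc k))) (u j)" using edge by simp
      then obtain x where x: "u' (Suc k) < x" "x < min (l' (Suc (Suc k))) (u j)"
        using dense by blast
      then have "complex_of_real x \<in> S"
        unfolding band_edges_mem[OF B'] using Sk by (auto intro!: exI[of _ "Suc k"])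
      then show False using gap[of x] x edge eq by simp
    qed
    then have "u j - l j \<le> u' (Suc k) - l' (Suc k)" using eq by simp
    also have "\<dots> \<le> max_gap_length p l' u'"
      unfolding max_gap_length_def using Sk by (intro Max_ge) auto
    finally show ?thesis .
  qed
  then show ?thesis
    unfolding max_gap_length_def[of p l u] using max_gap_length_nonneg[of p l' u'] by auto
qed

lemma max_gap_eq:
  assumes "band_edges p S l u"
  shows "max_gap p S = max_gap_length p l u"
  unfolding max_gap_def
proof (rule the_equality)
  show "\<exists>l' u'. band_edges p S l' u' \<and> max_gap_length p l u = max_gap_length p l' u'"
    using assms by blast
next
  fix g assume "\<exists>l' u'. band_edges p S l' u' \<and> g = max_gap_length p l' u'"
  then show "g = max_gap_length p l u"
    using assms by (auto intro: antisym max_gap_length_le)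
qed

end

theory Submission
  imports Defs "HOL-Computational_Algebra.Fundamental_Theorem_Algebra"
begin

text \<open>By Floquet theory the spectrum is the set where the discriminant \<open>Delta\<close> (the trace of the
  monodromy matrix) satisfies \<open>|Delta| \<le> 2\<close>. Cut the matrix at a site \<open>n\<close> and impose the boundary
  condition \<open>y\<^sub>n\<^sub>+\<^sub>1 = t y\<^sub>n\<close> one period apart. At each eigenvalue of this boundary value problem
  \<open>|Delta| \<ge> 2\<close>, with alternating signs, so exactly one eigenvalue lies in each closed gap, and one
  more lies at or above the top of the spectrum when \<open>t > 0\<close>. The trace of the boundary value
  problem is \<open>\<Sum>b - b\<^sub>n\<close> in the Dirichlet case and \<open>\<Sum>b + a\<^sub>n (t + 1 / t)\<close> for \<open>t > 0\<close>. The first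
  gives the bound on the variation of \<open>b\<close>. The second, at \<open>t = 1\<close> (lower bound) and at the ratio \<open>t\<close>
  for which the extra eigenvalue is exactly the top of the spectrum (upper bound), determines \<open>2 a\<^sub>n\<close>
  up to the sum of the gap lengths. The last inequality compares the matrix with a constant one.\<close>

section \<open>Polynomials with simple real roots\<close>

text \<open>The spectrum is given only through bounded inverses, so the set
  \<open>|Delta| \<le> 2\<close> has to be reached from there: on it, truncated Floquet solutions
  are approximate eigenvectors; off it, a solution decaying to the right and one decaying to the
  left build an exponentially decaying Green kernel. The signs at the eigenvalues rest on one
  Wronskian identity. If Q is the boundary value polynomial and m the multiplier at a root, then m
  Q' is a positive multiple of a sum of squares while m Delta = m^2 + 1. So Delta has the sign of
  Q', which alternates along simple real roots. The special ratio t in the upper bound is forced by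
  the extra eigenvalue: it lies above all gaps, so no gap edge bounds it from above. With W the sum
  of the gap lengths this yields omega_b \<le> W and 2 omega_a \<le> W, where W \<le> (p - 1)
  |gamma|; the stated powers of p follow by weakening. The constant 1/4 arises since replacing J by
  a constant matrix costs at most omega_b + 2 omega_a in norm, and half a gap cannot exceed this
  cost.\<close>

lemma poly_map_poly_of_real: "poly (map_poly of_real q) (of_real x :: 'a::{real_algebra_1,comm_semiring_0}) = of_real (poly q x)"
  by (induction q) (auto simp: map_poly_pCons)

lemma pderiv_map_poly_of_real:
  "pderiv (map_poly of_real q :: 'a::real_normed_field poly) = map_poly of_real (pderiv q)"
  by (rule poly_eqI) (simp add: coeff_pderiv coeff_map_poly)

lemma card_subset_poly_roots:
  fixes P :: "'a::{comm_ring_1,ring_no_zero_divisors} poly"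
  assumes "P \<noteq> 0" "A \<subseteq> {x. poly P x = 0}"
  shows "card A \<le> degree P"
  using card_mono[OF poly_roots_finite[OF assms(1)] assms(2)] card_poly_roots_bound[OF assms(1)]
  by (rule order_trans)

text \<open>A squarefree complex polynomial has as many distinct roots as its degree. Since all
  roots are real, this is also the number of real roots of \<open>Q\<close>, and their sorted list
  is the increasing enumeration.\<close>

lemma real_rooted_simple_poly_enum:
  fixes Q :: "real poly"
  assumes Q0: "Q \<noteq> 0"
    and real: "\<And>z. poly (map_poly complex_of_real Q) z = 0 \<Longrightarrow> z \<in> \<real>"
    and simple: "\<And>x. poly Q x = 0 \<Longrightarrow> poly (pderiv Q) x \<noteq> 0"
  obtains e where "strict_mono_on {..<degree Q} e"
    and "Q = smult (lead_coeff Q) (\<Prod>i<degree Q. [:- e i, 1:])"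
proof -
  define R where "R = {x. poly Q x = 0}"
  define C where "C = map_poly complex_of_real Q"
  have C0: "degree C = degree Q" by (simp add: C_def degree_map_poly)
  have roots: "{z. poly C z = 0} = of_real ` R"
  proof (intro equalityI subsetI)
    fix z assume "z \<in> {z. poly C z = 0}"
    then obtain x where "z = of_real x" and "poly C z = 0"
      using real unfolding C_def by (auto elim: Reals_cases)
    then show "z \<in> of_real ` R"
      unfolding C_def R_def by (simp add: poly_map_poly_of_real)
  qed (auto simp: C_def R_def poly_map_poly_of_real)
  have "rsquarefree C"
    unfolding rsquarefree_roots
  proof (intro allI notI, elim conjE)
    fix z assume z: "poly C z = 0" "poly (pderiv C) z = 0"
    then obtain x where x: "z = of_real x" "poly Q x = 0"
      using roots unfolding R_def by auto
    with z(2) have "poly (pderiv Q) x = 0"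
      by (simp add: C_def pderiv_map_poly_of_real poly_map_poly_of_real)
    with simple x show False by blast
  qed
  note complex_poly_decompose_rsquarefree[OF this]
  moreover have "lead_coeff C \<noteq> 0" using Q0 C0 by (auto simp: C_def coeff_map_poly)
  ultimately have "degree C = degree (\<Prod>z | poly C z = 0. [:- z, 1:])"
    using degree_smult_eq[of "lead_coeff C" "\<Prod>z | poly C z = 0. [:- z, 1:]"] by simp
  also have "\<dots> = card {z. poly C z = 0}"
    by (subst degree_prod_eq_sum_degree) auto
  finally have card: "card R = degree Q"
    using card_image[of complex_of_real R] by (simp add: C0 roots inj_on_def)
  have fin: "finite R" unfolding R_def using Q0 by (rule poly_roots_finite)
  define e where "e i = sorted_list_of_set R ! i" for i
  have len: "length (sorted_list_of_set R) = degree Q" using card fin by simp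
  have mono: "strict_mono_on {..<degree Q} e"
    unfolding strict_mono_on_def e_def
    using sorted_wrt_nth_less[OF strict_sorted_list_of_set[of R]] len by auto
  have bij: "bij_betw e {..<degree Q} R"
    using bij_betw_nth[of "sorted_list_of_set R" "{..<degree Q}" R] len fin
    by (simp add: e_def[abs_def])
  define P where "P = smult (lead_coeff Q) (\<Prod>i<degree Q. [:- e i, 1:])"
  have dP: "degree P = degree Q"
    using Q0 by (simp add: P_def degree_prod_eq_sum_degree)
  have lP: "coeff P (degree Q) = lead_coeff Q"
  proof -
    have "coeff P (degree P) = lead_coeff Q"
      unfolding P_def lead_coeff_smult lead_coeff_prod by simp
    then show ?thesis by (simp add: dP)
  qed
  \<comment> \<open>The leading coefficients agree, so a nonzero difference would have degree below
    \<open>degree Q\<close> while vanishing at the \<open>degree Q\<close> points of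
    \<open>R\<close>.\<close>
  have "Q = P"
  proof (rule ccontr)
    assume "Q \<noteq> P"
    then have ne: "Q - P \<noteq> 0" by simp
    have "R \<subseteq> {x. poly (Q - P) x = 0}"
    proof
      fix x assume x: "x \<in> R"
      then obtain i where "i < degree Q" "e i = x"
        using bij unfolding bij_betw_def by auto
      then have "poly P x = 0" unfolding P_def by (auto simp: poly_prod)
      then show "x \<in> {x. poly (Q - P) x = 0}" using x by (simp add: R_def)
    qed
    then have "card R \<le> degree (Q - P)" by (rule card_subset_poly_roots[OF ne])
    moreover have "degree (Q - P) \<le> degree Q" using dP by (metis degree_diff_le order_refl)
    ultimately have "degree (Q - P) = degree Q" using card by simp
    then have "coeff (Q - P) (degree Q) \<noteq> 0" using ne leading_coeff_neq_0[OF ne] by simp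
    then show False using lP by simp
  qed
  then show thesis using that mono P_def by blast
qed

text \<open>Exactly the \<open>d - 1 - i\<close> factors with \<open>j > i\<close> are
  negative.\<close>

lemma prod_linear_sign:
  fixes e :: "nat \<Rightarrow> real"
  assumes "strict_mono_on {..<d} e" "i < d"
  shows "0 < (-1) ^ (d - 1 - i) * (\<Prod>j\<in>{..<d} - {i}. e i - e j)"
proof -
  have split: "{..<d} - {i} = {..<i} \<union> {i<..<d}" using assms(2) by auto
  have *: "(\<Prod>j\<in>{..<d} - {i}. e i - e j) = (\<Prod>j<i. e i - e j) * (\<Prod>j\<in>{i<..<d}. e i - e j)"
    unfolding split by (rule prod.union_disjoint) auto
  have "(\<Prod>j\<in>{i<..<d}. e i - e j) = (\<Prod>j\<in>{i<..<d}. (-1) * (e j - e i))" by simp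
  also have "\<dots> = (-1) ^ (d - 1 - i) * (\<Prod>j\<in>{i<..<d}. e j - e i)"
    by (subst prod.distrib) simp
  finally have "(-1) ^ (d - 1 - i) * (\<Prod>j\<in>{..<d} - {i}. e i - e j) =
      ((-1) ^ (d - 1 - i))\<^sup>2 * ((\<Prod>j<i. e i - e j) * (\<Prod>j\<in>{i<..<d}. e j - e i))"
    unfolding * by (simp add: power2_eq_square)
  also have "((-1) ^ (d - 1 - i))\<^sup>2 = (1::real)" by (simp flip: power_mult)
  also have "0 < 1 * ((\<Prod>j<i. e i - e j) * (\<Prod>j\<in>{i<..<d}. e j - e i))"
    using assms by (auto intro!: mult_pos_pos prod_pos simp: strict_mono_on_def)
  finally show ?thesis .
qed

lemma poly_pderiv_prod_linear:
  fixes e :: "nat \<Rightarrow> real"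
  assumes "i < d"
  shows "poly (pderiv (\<Prod>j<d. [:- e j, 1:])) (e i) = (\<Prod>j\<in>{..<d} - {i}. e i - e j)"
proof -
  have "poly (pderiv (\<Prod>j<d. [:- e j, 1:])) (e i) = (\<Sum>k<d. \<Prod>j\<in>{..<d} - {k}. e i - e j)"
    by (simp add: pderiv_prod poly_sum poly_prod pderiv_pCons)
  also have "\<dots> = (\<Sum>k<d. if k = i then (\<Prod>j\<in>{..<d} - {i}. e i - e j) else 0)"
    using assms by (intro sum.cong) (auto intro!: prod_zero)
  also have "\<dots> = (\<Prod>j\<in>{..<d} - {i}. e i - e j)"
    using assms by simp
  finally show ?thesis .
qed

text \<open>This coefficient carries the trace: for a boundary value polynomial it yields the sum of
  the eigenvalues.\<close>

lemma coeff_prod_linear_second: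
  fixes e :: "nat \<Rightarrow> 'a::idom"
  shows "coeff (\<Prod>j<Suc d. [:- e j, 1:]) d = - (\<Sum>j<Suc d. e j)"
proof (induction d)
  case (Suc d)
  let ?P = "\<Prod>j<Suc d. [:- e j, 1:]"
  have "degree ?P = Suc d" by (subst degree_prod_eq_sum_degree) auto
  moreover have "lead_coeff ?P = 1" by (subst lead_coeff_prod) simp
  ultimately have "coeff ?P (Suc d) = 1" by simp
  moreover have "coeff (\<Prod>j<Suc (Suc d). [:- e j, 1:]) (Suc d) = coeff ?P d - e (Suc d) * coeff ?P (Suc d)"
    by (subst prod.lessThan_Suc) (simp add: mult.commute[of ?P] del: prod.lessThan_Suc)
  ultimately show ?case using Suc.IH by simp
qed simp

section \<open>Band structure of an oscillating polynomial\<close>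

text \<open>The exponent \<open>p - j\<close> counts the bands between the j-th gap and the
  half-line above \<open>l p\<close>, each of which reverses the sign of \<open>D\<close>. The gap
  intervals include their end points because an eigenvalue of a boundary value problem may sit at a
  gap edge, and the Dirichlet eigenvalue belonging to a closed gap has to.\<close>

definition oscillates :: "nat \<Rightarrow> real poly \<Rightarrow> (nat \<Rightarrow> real) \<Rightarrow> (nat \<Rightarrow> real) \<Rightarrow> bool" where
  "oscillates p D l u \<longleftrightarrow>
     (\<forall>j<p. u j < l (Suc j)) \<and>
     (\<forall>j\<in>{1..<p}. l j \<le> u j) \<and>
     (\<forall>j<p. \<forall>x. u j < x \<longrightarrow> x < l (Suc j) \<longrightarrow> \<bar>poly D x\<bar> < 2) \<and>
     (\<forall>j\<in>{1..<p}. \<forall>x\<in>{l j..u j}. 2 \<le> (-1) ^ (p - j) * poly D x) \<and>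
     (\<forall>x\<ge>l p. 2 \<le> poly D x) \<and>
     (\<forall>x\<le>u 0. 2 \<le> (-1) ^ p * poly D x) \<and>
     poly D (l p) = 2 \<and>
     {x. \<bar>poly D x\<bar> \<le> 2} = (\<Union>j<p. {u j..l (Suc j)})"

lemma oscillatesD:
  assumes "oscillates p D l u"
  shows "j < p \<Longrightarrow> u j < l (Suc j)"
    and "1 \<le> j \<Longrightarrow> j < p \<Longrightarrow> l j \<le> u j"
    and "j < p \<Longrightarrow> u j < x \<Longrightarrow> x < l (Suc j) \<Longrightarrow> \<bar>poly D x\<bar> < 2"
    and "1 \<le> j \<Longrightarrow> j < p \<Longrightarrow> l j \<le> x \<Longrightarrow> x \<le> u j \<Longrightarrow> 2 \<le> (-1) ^ (p - j) * poly D x"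
    and "l p \<le> x \<Longrightarrow> 2 \<le> poly D x"
    and "x \<le> u 0 \<Longrightarrow> 2 \<le> (-1) ^ p * poly D x"
    and "poly D (l p) = 2"
    and "{x. \<bar>poly D x\<bar> \<le> 2} = (\<Union>j<p. {u j..l (Suc j)})"
proof -
  note 1 = assms[unfolded oscillates_def, THEN conjunct1]
  note r1 = assms[unfolded oscillates_def, THEN conjunct2]
  note r2 = r1[THEN conjunct2] note r3 = r2[THEN conjunct2] note r4 = r3[THEN conjunct2]
  note r5 = r4[THEN conjunct2] note r6 = r5[THEN conjunct2]
  show "j < p \<Longrightarrow> u j < l (Suc j)" using 1 by simp
  show "1 \<le> j \<Longrightarrow> j < p \<Longrightarrow> l j \<le> u j" using r1[THEN conjunct1] by simp
  show "j < p \<Longrightarrow> u j < x \<Longrightarrow> x < l (Suc j) \<Longrightarrow> \<bar>poly D x\<bar> < 2" using r2[THEN conjunct1] by simp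
  show "1 \<le> j \<Longrightarrow> j < p \<Longrightarrow> l j \<le> x \<Longrightarrow> x \<le> u j \<Longrightarrow> 2 \<le> (-1) ^ (p - j) * poly D x"
    using r3[THEN conjunct1] by simp
  show "l p \<le> x \<Longrightarrow> 2 \<le> poly D x" using r4[THEN conjunct1] by simp
  show "x \<le> u 0 \<Longrightarrow> 2 \<le> (-1) ^ p * poly D x" using r5[THEN conjunct1] by simp
  show "poly D (l p) = 2" by (rule r6[THEN conjunct1])
  show "{x. \<bar>poly D x\<bar> \<le> 2} = (\<Union>j<p. {u j..l (Suc j)})" by (rule r6[THEN conjunct2])
qed

text \<open>\<open>u\<close> is the last point with \<open>f \<le> r\<close> and \<open>l\<close>
  the first point after it with \<open>s \<le> f\<close>; the intermediate value theorem turns both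
  inequalities into equalities.\<close>

lemma crossing_interval:
  fixes f :: "real \<Rightarrow> real"
  assumes "continuous_on {\<alpha>..\<beta>} f" "\<alpha> \<le> \<beta>" "f \<alpha> \<le> r" "s \<le> f \<beta>" "r < s"
  obtains u l where "\<alpha> \<le> u" "u < l" "l \<le> \<beta>" "f u = r" "f l = s"
    "\<And>x. u < x \<Longrightarrow> x < l \<Longrightarrow> r < f x \<and> f x < s"
proof -
  define U where "U = {x\<in>{\<alpha>..\<beta>}. f x \<le> r}"
  have "closed U" unfolding U_def
    by (intro continuous_closed_preimage_constant[of "{\<alpha>..\<beta>}", simplified] continuous_on_closed_Collect_le assms continuous_on_const closed_atLeastAtMost)
  then have "compact U"
    by (auto simp: U_def compact_eq_bounded_closed intro: bounded_subset[OF bounded_closed_interval])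
  moreover have "\<alpha> \<in> U" using assms by (auto simp: U_def)
  ultimately obtain u where u: "u \<in> U" "\<And>x. x \<in> U \<Longrightarrow> x \<le> u"
    using compact_attains_sup[of U] by blast
  then have u': "\<alpha> \<le> u" "u \<le> \<beta>" "f u \<le> r" by (auto simp: U_def)
  have above: "r < f x" if "u < x" "x \<le> \<beta>" for x
    using u(2)[of x] that u' by (force simp: U_def)
  have cont: "continuous_on {u..\<beta>} f"
    by (rule continuous_on_subset[OF assms(1)]) (use u' in auto)
  have fu: "f u = r"
  proof (rule ccontr)
    assume "f u \<noteq> r"
    then have "f u < r" using u' by simp
    moreover have "\<exists>x. u \<le> x \<and> x \<le> \<beta> \<and> f x = r"
      using u' assms cont by (intro IVT') auto
    then obtain x where "u \<le> x" "x \<le> \<beta>" "f x = r" by blast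
    ultimately show False using above[of x] by (cases "x = u") auto
  qed
  define L where "L = {x\<in>{u..\<beta>}. s \<le> f x}"
  have "closed L" unfolding L_def
    by (intro continuous_on_closed_Collect_le cont continuous_on_const closed_atLeastAtMost)
  then have "compact L"
    by (auto simp: L_def compact_eq_bounded_closed intro: bounded_subset[OF bounded_closed_interval])
  moreover have "\<beta> \<in> L" using assms u' by (auto simp: L_def)
  ultimately obtain l where l: "l \<in> L" "\<And>x. x \<in> L \<Longrightarrow> l \<le> x"
    using compact_attains_inf[of L] by blast
  then have l': "u \<le> l" "l \<le> \<beta>" "s \<le> f l" by (auto simp: L_def)
  have below: "f x < s" if "u \<le> x" "x < l" for x
    using l(2)[of x] that l' by (force simp: L_def)
  have ul: "u < l" using l' fu assms(5) by (cases "u = l") auto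
  have fl: "f l = s"
  proof (rule ccontr)
    assume "f l \<noteq> s"
    then have "s < f l" using l' by simp
    moreover have "\<exists>x. u \<le> x \<and> x \<le> l \<and> f x = s"
      using u' l' fu assms continuous_on_subset[OF cont, of "{u..l}"] by (intro IVT') auto
    then obtain x where "u \<le> x" "x \<le> l" "f x = s" by blast
    ultimately show False using below[of x] by (cases "x = l") auto
  qed
  show thesis
    by (rule that[OF u'(1) ul l'(2) fu fl]) (use above below l' in auto)
qed

lemma poly_eventually_gt:
  fixes D :: "real poly"
  assumes "lead_coeff D > 0" "degree D > 0"
  shows "\<exists>R. \<forall>x\<ge>R. c < poly D x"
proof -
  have "degree (D - [:c:]) = degree D"
    using assms(2) degree_add_eq_left[of "[:- c:]" D] by (simp add: diff_conv_add_uminus del: add_uminus_conv_diff)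
  then have "lead_coeff (D - [:c:]) = lead_coeff D"
    using assms(2) by (simp add: coeff_pCons split: nat.split)
  then obtain R where "\<forall>x\<ge>R. lead_coeff D \<le> poly (D - [:c:]) x"
    using poly_pinfty_gt_lc[of "D - [:c:]"] assms(1) by metis
  then have "\<forall>x\<ge>R. c < poly D x" using assms(1) by fastforce
  then show ?thesis by blast
qed

lemma poly_eventually_gt_at_bot:
  fixes D :: "real poly"
  assumes "lead_coeff D > 0" "degree D > 0"
  shows "\<exists>L. \<forall>x\<le>L. c < (-1) ^ degree D * poly D x"
proof -
  define E where "E = smult ((-1) ^ degree D) (pcompose D [:0, -1:])"
  have deg: "degree E = degree D" by (simp add: E_def degree_pcompose)
  have "lead_coeff (pcompose D [:0, -1:]) = lead_coeff D * (-1) ^ degree D"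
    by (subst lead_coeff_comp) auto
  then have "lead_coeff E = lead_coeff D"
    by (simp add: E_def lead_coeff_smult flip: power_mult_distrib)
  then obtain R where R: "\<forall>x\<ge>R. c < poly E x"
    using poly_eventually_gt[of E c] assms deg by auto
  have "poly E (- x) = (-1) ^ degree D * poly D x" for x by (simp add: E_def poly_pcompose)
  moreover have "c < poly E (- x)" if "x \<le> - R" for x using R that by simp
  ultimately show ?thesis by (intro exI[of _ "- R"]) auto
qed

lemma nested_chain:
  fixes c u l :: "nat \<Rightarrow> real"
  assumes "\<And>i j. i < j \<Longrightarrow> j \<le> p \<Longrightarrow> c i < c j" "\<And>j. j < p \<Longrightarrow> c j \<le> u j \<and> u j < l (Suc j) \<and> l (Suc j) \<le> c (Suc j)"
    and "i < j" "j < p"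
  shows "l (Suc i) \<le> u j"
proof -
  have "c (Suc i) \<le> c j" using assms(1)[of "Suc i" j] assms(3,4) by (cases "Suc i = j") auto
  then show ?thesis using assms(2)[of i] assms(2)[of j] assms(3,4) by linarith
qed

text \<open>Counting roots of \<open>D - v\<close> for \<open>\<bar>v\<bar> < 2\<close> leaves no room outside the bands. A point outside
  them with \<open>\<bar>D\<bar> = 2\<close> is critical, and together with one further critical point per gap it would
  be one too many for the derivative.\<close>

lemma oscillates_exists:
  fixes D :: "real poly"
  assumes deg: "degree D = p" and p: "0 < p" and lc: "lead_coeff D > 0"
    and mono: "strict_mono_on {..<p - 1} e"
    and alt: "\<And>i. i < p - 1 \<Longrightarrow> 2 \<le> (-1) ^ (p - 1 - i) * poly D (e i)"
  shows "\<exists>l u. oscillates p D l u"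
proof -
  obtain R0 where R0: "\<And>x. x \<ge> R0 \<Longrightarrow> 2 < poly D x"
    using poly_eventually_gt[of D 2] deg p lc by auto
  obtain L0 where L0: "\<And>x. x \<le> L0 \<Longrightarrow> 2 < (-1) ^ p * poly D x"
    using poly_eventually_gt_at_bot[of D 2] deg p lc by auto
  \<comment> \<open>The point 0 keeps the set nonempty for \<open>p = 1\<close>, so that
    \<open>Min\<close> and \<open>Max\<close> are meaningful.\<close>
  define S where "S = insert 0 (e ` {..<p - 1})"
  have finS: "finite S" by (simp add: S_def)
  define L where "L = min L0 (Min S) - 1"
  define R where "R = max R0 (Max S) + 1"
  have LS: "L < x" "x < R" if "x \<in> S" for x
  proof -
    have "Min S \<le> x" "x \<le> Max S" using that finS by auto
    then show "L < x" "x < R" by (simp_all add: L_def R_def)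
  qed
  have L0L: "L \<le> L0" "R0 \<le> R" unfolding L_def R_def by linarith+
  have LR: "L < R" using LS[of 0] by (simp add: S_def)
  \<comment> \<open>With one point far to the left and one far to the right added to the given ones,
    there are p + 1 points where \<open>|D| \<ge> 2\<close> with alternating signs. Each of the p
    intervals between them contains a full crossing between the levels -2 and 2, which becomes a
    band.\<close>
  define c where "c k = (if k = 0 then L else if k = p then R else e (k - 1))" for k
  have cmono: "c i < c j" if "i < j" "j \<le> p" for i j
  proof (cases "0 < i \<and> j < p")
    case True
    then have "e (i - 1) < e (j - 1)" using that by (intro strict_mono_onD[OF mono]) auto
    then show ?thesis using True that by (simp add: c_def)
  qed (use that LS LR in \<open>auto simp: c_def S_def\<close>)
  have csign: "2 \<le> (-1) ^ (p - k) * poly D (c k)" if k: "k \<le> p" for k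
  proof -
    consider "k = 0" | "k = p" "k \<noteq> 0" | "0 < k" "k < p" using k by linarith
    then show ?thesis
    proof cases
      case 1
      then show ?thesis using L0[of L] L0L by (simp add: c_def)
    next
      case 2
      then show ?thesis using R0[of R] L0L by (simp add: c_def)
    next
      case 3
      then show ?thesis using alt[of "k - 1"] by (simp add: c_def)
    qed
  qed
  have "\<exists>u l. c j \<le> u \<and> u < l \<and> l \<le> c (Suc j) \<and>
      (-1) ^ (p - Suc j) * poly D u = -2 \<and> (-1) ^ (p - Suc j) * poly D l = 2 \<and>
      (\<forall>x. u < x \<longrightarrow> x < l \<longrightarrow> \<bar>poly D x\<bar> < 2)" if j: "j < p" for j
  proof -
    let ?f = "\<lambda>x. (-1) ^ (p - Suc j) * poly D x"
    have pj: "p - j = Suc (p - Suc j)" using j by simp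
    have 1: "?f (c j) \<le> -2" using csign[of j] j by (simp add: pj)
    have 2: "2 \<le> ?f (c (Suc j))" using csign[of "Suc j"] j by simp
    have 3: "c j \<le> c (Suc j)" using cmono[of j "Suc j"] j by simp
    have 4: "continuous_on {c j..c (Suc j)} ?f" by (intro continuous_intros)
    obtain u l where ul: "c j \<le> u" "u < l" "l \<le> c (Suc j)" "?f u = -2" "?f l = 2"
      "\<And>x. u < x \<Longrightarrow> x < l \<Longrightarrow> -2 < ?f x \<and> ?f x < 2"
      using crossing_interval[OF 4 3 1 2] by auto
    have "\<bar>poly D x\<bar> = \<bar>?f x\<bar>" for x by (simp add: abs_mult power_abs)
    then have "\<forall>x. u < x \<longrightarrow> x < l \<longrightarrow> \<bar>poly D x\<bar> < 2"
      using ul(6) by (auto simp: abs_less_iff) (smt (verit))+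
    then show ?thesis using ul by blast
  qed
  then obtain u l' where ul: "\<And>j. j < p \<Longrightarrow> c j \<le> u j \<and> u j < l' j \<and> l' j \<le> c (Suc j)"
    and uv: "\<And>j. j < p \<Longrightarrow> (-1) ^ (p - Suc j) * poly D (u j) = -2"
    and lv: "\<And>j. j < p \<Longrightarrow> (-1) ^ (p - Suc j) * poly D (l' j) = 2"
    and inner: "\<And>j x. j < p \<Longrightarrow> u j < x \<Longrightarrow> x < l' j \<Longrightarrow> \<bar>poly D x\<bar> < 2"
    by metis
  define l where "l j = l' (j - 1)" for j
  have lS [simp]: "l (Suc j) = l' j" for j by (simp add: l_def)
  have lj: "l j \<le> c j" if "1 \<le> j" "j \<le> p" for j using ul[of "j - 1"] that by (simp add: l_def)
  have chain: "l' i \<le> u j" if "i < j" "j < p" for i j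
    using nested_chain[of p c u l i j] cmono ul that by auto
  have inside: "\<exists>j<p. u j < y \<and> y < l' j" if y: "\<bar>poly D y\<bar> < 2" for y
  proof (rule ccontr)
    assume no: "\<not> ?thesis"
    define v where "v = poly D y"
    have "\<exists>x. u j < x \<and> x < l' j \<and> poly D x = v" if j: "j < p" for j
    proof -
      let ?f = "\<lambda>x. (-1) ^ (p - Suc j) * poly D x"
      have "\<bar>(-1) ^ (p - Suc j) * v\<bar> < 2" using y by (simp add: abs_mult power_abs v_def)
      then have "?f (u j) \<le> (-1) ^ (p - Suc j) * v" "(-1) ^ (p - Suc j) * v \<le> ?f (l' j)"
        using uv[OF j] lv[OF j] by linarith+
      moreover have "continuous_on {u j..l' j} ?f" by (intro continuous_intros)
      ultimately obtain x where x: "u j \<le> x" "x \<le> l' j" "?f x = (-1) ^ (p - Suc j) * v"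
        using IVT'[of ?f "u j" "(-1) ^ (p - Suc j) * v" "l' j"] ul[OF j] by auto
      then have "x \<noteq> u j" "x \<noteq> l' j"
        using \<open>\<bar>(-1) ^ (p - Suc j) * v\<bar> < 2\<close> uv[OF j] lv[OF j] by auto
      then show ?thesis using x by (intro exI[of _ x]) auto
    qed
    then obtain g where g: "\<And>j. j < p \<Longrightarrow> u j < g j \<and> g j < l' j \<and> poly D (g j) = v" by metis
    have glt: "g i < g j" if "i < j" "j < p" for i j
      using g[of i] g[of j] chain[OF that] that by linarith
    then have inj: "inj_on g {..<p}" by (auto simp: inj_on_def) (metis less_irrefl nat_neq_iff)
    have "y \<notin> g ` {..<p}" using no g by auto
    then have c1: "card (insert y (g ` {..<p})) = Suc p" by (simp add: card_image inj)
    have ne: "D - [:v:] \<noteq> 0" using deg p by auto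
    have "insert y (g ` {..<p}) \<subseteq> {x. poly (D - [:v:]) x = 0}" using g by (auto simp: v_def)
    then have "Suc p \<le> degree (D - [:v:])"
      using card_subset_poly_roots[OF ne] c1 by metis
    also have "degree (D - [:v:]) \<le> p" using degree_diff_le[of D p "[:v:]"] deg by simp
    finally show False by simp
  qed
  \<comment> \<open>\<open>|D| \<ge> 2\<close> on the whole stretch between neighbouring bands, so
    \<open>D\<close> has no zero there, and the known sign at the test point \<open>c j\<close>
    carries over to \<open>x\<close>.\<close>
  have sign: "2 \<le> (-1) ^ (p - j) * poly D x"
    if j: "j \<le> p" and lo: "j \<noteq> 0 \<Longrightarrow> l j \<le> x" and hi: "j \<noteq> p \<Longrightarrow> x \<le> u j" for j x
  proof -
    have far: "2 \<le> \<bar>poly D y\<bar>" if y: "j \<noteq> 0 \<Longrightarrow> l j \<le> y" "j \<noteq> p \<Longrightarrow> y \<le> u j" for y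
    proof (rule ccontr)
      assume "\<not> ?thesis"
      then obtain k where k: "k < p" "u k < y" "y < l' k" using inside[of y] by auto
      show False
      proof (cases "k < j")
        case True
        have "l' k \<le> l j"
        proof (cases "k = j - 1")
          case False
          then have "k < j - 1" "j - 1 < p" using True j by linarith+
          then show ?thesis using chain[of k "j - 1"] ul[of "j - 1"] by (simp add: l_def)
        qed (simp add: l_def)
        then show False using y k True by auto
      next
        case False
        then have "u j \<le> u k" using chain[of j k] ul[of j] k by (cases "k = j") auto
        then show False using y k False by auto
      qed
    qed
    have cj: "(j \<noteq> 0 \<longrightarrow> l j \<le> c j) \<and> (j \<noteq> p \<longrightarrow> c j \<le> u j)" using lj[of j] ul[of j] j by auto
    show ?thesis
    proof (rule ccontr)
      assume neg: "\<not> ?thesis"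
      have "2 \<le> \<bar>(-1) ^ (p - j) * poly D x\<bar>" using far[of x] lo hi by (simp add: abs_mult power_abs)
      then have "(-1) ^ (p - j) * poly D x \<le> 0" using neg by linarith
      moreover have "0 \<le> (-1) ^ (p - j) * poly D (c j)" using csign[OF j] by linarith
      moreover have "continuous_on A (\<lambda>x. (-1) ^ (p - j) * poly D x)" for A by (intro continuous_intros)
      ultimately obtain y where y: "min x (c j) \<le> y" "y \<le> max x (c j)" "(-1) ^ (p - j) * poly D y = 0"
        using IVT'[of "\<lambda>x. (-1) ^ (p - j) * poly D x" x 0 "c j"]
          IVT2'[of "\<lambda>x. (-1) ^ (p - j) * poly D x" x 0 "c j"]
        by (cases "x \<le> c j") auto
      have "2 \<le> \<bar>poly D y\<bar>" using y lo hi cj by (intro far) auto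
      then show False using y(3) by simp
    qed
  qed
  have set_eq: "{x. \<bar>poly D x\<bar> \<le> 2} = (\<Union>j<p. {u j..l (Suc j)})"
  proof (intro equalityI subsetI)
    fix x assume "x \<in> (\<Union>j<p. {u j..l (Suc j)})"
    then obtain j where j: "j < p" "u j \<le> x" "x \<le> l' j" by auto
    have "\<bar>(-1) ^ (p - Suc j) * poly D (u j)\<bar> = 2" "\<bar>(-1) ^ (p - Suc j) * poly D (l' j)\<bar> = 2"
      using uv lv j by simp_all
    then have "\<bar>poly D (u j)\<bar> = 2" "\<bar>poly D (l' j)\<bar> = 2" by (simp_all add: abs_mult power_abs)
    then show "x \<in> {x. \<bar>poly D x\<bar> \<le> 2}" using inner[of j x] j by (cases "x = u j"; cases "x = l' j") auto
  next
    fix x assume "x \<in> {x. \<bar>poly D x\<bar> \<le> 2}"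
    then have x: "\<bar>poly D x\<bar> \<le> 2" by simp
    show "x \<in> (\<Union>j<p. {u j..l (Suc j)})"
    proof (rule ccontr)
      assume out: "\<not> ?thesis"
      then have x2: "\<bar>poly D x\<bar> = 2" using inside[of x] x by force
      have Dd: "(poly D has_real_derivative poly (pderiv D) y) (at y)" for y by (rule poly_DERIV)
      \<comment> \<open>The complement of the bands is open and \<open>|D| \<ge> 2\<close> on it, so
        the square of \<open>D\<close> has a local minimum at \<open>x\<close>.\<close>
      have crit_x: "poly (pderiv D) x = 0"
      proof -
        have "open (- (\<Union>j<p. {u j..l (Suc j)}))" by (intro open_Compl closed_UN) auto
        moreover have "x \<in> - (\<Union>j<p. {u j..l (Suc j)})" using out by blast
        ultimately obtain \<epsilon> where "\<epsilon> > 0" and "\<forall>y. dist y x < \<epsilon> \<longrightarrow> y \<in> - (\<Union>j<p. {u j..l (Suc j)})"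
          unfolding open_dist by blast
        then have \<epsilon>: "\<epsilon> > 0" "\<And>y. \<bar>x - y\<bar> < \<epsilon> \<Longrightarrow> y \<notin> (\<Union>j<p. {u j..l (Suc j)})"
          unfolding dist_real_def by (auto simp only: Compl_iff abs_minus_commute)
        have "((\<lambda>y. (poly D y)\<^sup>2) has_real_derivative (2 * poly D x * poly (pderiv D) x)) (at x)"
          by (auto intro!: derivative_eq_intros Dd)
        moreover have "\<forall>y. \<bar>x - y\<bar> < \<epsilon> \<longrightarrow> (poly D x)\<^sup>2 \<le> (poly D y)\<^sup>2"
        proof (intro allI impI)
          fix y assume "\<bar>x - y\<bar> < \<epsilon>"
          then have "2 \<le> \<bar>poly D y\<bar>" using \<epsilon>(2)[of y] inside[of y] by force
          then show "(poly D x)\<^sup>2 \<le> (poly D y)\<^sup>2" using x2 by (intro power2_le_iff_abs_le[THEN iffD2] abs_le_square_iff[THEN iffD1]) auto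
        qed
        ultimately have "2 * poly D x * poly (pderiv D) x = 0" by (rule DERIV_local_min[OF _ \<epsilon>(1)])
        then show ?thesis using x2 by auto
      qed
      \<comment> \<open>At a closed gap, \<open>D\<close> has a local extremum. Across an open gap,
        equal values at both edges give a critical point by Rolle. If \<open>x\<close> lies inside
        the gap, Rolle is applied between \<open>l j\<close> and \<open>x\<close> instead, so that
        the point found differs from \<open>x\<close>.\<close>
      have "\<exists>y. l j \<le> y \<and> y \<le> u j \<and> y \<noteq> x \<and> poly (pderiv D) y = 0" if j: "j \<in> {1..<p}" for j
      proof -
        have luj: "l j \<le> u j" using lj[of j] ul[of j] j by auto
        have j1: "j - 1 < p" "Suc (j - 1) = j" using j by auto
        have pj: "p - j = Suc (p - Suc j)" using j by (simp add: Suc_diff_Suc)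
        let ?s = "(-1) ^ (p - j) :: real"
        have s2: "?s * ?s = 1" by (simp flip: power_mult_distrib)
        have vl: "?s * poly D (l j) = 2" using lv[OF j1(1)] j1(2) by (simp add: l_def)
        have vu: "?s * poly D (u j) = 2" using uv[of j] j by (simp add: pj)
        have canc: "poly D y = poly D z" if "?s * poly D y = 2" "?s * poly D z = 2" for y z
          using that by (metis mult_cancel_left power_eq_0_iff zero_neq_neg_one)
        have rolle: "\<exists>y. \<alpha> < y \<and> y < \<beta> \<and> poly (pderiv D) y = 0" if "\<alpha> < \<beta>" "poly D \<alpha> = poly D \<beta>" for \<alpha> \<beta>
        proof -
          have "\<exists>y>\<alpha>. y < \<beta> \<and> (\<lambda>h. h * poly (pderiv D) y) = (\<lambda>v. 0)"
            using that Dd by (intro Rolle_deriv[of \<alpha> \<beta> "poly D"])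
              (auto intro!: continuous_intros simp: has_field_derivative_def mult.commute[of _ "poly (pderiv D) _"])
          then show ?thesis by (metis mult_1)
        qed
        consider "l j = u j" | "l j < x" "x < u j" | "l j < u j" "\<not> (l j < x \<and> x < u j)" using luj by linarith
        then show ?thesis
        proof cases
          case 1
          have "l j \<noteq> x" using out j 1 ul[of j] by fastforce
          moreover have "poly (pderiv D) (l j) = 0"
          proof -
            define \<epsilon> where "\<epsilon> = min (l j - u (j - 1)) (l' j - l j)"
            have \<epsilon>: "0 < \<epsilon>" using ul[OF j1(1)] ul[of j] j 1 by (auto simp: \<epsilon>_def l_def)
            have "((\<lambda>y. ?s * poly D y) has_real_derivative (?s * poly (pderiv D) (l j))) (at (l j))"
              by (auto intro!: derivative_eq_intros Dd)
            moreover have "\<forall>y. \<bar>l j - y\<bar> < \<epsilon> \<longrightarrow> ?s * poly D y \<le> ?s * poly D (l j)"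
            proof (intro allI impI)
              fix y assume "\<bar>l j - y\<bar> < \<epsilon>"
              then have "u (j - 1) < y" "y < l' j" unfolding \<epsilon>_def by linarith+
              then have "\<bar>poly D y\<bar> < 2 \<or> y = l j"
                using inner[OF j1(1), of y] inner[of j y] j 1
                by (cases y "l j" rule: linorder_cases) (auto simp: l_def)
              then show "?s * poly D y \<le> ?s * poly D (l j)"
                using vl abs_ge_self[of "?s * poly D y"] by (auto simp: abs_mult power_abs)
            qed
            ultimately have "?s * poly (pderiv D) (l j) = 0" by (rule DERIV_local_max[OF _ \<epsilon>])
            then show ?thesis by simp
          qed
          ultimately show ?thesis using 1 by auto
        next
          case 2
          have "2 \<le> ?s * poly D x" using sign[of j x] 2 j by auto
          moreover have "\<bar>?s * poly D x\<bar> = 2" using x2 by (simp add: abs_mult power_abs)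
          ultimately have "?s * poly D x = 2" by linarith
          then obtain y where "l j < y" "y < x" "poly (pderiv D) y = 0"
            using rolle[OF 2(1) canc[OF vl]] by blast
          then show ?thesis using 2(2) by (intro exI[of _ y]) auto
        next
          case 3
          then obtain y where "l j < y" "y < u j" "poly (pderiv D) y = 0"
            using rolle[OF 3(1) canc[OF vl vu]] by blast
          then show ?thesis using 3(2) by (intro exI[of _ y]) auto
        qed
      qed
      then obtain y where y: "\<And>j. j \<in> {1..<p} \<Longrightarrow> l j \<le> y j \<and> y j \<le> u j \<and> y j \<noteq> x \<and> poly (pderiv D) (y j) = 0"
        by metis
      have ylt: "y i < y j" if "i < j" "i \<in> {1..<p}" "j \<in> {1..<p}" for i j
      proof -
        have j1: "j - 1 < p" "i \<noteq> j - 1 \<longrightarrow> i < j - 1" using that by auto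
        have "u i < l' i" "u (j - 1) < l' (j - 1)" using ul[of i] ul[OF j1(1)] that by auto
        moreover have "i = j - 1 \<or> l' i \<le> u (j - 1)" using chain[of i "j - 1"] j1 by blast
        ultimately have "u i < l j" by (auto simp: l_def)
        then show ?thesis using y[OF that(2)] y[OF that(3)] by linarith
      qed
      have inj: "inj_on y {1..<p}"
        by (intro linorder_inj_onI') (metis ylt less_irrefl)
      have "x \<notin> y ` {1..<p}" using y by blast
      then have c1: "card (insert x (y ` {1..<p})) = p" using p card_image[OF inj] by simp
      have ne: "pderiv D \<noteq> 0" using deg p by (simp add: pderiv_eq_0_iff)
      have "insert x (y ` {1..<p}) \<subseteq> {x. poly (pderiv D) x = 0}" using y crit_x by auto
      then have "p \<le> degree (pderiv D)"
        using card_subset_poly_roots[OF ne] c1 by metis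
      then show False using deg p by (simp add: degree_pderiv)
    qed
  qed
  have "oscillates p D l u"
    unfolding oscillates_def
  proof (intro conjI)
    show "\<forall>j<p. u j < l (Suc j)" using ul by simp
    show "\<forall>j\<in>{1..<p}. l j \<le> u j" using lj ul by force
    show "\<forall>j<p. \<forall>x. u j < x \<longrightarrow> x < l (Suc j) \<longrightarrow> \<bar>poly D x\<bar> < 2" using inner by simp
    show "\<forall>j\<in>{1..<p}. \<forall>x\<in>{l j..u j}. 2 \<le> (-1) ^ (p - j) * poly D x" using sign by simp
    show "\<forall>x\<ge>l p. 2 \<le> poly D x" using sign[of p] by simp
    show "\<forall>x\<le>u 0. 2 \<le> (-1) ^ p * poly D x" using sign[of 0] by simp
    show "poly D (l p) = 2" using lv[of "p - 1"] p by (simp add: l_def)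
    show "{x. \<bar>poly D x\<bar> \<le> 2} = (\<Union>j<p. {u j..l (Suc j)})" by (fact set_eq)
  qed
  then show ?thesis by blast
qed

text \<open>Since \<open>|D| \<ge> 2\<close> at \<open>e i\<close>, this point avoids the open
  bands, and its sign is that of gap number \<open>i + 1\<close>, opposite to that of the
  neighbouring gaps. Monotonicity of \<open>e\<close> excludes slipping further: induction upwards
  gives the lower bounds, induction downwards the upper ones. For \<open>d = p\<close> the last
  point is bounded from below only, by \<open>l p\<close>.\<close>

lemma oscillates_alternating_points:
  assumes osc: "oscillates p D l u" and d: "p - 1 \<le> d" "d \<le> p"
    and mono: "strict_mono_on {..<d} e"
    and alt: "\<And>i. i < d \<Longrightarrow> 2 \<le> (-1) ^ (p - 1 - i) * poly D (e i)"
  shows "i < d \<Longrightarrow> l (Suc i) \<le> e i"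
    and "i < p - 1 \<Longrightarrow> e i \<le> u (Suc i)"
proof -
  have abs2: "2 \<le> \<bar>poly D (e i)\<bar>" if "i < d" for i
    using alt[OF that] abs_ge_self[of "(-1) ^ (p - 1 - i) * poly D (e i)"]
    by (simp add: abs_mult power_abs)
  note band = oscillatesD(3)[OF osc] and gap = oscillatesD(4)[OF osc]
    and top = oscillatesD(5)[OF osc] and bot = oscillatesD(6)[OF osc]
  have flip: "(-1) ^ (p - 1 - i) = - ((-1) ^ (p - i) :: real)" if "i < p" for i
  proof -
    have "p - i = Suc (p - 1 - i)" using that by simp
    then show ?thesis by simp
  qed
  show lower: "l (Suc i) \<le> e i" if "i < d" for i
    using that
  proof (induction i)
    case 0
    show ?case
    proof (rule ccontr)
      assume "\<not> ?case"
      then have "e 0 \<le> u 0" using band[of 0 "e 0"] abs2[of 0] 0 d by force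
      then show False using bot[of "e 0"] alt[of 0] 0 d flip[of 0] by simp
    qed
  next
    case (Suc i)
    have ei: "e i < e (Suc i)" using mono Suc.prems by (simp add: strict_mono_on_def)
    show ?case
    proof (rule ccontr)
      assume "\<not> ?case"
      then have "e (Suc i) \<le> u (Suc i)" using band[of "Suc i" "e (Suc i)"] abs2[of "Suc i"] Suc.prems d by force
      moreover have "l (Suc i) \<le> e (Suc i)" using Suc.IH Suc.prems ei by simp
      ultimately show False
        using gap[of "Suc i" "e (Suc i)"] alt[of "Suc i"] Suc.prems d flip[of "Suc i"] by simp
    qed
  qed
  show "e i \<le> u (Suc i)" if "i < p - 1" for i
  proof -
    have "i \<le> p - 2" using that by simp
    then show ?thesis
    proof (induction rule: inc_induct)
      case base
      have p2: "2 \<le> p" using that by simp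
      show ?case
      proof (rule ccontr)
        assume "\<not> ?case"
        then have "u (p - 1) < e (p - 2)" using p2 by (simp add: Suc_diff_Suc numeral_2_eq_2)
        moreover have "p - 2 < d" using p2 d by linarith
        ultimately have "l p \<le> e (p - 2)"
          using band[of "p - 1" "e (p - 2)"] abs2[of "p - 2"] p2 d by (cases "e (p - 2) < l p") auto
        then have "2 \<le> poly D (e (p - 2))" by (rule top)
        moreover have "p - 1 - (p - 2) = 1" using p2 by simp
        moreover have "p - 2 < d" using p2 d by linarith
        ultimately show False using alt[of "p - 2"] by simp
      qed
    next
      case (step i)
      have i: "Suc i < p - 1" using step.hyps by simp
      have ei: "e i < e (Suc i)" using mono i d by (simp add: strict_mono_on_def)
      show ?case
      proof (rule ccontr)
        assume "\<not> ?case"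
        then have "l (Suc (Suc i)) \<le> e i" using band[of "Suc i" "e i"] abs2[of i] i d by force
        moreover have "e i \<le> u (Suc (Suc i))" using step.IH ei by simp
        ultimately show False
          using gap[of "Suc (Suc i)" "e i"] alt[of i] i d flip[of "Suc i"] less_diff_conv[of "Suc i" p 1]
          by simp
      qed
    qed
  qed
qed

section \<open>Solutions of the Jacobi recursion\<close>

text \<open>The solution at site k as a polynomial in the spectral parameter, with values s and t at
  sites 0 and 1. The coefficient type is left open because real coefficients serve the counting of
  roots and complex ones the Floquet solutions.\<close>

fun sol :: "(nat \<Rightarrow> real) \<Rightarrow> (nat \<Rightarrow> real) \<Rightarrow> 'a \<Rightarrow> 'a \<Rightarrow> nat \<Rightarrow> 'a::real_normed_field poly" where
  "sol \<alpha> \<beta> s t 0 = [:s:]"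
| "sol \<alpha> \<beta> s t (Suc 0) = [:t:]"
| "sol \<alpha> \<beta> s t (Suc (Suc k)) = smult (of_real (inverse (\<alpha> (Suc k))))
     ([:- of_real (\<beta> (Suc k)), 1:] * sol \<alpha> \<beta> s t (Suc k) - smult (of_real (\<alpha> k)) (sol \<alpha> \<beta> s t k))"

definition jacobi_rec :: "(nat \<Rightarrow> real) \<Rightarrow> (nat \<Rightarrow> real) \<Rightarrow> 'a::real_normed_field \<Rightarrow> (nat \<Rightarrow> 'a) \<Rightarrow> bool" where
  "jacobi_rec \<alpha> \<beta> z y \<longleftrightarrow> (\<forall>k. of_real (\<alpha> (Suc k)) * y (Suc (Suc k)) =
     (z - of_real (\<beta> (Suc k))) * y (Suc k) - of_real (\<alpha> k) * y k)"

lemma sol_linear: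
  "sol \<alpha> \<beta> s t k = smult s (sol \<alpha> \<beta> 1 0 k) + smult t (sol \<alpha> \<beta> 0 1 k)"
  by (induction \<alpha> \<beta> s t k rule: sol.induct)
    (simp_all add: smult_add_right smult_diff_right algebra_simps)

lemma coeff_sol_of_real:
  "coeff (sol \<alpha> \<beta> (of_real s) (of_real t) k :: 'a::real_normed_field poly) i = of_real (coeff (sol \<alpha> \<beta> s t k) i)"
  by (induction \<alpha> \<beta> s t k arbitrary: i rule: sol.induct) (auto simp: coeff_pCons split: nat.split)

text \<open>A solution that vanishes at site 1 is, from there on, a multiple of the solution with
  values 0 and 1 of the shifted recursion; the factor is its value at site 2. This reduces all
  degrees and leading coefficients to those of one family.\<close>

lemma sol_const_shift:
  assumes "\<alpha> 1 \<noteq> 0"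
  shows "sol \<alpha> \<beta> 1 0 (Suc k) =
    smult (- of_real (\<alpha> 0 / \<alpha> 1)) (sol (\<lambda>i. \<alpha> (Suc i)) (\<lambda>i. \<beta> (Suc i)) 0 (1::'a::real_normed_field) k)"
proof (induction k rule: induct_nat_012)
  case 1
  then show ?case using assms by (simp add: field_simps)
next
  case (ge2 k)
  show ?case
    unfolding sol.simps(3)[of \<alpha> \<beta> 1 0 "Suc k"] sol.simps(3)[of "\<lambda>i. \<alpha> (Suc i)" "\<lambda>i. \<beta> (Suc i)" 0 1 k] ge2
    by (simp add: smult_diff_right mult_ac del: mult_pCons_left sol.simps)
qed simp

lemma degree_sol_0_1: "degree (sol \<alpha> \<beta> 0 (1::real) (Suc k)) \<le> k"
proof (induction k rule: induct_nat_012)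
  case (ge2 k)
  have "degree ([:- of_real (\<beta> (Suc (Suc k))), 1:] * sol \<alpha> \<beta> 0 (1::real) (Suc (Suc k))) \<le> 1 + Suc k"
    by (rule order_trans[OF degree_mult_le]) (use ge2 in \<open>simp del: sol.simps\<close>)
  moreover have "degree (sol \<alpha> \<beta> 0 (1::real) (Suc k)) \<le> 1 + Suc k"
    using ge2 by (simp del: sol.simps)
  ultimately show ?case
    unfolding sol.simps(3)[of _ _ _ _ "Suc k"]
    by (intro order_trans[OF degree_smult_le] degree_diff_le) (simp_all del: sol.simps mult_pCons_left)
qed (auto intro: order_trans[OF degree_smult_le])

lemma coeff_sol_0_1:
  assumes "\<And>k. \<alpha> k > 0"
  shows "coeff (sol \<alpha> \<beta> 0 (1::real) (Suc k)) k = 1 / (\<Prod>i=1..k. \<alpha> i)"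
proof (induction k rule: induct_nat_012)
  case (ge2 k)
  have "coeff (sol \<alpha> \<beta> 0 (1::real) (Suc (Suc k))) (Suc (Suc k)) = 0"
    "coeff (sol \<alpha> \<beta> 0 (1::real) (Suc k)) (Suc (Suc k)) = 0"
    by (rule coeff_eq_0, rule le_less_trans[OF degree_sol_0_1], simp)+
  then have "coeff (sol \<alpha> \<beta> 0 (1::real) (Suc (Suc (Suc k)))) (Suc (Suc k)) =
      inverse (\<alpha> (Suc (Suc k))) * coeff (sol \<alpha> \<beta> 0 (1::real) (Suc (Suc k))) (Suc k)"
    by (subst sol.simps(3)) (simp del: sol.simps)
  then show ?case unfolding ge2 by (simp add: field_simps)
qed (use assms[of 1] in \<open>auto simp: field_simps\<close>)

text \<open>Up to the product of the \<alpha>, this polynomial is the characteristic polynomial of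
  the truncation to the sites 1 to k + 1, whose trace appears here.\<close>

lemma coeff_sol_0_1_second:
  assumes "\<And>k. \<alpha> k > 0"
  shows "coeff (sol \<alpha> \<beta> 0 (1::real) (Suc (Suc k))) k = - (\<Sum>i=1..Suc k. \<beta> i) / (\<Prod>i=1..Suc k. \<alpha> i)"
proof (induction k)
  case 0
  then show ?case using assms[of 1] by (simp add: field_simps)
next
  case (Suc k)
  let ?S = "sol \<alpha> \<beta> 0 (1::real)"
  have z: "coeff (?S (Suc k)) (Suc k) = 0"
    by (rule coeff_eq_0, rule le_less_trans[OF degree_sol_0_1], simp)
  have 1: "coeff (?S (Suc (Suc k))) (Suc k) = 1 / (\<Prod>i=1..Suc k. \<alpha> i)"
    by (rule coeff_sol_0_1[OF assms])
  have "coeff (?S (Suc (Suc (Suc k)))) (Suc k) = inverse (\<alpha> (Suc (Suc k))) *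
      (- \<beta> (Suc (Suc k)) * coeff (?S (Suc (Suc k))) (Suc k) + coeff (?S (Suc (Suc k))) k)"
    by (subst sol.simps(3)) (simp add: z del: sol.simps)
  also have "\<dots> = - (\<Sum>i=1..Suc (Suc k). \<beta> i) / (\<Prod>i=1..Suc (Suc k). \<alpha> i)"
  proof -
    define P where "P = (\<Prod>i=1..Suc k. \<alpha> i)"
    have "P > 0" unfolding P_def using assms by (intro prod_pos) auto
    moreover have "(\<Prod>i=1..Suc (Suc k). \<alpha> i) = P * \<alpha> (Suc (Suc k))" by (simp add: P_def)
    moreover have "(\<Sum>i=1..Suc (Suc k). \<beta> i) = (\<Sum>i=1..Suc k. \<beta> i) + \<beta> (Suc (Suc k))" by simp
    ultimately show ?thesis unfolding 1 Suc.IH P_def[symmetric]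
      using assms[of "Suc (Suc k)"] by (simp only:) (simp add: field_simps del: sum.cl_ivl_Suc prod.cl_ivl_Suc)
  qed
  finally show ?case .
qed

context
  fixes \<alpha> \<beta> :: "nat \<Rightarrow> real"
  assumes pos: "\<And>k. \<alpha> k > 0"
begin

lemma jacobi_rec_sol: "jacobi_rec \<alpha> \<beta> z (\<lambda>k. poly (sol \<alpha> \<beta> s t k) z)"
  unfolding jacobi_rec_def
proof
  fix k
  have "of_real (\<alpha> (Suc k)) * of_real (inverse (\<alpha> (Suc k))) = (1::'a)"
    using pos[of "Suc k"] by (simp flip: of_real_mult)
  then have cancel: "of_real (\<alpha> (Suc k)) * (of_real (inverse (\<alpha> (Suc k))) * x) = x" for x :: 'a
    by (metis mult.assoc mult_1)
  have "poly (sol \<alpha> \<beta> s t (Suc (Suc k))) z = of_real (inverse (\<alpha> (Suc k))) *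
      ((z - of_real (\<beta> (Suc k))) * poly (sol \<alpha> \<beta> s t (Suc k)) z - of_real (\<alpha> k) * poly (sol \<alpha> \<beta> s t k) z)"
    by (subst sol.simps(3)) (simp add: algebra_simps del: sol.simps of_real_inverse)
  then show "of_real (\<alpha> (Suc k)) * poly (sol \<alpha> \<beta> s t (Suc (Suc k))) z =
      (z - of_real (\<beta> (Suc k))) * poly (sol \<alpha> \<beta> s t (Suc k)) z - of_real (\<alpha> k) * poly (sol \<alpha> \<beta> s t k) z"
    by (simp only: cancel)
qed

lemma jacobi_rec_zero_pair:
  assumes "jacobi_rec \<alpha> \<beta> z y" "y k = 0" "y (Suc k) = 0"
  shows "y 0 = 0 \<and> y 1 = 0"
  using assms(2,3)
proof (induction k)
  case (Suc k)
  have "of_real (\<alpha> k) * y k = 0"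
    using assms(1)[unfolded jacobi_rec_def, rule_format, of k] Suc.prems by simp
  then have "y k = 0" using pos[of k] by simp
  then show ?case using Suc by simp
qed simp

text \<open>Green's formula: for spectral parameters z and z' the Wronskian gains
  \<open>(z - z') * y i * y' i\<close> at each site. The case z' = z gives the determinant of the
  monodromy matrix, the case z' = \<open>cnj z\<close> the reality of eigenvalues.\<close>

lemma wronskian_step:
  assumes "jacobi_rec \<alpha> \<beta> z y" "jacobi_rec \<alpha> \<beta> z' y'"
  shows "of_real (\<alpha> k) * (y (Suc k) * y' k - y k * y' (Suc k)) =
    of_real (\<alpha> 0) * (y 1 * y' 0 - y 0 * y' 1) + (z - z') * (\<Sum>i=1..k. y i * y' i)"
proof (induction k)
  case (Suc k)
  have y: "of_real (\<alpha> (Suc k)) * y (Suc (Suc k)) = (z - of_real (\<beta> (Suc k))) * y (Suc k) - of_real (\<alpha> k) * y k"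
    using assms(1) by (simp add: jacobi_rec_def)
  have y': "of_real (\<alpha> (Suc k)) * y' (Suc (Suc k)) = (z' - of_real (\<beta> (Suc k))) * y' (Suc k) - of_real (\<alpha> k) * y' k"
    using assms(2) by (simp add: jacobi_rec_def)
  have "of_real (\<alpha> (Suc k)) * (y (Suc (Suc k)) * y' (Suc k) - y (Suc k) * y' (Suc (Suc k))) =
    (of_real (\<alpha> (Suc k)) * y (Suc (Suc k))) * y' (Suc k) - y (Suc k) * (of_real (\<alpha> (Suc k)) * y' (Suc (Suc k)))"
    by (simp add: algebra_simps)
  also have "\<dots> = of_real (\<alpha> k) * (y (Suc k) * y' k - y k * y' (Suc k)) + (z - z') * (y (Suc k) * y' (Suc k))"
    unfolding y y' by (simp add: algebra_simps)
  finally show ?case unfolding Suc.IH by (simp add: algebra_simps)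
qed simp

text \<open>Green's formula in the limit of equal spectral parameters. The initial Wronskian
  vanishes since the values at sites 0 and 1 are constant polynomials. The sum of squares decides
  the sign of the derivative of a boundary value polynomial at its roots.\<close>

lemma wronskian_deriv:
  fixes x :: real and s t :: real
  defines "y k \<equiv> poly (sol \<alpha> \<beta> s t k) x" and "y' k \<equiv> poly (pderiv (sol \<alpha> \<beta> s t k)) x"
  shows "\<alpha> k * (y k * y' (Suc k) - y (Suc k) * y' k) = (\<Sum>i=1..k. (y i)\<^sup>2)"
proof (induction k)
  case 0
  then show ?case by (simp add: y'_def)
next
  case (Suc k)
  have y: "\<alpha> (Suc k) * y (Suc (Suc k)) = (x - \<beta> (Suc k)) * y (Suc k) - \<alpha> k * y k"
    using jacobi_rec_sol[where z=x] unfolding jacobi_rec_def y_def by simp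
  have y': "\<alpha> (Suc k) * y' (Suc (Suc k)) = (x - \<beta> (Suc k)) * y' (Suc k) + y (Suc k) - \<alpha> k * y' k"
  proof -
    have "y' (Suc (Suc k)) = inverse (\<alpha> (Suc k)) * ((x - \<beta> (Suc k)) * y' (Suc k) + y (Suc k) - \<alpha> k * y' k)"
      unfolding y_def y'_def
      by (subst sol.simps(3)) (simp add: pderiv_smult pderiv_diff pderiv_mult pderiv_pCons del: sol.simps mult_pCons_left)
    then show ?thesis using pos[of "Suc k"] by (simp only:) (simp add: divide_simps)
  qed
  have "\<alpha> (Suc k) * (y (Suc k) * y' (Suc (Suc k)) - y (Suc (Suc k)) * y' (Suc k)) =
     y (Suc k) * (\<alpha> (Suc k) * y' (Suc (Suc k))) - (\<alpha> (Suc k) * y (Suc (Suc k))) * y' (Suc k)"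
    by (simp add: algebra_simps)
  also have "\<dots> = \<alpha> k * (y k * y' (Suc k) - y (Suc k) * y' k) + (y (Suc k))\<^sup>2"
    unfolding y y' by (simp add: algebra_simps power2_eq_square)
  finally show ?case unfolding Suc.IH by simp
qed

end

section \<open>Monodromy and boundary value problems\<close>

text \<open>Sites are counted by natural numbers from the place of the cut, so moving the cut means
  passing to shifted coefficient sequences.\<close>

locale periodic_rec =
  fixes \<alpha> \<beta> :: "nat \<Rightarrow> real" and p :: nat
  assumes p_pos: "0 < p"
    and \<alpha>_pos: "\<And>k. \<alpha> k > 0"
    and \<alpha>_per: "\<And>k. \<alpha> (k + p) = \<alpha> k"
    and \<beta>_per: "\<And>k. \<beta> (k + p) = \<beta> k"
begin

lemmas jacobi_rec_sol' = jacobi_rec_sol[where \<alpha>=\<alpha> and \<beta>=\<beta>, OF \<alpha>_pos]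
  and wronskian_step' = wronskian_step[where \<alpha>=\<alpha> and \<beta>=\<beta>, OF \<alpha>_pos]
  and wronskian_deriv' = wronskian_deriv[where \<alpha>=\<alpha> and \<beta>=\<beta>, OF \<alpha>_pos]
  and jacobi_rec_zero_pair' = jacobi_rec_zero_pair[where \<alpha>=\<alpha> and \<beta>=\<beta>, OF \<alpha>_pos]

definition disc :: "'a::real_normed_field poly" where
  "disc = sol \<alpha> \<beta> 1 0 p + sol \<alpha> \<beta> 0 1 (Suc p)"

text \<open>A root means that the values at p and \<open>Suc p\<close> are parallel to those at 0
  and 1, that is, (s, t) is an eigenvector of the monodromy matrix. The homogeneous pair, in place
  of the ratio t / s, includes the Dirichlet condition s = 0.\<close>

definition bvp :: "'a \<Rightarrow> 'a \<Rightarrow> 'a::real_normed_field poly" where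
  "bvp s t = smult s (sol \<alpha> \<beta> s t (Suc p)) - smult t (sol \<alpha> \<beta> s t p)"

lemma poly_sol_linear:
  "poly (sol \<alpha> \<beta> s t k) z = s * poly (sol \<alpha> \<beta> 1 0 k) z + t * poly (sol \<alpha> \<beta> 0 1 k) z"
  by (subst sol_linear) simp

lemma disc_of_real: "poly (disc :: 'a::real_normed_field poly) (of_real x) = of_real (poly disc x)"
proof -
  have "coeff (sol \<alpha> \<beta> 1 0 k :: 'a poly) i = of_real (coeff (sol \<alpha> \<beta> 1 0 k) i)"
    "coeff (sol \<alpha> \<beta> 0 1 k :: 'a poly) i = of_real (coeff (sol \<alpha> \<beta> 0 1 k) i)" for k i
    using coeff_sol_of_real[of \<alpha> \<beta> 1 0 k i, where 'a='a] coeff_sol_of_real[of \<alpha> \<beta> 0 1 k i, where 'a='a] by simp_all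
  then have "(disc :: 'a poly) = map_poly of_real disc"
    by (intro poly_eqI) (simp add: disc_def coeff_map_poly del: sol.simps)
  then show ?thesis by (simp only: poly_map_poly_of_real)
qed

lemma bvp_of_real:
  "bvp (of_real s) (of_real t) = (map_poly of_real (bvp s t) :: 'a::real_normed_field poly)"
  by (rule poly_eqI) (simp add: bvp_def coeff_sol_of_real coeff_map_poly)

lemma monodromy_det:
  "poly (sol \<alpha> \<beta> 1 0 p) z * poly (sol \<alpha> \<beta> 0 1 (Suc p)) z
    - poly (sol \<alpha> \<beta> 1 0 (Suc p)) z * poly (sol \<alpha> \<beta> 0 1 p) z = 1"
  using wronskian_step'[OF jacobi_rec_sol'[of z 0 1] jacobi_rec_sol'[of z 1 0], of p]
    \<alpha>_per[of 0] \<alpha>_pos[of 0]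
  by (simp add: mult.commute)

lemma monodromy_eigenvalue:
  assumes "s \<noteq> 0 \<or> t \<noteq> 0"
    and "poly (sol \<alpha> \<beta> s t p) z = m * s" "poly (sol \<alpha> \<beta> s t (Suc p)) z = m * t"
  shows "m\<^sup>2 - poly disc z * m + 1 = 0"
proof -
  let ?c = "\<lambda>k. poly (sol \<alpha> \<beta> 1 0 k) z" and ?f = "\<lambda>k. poly (sol \<alpha> \<beta> 0 1 k) z"
  have e1: "(?c p - m) * s + ?f p * t = 0" and e2: "?c (Suc p) * s + (?f (Suc p) - m) * t = 0"
    using assms(2,3) poly_sol_linear[of s t p z] poly_sol_linear[of s t "Suc p" z]
    by (simp_all add: algebra_simps)
  have "((?c p - m) * (?f (Suc p) - m) - ?c (Suc p) * ?f p) * s = 0"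
  proof -
    have "((?c p - m) * (?f (Suc p) - m) - ?c (Suc p) * ?f p) * s =
      (?f (Suc p) - m) * ((?c p - m) * s + ?f p * t) - ?f p * (?c (Suc p) * s + (?f (Suc p) - m) * t)"
      by (simp add: algebra_simps)
    then show ?thesis unfolding e1 e2 by simp
  qed
  moreover have "((?c p - m) * (?f (Suc p) - m) - ?c (Suc p) * ?f p) * t = 0"
  proof -
    have "((?c p - m) * (?f (Suc p) - m) - ?c (Suc p) * ?f p) * t =
      (?c p - m) * (?c (Suc p) * s + (?f (Suc p) - m) * t) - ?c (Suc p) * ((?c p - m) * s + ?f p * t)"
      by (simp add: algebra_simps)
    then show ?thesis unfolding e1 e2 by simp
  qed
  ultimately have "(?c p - m) * (?f (Suc p) - m) - ?c (Suc p) * ?f p = 0" using assms(1) by auto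
  moreover have "(?c p - m) * (?f (Suc p) - m) - ?c (Suc p) * ?f p =
      m\<^sup>2 - poly disc z * m + (?c p * ?f (Suc p) - ?c (Suc p) * ?f p)"
    by (simp add: disc_def algebra_simps power2_eq_square)
  ultimately show ?thesis using monodromy_det[of z] by simp
qed

lemma bvp_root_eigenvector:
  assumes "s \<noteq> 0 \<or> t \<noteq> 0" "poly (bvp s t) z = 0"
  obtains m where "poly (sol \<alpha> \<beta> s t p) z = m * s" "poly (sol \<alpha> \<beta> s t (Suc p)) z = m * t"
proof (cases "s = 0")
  case True
  then show ?thesis
    using assms that[of "poly (sol \<alpha> \<beta> s t (Suc p)) z / t"] by (auto simp: bvp_def)
next
  case False
  then show ?thesis
    using assms that[of "poly (sol \<alpha> \<beta> s t p) z / s"] by (auto simp: bvp_def field_simps)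
qed

lemma monodromy_eigenvector_exists:
  assumes "m\<^sup>2 - poly disc z * m + 1 = 0"
  obtains s t where "s \<noteq> 0 \<or> t \<noteq> 0"
    "poly (sol \<alpha> \<beta> s t p) z = m * s" "poly (sol \<alpha> \<beta> s t (Suc p)) z = m * t"
proof -
  let ?c = "\<lambda>k. poly (sol \<alpha> \<beta> 1 0 k) z" and ?f = "\<lambda>k. poly (sol \<alpha> \<beta> 0 1 k) z"
  have det: "(?c p - m) * (?f (Suc p) - m) = ?c (Suc p) * ?f p"
  proof -
    have "(?c p - m) * (?f (Suc p) - m) - ?c (Suc p) * ?f p =
      m\<^sup>2 - poly disc z * m + (?c p * ?f (Suc p) - ?c (Suc p) * ?f p)"
      by (simp add: disc_def algebra_simps power2_eq_square)
    then show ?thesis using assms monodromy_det[of z] by simp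
  qed
  have "\<exists>s t. (s \<noteq> 0 \<or> t \<noteq> 0) \<and> (?c p - m) * s + ?f p * t = 0 \<and> ?c (Suc p) * s + (?f (Suc p) - m) * t = 0"
  proof -
    consider "?f p \<noteq> 0 \<or> ?c p - m \<noteq> 0" | "?f p = 0" "?c p - m = 0" "?f (Suc p) - m \<noteq> 0 \<or> ?c (Suc p) \<noteq> 0"
      | "?f p = 0" "?c p - m = 0" "?f (Suc p) - m = 0" "?c (Suc p) = 0" by blast
    then show ?thesis
    proof cases
      case 1
      then show ?thesis
        using det by (intro exI[of _ "?f p"] exI[of _ "- (?c p - m)"]) (auto simp: algebra_simps)
    next
      case 2
      then show ?thesis
        by (intro exI[of _ "?f (Suc p) - m"] exI[of _ "- ?c (Suc p)"]) (auto simp: algebra_simps)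
    next
      case 3
      then show ?thesis by (intro exI[of _ 1] exI[of _ 0]) auto
    qed
  qed
  then obtain s t where st: "s \<noteq> 0 \<or> t \<noteq> 0"
    "(?c p - m) * s + ?f p * t = 0" "?c (Suc p) * s + (?f (Suc p) - m) * t = 0" by blast
  show thesis
  proof (rule that[OF st(1)])
    show "poly (sol \<alpha> \<beta> s t p) z = m * s" "poly (sol \<alpha> \<beta> s t (Suc p)) z = m * t"
      using st(2,3) poly_sol_linear[of s t p z] poly_sol_linear[of s t "Suc p" z]
      by (simp_all add: algebra_simps)
  qed
qed

lemma sol_nonzero_in_period:
  assumes st: "s \<noteq> 0 \<or> t \<noteq> 0" and root: "poly (bvp s t) z = 0"
  shows "\<exists>i\<in>{1..p}. poly (sol \<alpha> \<beta> s t i) z \<noteq> 0"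
proof (rule ccontr)
  assume "\<not> ?thesis"
  then have 0: "\<And>i. 1 \<le> i \<Longrightarrow> i \<le> p \<Longrightarrow> poly (sol \<alpha> \<beta> s t i) z = 0" by auto
  have "t = 0" using 0[of 1] p_pos by simp
  moreover have "poly (sol \<alpha> \<beta> s t p) z = 0" using 0[of p] p_pos by simp
  ultimately have "poly (sol \<alpha> \<beta> s t (Suc p)) z = 0" using root st by (auto simp: bvp_def)
  then have "poly (sol \<alpha> \<beta> s t 0) z = 0 \<and> poly (sol \<alpha> \<beta> s t 1) z = 0"
    using jacobi_rec_zero_pair'[OF jacobi_rec_sol'[of z s t], of p]
      \<open>poly (sol \<alpha> \<beta> s t p) z = 0\<close> by blast
  then show False using st by simp
qed

text \<open>Green's formula over one period is applied to the solution and its conjugate. The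
  boundary terms cancel if the multiplier has modulus 1 or if the flux
  \<open>t * cnj s - s * cnj t\<close> vanishes, leaving \<open>z - cnj z\<close> times a positive
  sum. The first alternative serves the spectrum, the second the real boundary conditions.\<close>

lemma quasiperiodic_imp_real:
  fixes z :: complex
  assumes st: "s \<noteq> 0 \<or> t \<noteq> 0"
    and m: "poly (sol \<alpha> \<beta> s t p) z = m * s" "poly (sol \<alpha> \<beta> s t (Suc p)) z = m * t"
    and flux: "cmod m = 1 \<or> t * cnj s = s * cnj t"
  shows "z \<in> \<real>"
proof -
  define y where "y k = poly (sol \<alpha> \<beta> s t k) z" for k
  have y: "jacobi_rec \<alpha> \<beta> z y" unfolding y_def by (rule jacobi_rec_sol')
  then have y': "jacobi_rec \<alpha> \<beta> (cnj z) (\<lambda>k. cnj (y k))"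
    unfolding jacobi_rec_def
    by (metis complex_cnj_complex_of_real complex_cnj_diff complex_cnj_mult)
  have mm: "m * cnj m = of_real ((cmod m)\<^sup>2)" by (simp add: complex_mult_cnj cmod_def)
  have "of_real (\<alpha> p) * (y (Suc p) * cnj (y p) - y p * cnj (y (Suc p)))
     = of_real (\<alpha> 0) * (m * cnj m) * (t * cnj s - s * cnj t)"
    using \<alpha>_per[of 0] by (simp add: y_def m algebra_simps)
  also have "\<dots> = of_real (\<alpha> 0) * (y 1 * cnj (y 0) - y 0 * cnj (y 1))"
    using flux unfolding mm by (auto simp: y_def)
  finally have "(z - cnj z) * (\<Sum>i=1..p. y i * cnj (y i)) = 0"
    using wronskian_step'[OF y y', of p] by simp
  moreover have "(\<Sum>i=1..p. y i * cnj (y i)) \<noteq> 0"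
  proof -
    have root: "poly (bvp s t) z = 0" using m by (simp add: bvp_def)
    obtain i where i: "i \<in> {1..p}" "y i \<noteq> 0"
      using sol_nonzero_in_period[OF st root] unfolding y_def by blast
    have "0 < (\<Sum>i=1..p. (cmod (y i))\<^sup>2)" using i by (intro sum_pos2[of _ i]) auto
    moreover have "(\<Sum>i=1..p. y i * cnj (y i)) = of_real (\<Sum>i=1..p. (cmod (y i))\<^sup>2)"
      unfolding of_real_sum by (intro sum.cong) (auto simp: complex_mult_cnj cmod_def)
    ultimately show ?thesis by (metis less_irrefl of_real_eq_0_iff)
  qed
  ultimately have "z = cnj z" by simp
  then show ?thesis by (metis Reals_cnj_iff)
qed

lemma bvp_real_rooted:
  fixes s t :: real
  assumes st: "s \<noteq> 0 \<or> t \<noteq> 0" and root: "poly (map_poly complex_of_real (bvp s t)) z = 0"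
  shows "z \<in> \<real>"
proof -
  have st': "complex_of_real s \<noteq> 0 \<or> complex_of_real t \<noteq> 0" using st by simp
  have root': "poly (bvp (complex_of_real s) (complex_of_real t)) z = 0"
    using root by (simp add: bvp_of_real)
  obtain m where "poly (sol \<alpha> \<beta> (complex_of_real s) (complex_of_real t) p) z = m * complex_of_real s"
    "poly (sol \<alpha> \<beta> (complex_of_real s) (complex_of_real t) (Suc p)) z = m * complex_of_real t"
    using bvp_root_eigenvector[OF st' root'] by blast
  then show ?thesis using quasiperiodic_imp_real[OF st'] by (simp add: mult.commute)
qed

text \<open>With the real multiplier m of the eigenvector, m times the derivative is positive by
  \<open>wronskian_deriv\<close>, and m times the discriminant is m^2 + 1. So both have the sign of
  m, and the discriminant has modulus |m| + 1 / |m|.\<close>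

lemma bvp_root_disc:
  fixes s t :: real
  assumes st: "s \<noteq> 0 \<or> t \<noteq> 0" and root: "poly (bvp s t) x = 0"
  shows "0 < poly (pderiv (bvp s t)) x * poly disc x" and "2 \<le> \<bar>poly disc x\<bar>"
proof -
  obtain m where m: "poly (sol \<alpha> \<beta> s t p) x = m * s" "poly (sol \<alpha> \<beta> s t (Suc p)) x = m * t"
    using bvp_root_eigenvector[OF st root] by blast
  obtain i where i: "i \<in> {1..p}" "poly (sol \<alpha> \<beta> s t i) x \<noteq> 0"
    using sol_nonzero_in_period[OF st root] by blast
  have "0 < (\<Sum>i=1..p. (poly (sol \<alpha> \<beta> s t i) x)\<^sup>2)" using i by (intro sum_pos2[of _ i]) auto
  also have "\<dots> = \<alpha> p * (m * poly (pderiv (bvp s t)) x)"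
    using wronskian_deriv'[where k=p and s=s and t=t and x=x] unfolding m
    by (simp add: bvp_def pderiv_smult pderiv_diff algebra_simps)
  finally have pos: "0 < m * poly (pderiv (bvp s t)) x"
    using \<alpha>_pos[of p] by (simp add: zero_less_mult_iff)
  then have m0: "m \<noteq> 0" by auto
  have eq: "m * poly disc x = m\<^sup>2 + 1" using monodromy_eigenvalue[OF st m] by (simp add: mult.commute)
  have "0 < (m * poly (pderiv (bvp s t)) x) * (m * poly disc x)"
    using mult_pos_pos[OF pos, of "m * poly disc x"] by (simp add: eq add_nonneg_pos)
  also have "\<dots> = m\<^sup>2 * (poly (pderiv (bvp s t)) x * poly disc x)" by (simp add: power2_eq_square)
  finally show "0 < poly (pderiv (bvp s t)) x * poly disc x" using m0 by (simp add: zero_less_mult_iff)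
  have "0 \<le> (\<bar>m\<bar> - 1)\<^sup>2" by simp
  then have "\<bar>m\<bar> * 2 \<le> m\<^sup>2 + 1" by (simp add: power2_diff algebra_simps)
  also have "\<dots> = \<bar>m\<bar> * \<bar>poly disc x\<bar>" using eq by (metis abs_mult abs_of_nonneg add_nonneg_nonneg zero_le_one zero_le_power2)
  finally show "2 \<le> \<bar>poly disc x\<bar>" using m0 by simp
qed

text \<open>The derivative alternates in sign along consecutive simple roots, and the discriminant
  shares its sign by \<open>bvp_root_disc\<close>.\<close>

lemma bvp_roots_enum:
  fixes s t :: real
  assumes st: "s \<noteq> 0 \<or> t \<noteq> 0" and Q0: "bvp s t \<noteq> 0"
  obtains e where "strict_mono_on {..<degree (bvp s t)} e"
    and "bvp s t = smult (lead_coeff (bvp s t)) (\<Prod>i<degree (bvp s t). [:- e i, 1:])"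
    and "\<And>i. i < degree (bvp s t) \<Longrightarrow>
      2 \<le> sgn (lead_coeff (bvp s t)) * (-1) ^ (degree (bvp s t) - 1 - i) * poly disc (e i)"
proof -
  let ?Q = "bvp s t" let ?d = "degree (bvp s t)" let ?c = "lead_coeff (bvp s t)"
  have "poly (pderiv ?Q) x \<noteq> 0" if "poly ?Q x = 0" for x
    using bvp_root_disc(1)[OF st that] by auto
  then obtain e where e: "strict_mono_on {..<?d} e" and Q: "?Q = smult ?c (\<Prod>i<?d. [:- e i, 1:])"
    using real_rooted_simple_poly_enum[OF Q0 bvp_real_rooted[OF st]] by blast
  have "2 \<le> sgn ?c * (-1) ^ (?d - 1 - i) * poly disc (e i)" if i: "i < ?d" for i
  proof -
    let ?\<sigma> = "(-1) ^ (?d - 1 - i) :: real"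
    have "poly ?Q (e i) = 0" by (subst Q) (use i in \<open>auto simp: poly_prod\<close>)
    note D = bvp_root_disc[OF st this]
    have "poly (pderiv ?Q) (e i) = ?c * (\<Prod>j\<in>{..<?d} - {i}. e i - e j)"
      by (subst Q) (simp only: pderiv_smult poly_smult poly_pderiv_prod_linear[OF i])
    then have "sgn ?c * ?\<sigma> * poly (pderiv ?Q) (e i) = \<bar>?c\<bar> * (?\<sigma> * (\<Prod>j\<in>{..<?d} - {i}. e i - e j))"
      by (simp only: abs_sgn mult_ac)
    also have "0 < \<dots>"
      using mult_pos_pos[OF _ prod_linear_sign[OF e i], of "\<bar>?c\<bar>"] Q0 by simp
    finally have "0 < sgn ?c * ?\<sigma> * poly (pderiv ?Q) (e i)" .
    then have "0 < (sgn ?c * ?\<sigma> * poly (pderiv ?Q) (e i)) * (poly (pderiv ?Q) (e i) * poly disc (e i))"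
      using D(1) by (rule mult_pos_pos)
    also have "\<dots> = (poly (pderiv ?Q) (e i))\<^sup>2 * (sgn ?c * ?\<sigma> * poly disc (e i))"
      by (simp add: power2_eq_square)
    finally have "0 < sgn ?c * ?\<sigma> * poly disc (e i)" by (simp add: zero_less_mult_iff)
    moreover have "\<bar>sgn ?c * ?\<sigma> * poly disc (e i)\<bar> = \<bar>poly disc (e i)\<bar>"
      using Q0 by (simp add: abs_mult power_abs sgn_if)
    ultimately show ?thesis using D(2) by linarith
  qed
  with e Q that show thesis by blast
qed

end

section \<open>Trace formulas\<close>

context periodic_rec
begin

lemma \<alpha>_nz [simp]: "\<alpha> k \<noteq> 0"
  using \<alpha>_pos[of k] by simp

lemma sol_Suc_shift:
  "poly (sol \<alpha> \<beta> s t (Suc k)) z =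
    poly (sol (\<lambda>i. \<alpha> (Suc i)) (\<lambda>i. \<beta> (Suc i)) t (poly (sol \<alpha> \<beta> s t 2) z) k) z"
proof (induction k rule: induct_nat_012)
  case (ge2 k)
  define w where "w = poly (sol \<alpha> \<beta> s t 2) z"
  show ?case
    using ge2[folded w_def]
    unfolding w_def[symmetric] sol.simps(3)[of \<alpha> \<beta> s t "Suc k"]
      sol.simps(3)[of "\<lambda>i. \<alpha> (Suc i)" "\<lambda>i. \<beta> (Suc i)" t w k]
    by (simp del: sol.simps mult_pCons_left)
qed (simp_all add: numeral_2_eq_2)

lemma shift: "periodic_rec (\<lambda>i. \<alpha> (Suc i)) (\<lambda>i. \<beta> (Suc i)) p"
  using p_pos \<alpha>_pos \<alpha>_per[of "Suc _"] \<beta>_per[of "Suc _"] by unfold_locales auto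

text \<open>Monodromy matrices at adjacent sites are conjugate. The computation writes the solutions
  \<open>?c\<close>, \<open>?f\<close> in terms of the shifted ones and uses the recursion at site
  \<open>Suc p\<close>. Independence of the cut is what allows trace bounds at different sites to
  share the same band edges.\<close>

lemma disc_shift: "periodic_rec.disc (\<lambda>i. \<alpha> (Suc i)) (\<lambda>i. \<beta> (Suc i)) p = (disc :: 'a::real_normed_field poly)"
proof -
  interpret S: periodic_rec "\<lambda>i. \<alpha> (Suc i)" "\<lambda>i. \<beta> (Suc i)" p by (rule shift)
  have "poly S.disc z = poly disc z" for z :: 'a
  proof -
    let ?c = "\<lambda>k. poly (sol \<alpha> \<beta> 1 0 k) z" and ?f = "\<lambda>k. poly (sol \<alpha> \<beta> 0 1 k) z"
    let ?c' = "\<lambda>k. poly (sol (\<lambda>i. \<alpha> (Suc i)) (\<lambda>i. \<beta> (Suc i)) 1 0 k) z"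
      and ?f' = "\<lambda>k. poly (sol (\<lambda>i. \<alpha> (Suc i)) (\<lambda>i. \<beta> (Suc i)) 0 1 k) z"
    have nz: "of_real (\<alpha> 0) \<noteq> (0::'a)" "of_real (\<alpha> 1) \<noteq> (0::'a)" by simp_all
    have c2: "?c 2 = - of_real (\<alpha> 0) / of_real (\<alpha> 1)" by (simp add: numeral_2_eq_2 field_simps)
    have f2: "?f 2 = (z - of_real (\<beta> 1)) / of_real (\<alpha> 1)" by (simp add: numeral_2_eq_2 field_simps)
    have c: "?c (Suc k) = ?c 2 * ?f' k" for k
      unfolding sol_Suc_shift[of 1 0 k z] S.poly_sol_linear[of 0 "?c 2"] by simp
    have f: "?f (Suc k) = ?c' k + ?f 2 * ?f' k" for k
      unfolding sol_Suc_shift[of 0 1 k z] S.poly_sol_linear[of 1 "?f 2"] by simp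
    have "of_real (\<alpha> (Suc p)) * ?c (Suc (Suc p)) =
        (z - of_real (\<beta> (Suc p))) * ?c (Suc p) - of_real (\<alpha> p) * ?c p"
      using jacobi_rec_sol'[of z 1 0] unfolding jacobi_rec_def by blast
    then have "of_real (\<alpha> 1) * (?c 2 * ?f' (Suc p)) = (z - of_real (\<beta> 1)) * (?c 2 * ?f' p) - of_real (\<alpha> 0) * ?c p"
      using \<alpha>_per[of 1] \<alpha>_per[of 0] \<beta>_per[of 1] unfolding c by simp
    then have "of_real (\<alpha> 0) * ?f' (Suc p) = of_real (\<alpha> 0) * (?f 2 * ?f' p + ?c p)"
      unfolding c2 f2 using nz by (simp add: field_simps)
    then have "?f' (Suc p) = ?f 2 * ?f' p + ?c p" using nz(1) mult_left_cancel by blast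
    then show ?thesis unfolding S.disc_def disc_def poly_add f by simp
  qed
  then show ?thesis by (simp add: poly_eq_poly_eq_iff[symmetric] fun_eq_iff)
qed

section \<open>Degrees and leading coefficients of the discriminant and the boundary value
  polynomials\<close>

lemma prod_\<alpha>_pos: "0 < (\<Prod>i=1..k. \<alpha> i)"
  by (intro prod_pos) (use \<alpha>_pos in auto)

lemma lead_normalisation:
  "coeff (sol \<alpha> \<beta> 0 (1::real) p) (p - 1) = \<alpha> 0 / (\<Prod>i=1..p. \<alpha> i)"
  "coeff (sol \<alpha> \<beta> 1 (0::real) (Suc p)) (p - 1) = - \<alpha> 0 / (\<Prod>i=1..p. \<alpha> i)"
proof -
  obtain q where q: "p = Suc q" using p_pos by (cases p) auto
  have \<alpha>p: "\<alpha> (Suc q) = \<alpha> 0" using \<alpha>_per[of 0] by (simp add: q)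
  have "coeff (sol \<alpha> \<beta> 0 (1::real) (Suc q)) q = 1 / (\<Prod>i=1..q. \<alpha> i)"
    by (rule coeff_sol_0_1[OF \<alpha>_pos])
  then show "coeff (sol \<alpha> \<beta> 0 (1::real) p) (p - 1) = \<alpha> 0 / (\<Prod>i=1..p. \<alpha> i)"
    using \<alpha>_pos[of 0] prod_\<alpha>_pos[of q] by (simp add: q \<alpha>p del: sol.simps)
  have shift: "(\<Prod>i=1..Suc q. \<alpha> i) = \<alpha> 1 * (\<Prod>i=1..q. \<alpha> (Suc i))"
    by (simp add: prod.atLeast_Suc_atMost prod.shift_bounds_cl_Suc_ivl[symmetric] del: prod.cl_ivl_Suc)
  have "coeff (sol (\<lambda>i. \<alpha> (Suc i)) (\<lambda>i. \<beta> (Suc i)) 0 (1::real) (Suc q)) q = 1 / (\<Prod>i=1..q. \<alpha> (Suc i))"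
    by (rule coeff_sol_0_1) (rule \<alpha>_pos)
  then show "coeff (sol \<alpha> \<beta> 1 (0::real) (Suc p)) (p - 1) = - \<alpha> 0 / (\<Prod>i=1..p. \<alpha> i)"
    using sol_const_shift[of \<alpha> \<beta> "Suc q", where 'a=real] \<alpha>_pos[of 1] by (simp add: q shift[unfolded One_nat_def] del: sol.simps prod.cl_ivl_Suc)
qed

lemma degree_sol_1_0: "degree (sol \<alpha> \<beta> 1 (0::real) (Suc k)) \<le> k - 1"
proof (cases k)
  case (Suc j)
  have "sol \<alpha> \<beta> 1 (0::real) (Suc k) =
      smult (- (\<alpha> 0 / \<alpha> 1)) (sol (\<lambda>i. \<alpha> (Suc i)) (\<lambda>i. \<beta> (Suc i)) 0 1 k)"
    using sol_const_shift[of \<alpha> \<beta> k, where 'a=real] \<alpha>_pos[of 1] by simp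
  then show ?thesis
    using degree_sol_0_1[of "\<lambda>i. \<alpha> (Suc i)" "\<lambda>i. \<beta> (Suc i)" j] degree_smult_le order_trans
    unfolding Suc by (metis diff_Suc_1)
qed simp

lemma degree_disc: "degree (disc :: real poly) = p" and lead_coeff_disc: "lead_coeff (disc :: real poly) > 0"
proof -
  have "degree (sol \<alpha> \<beta> 1 (0::real) p) \<le> p"
    using degree_sol_1_0[of "p - 1"] p_pos by (simp del: sol.simps)
  then have le: "degree (disc :: real poly) \<le> p"
    unfolding disc_def using degree_sol_0_1 by (intro degree_add_le) auto
  have "coeff (sol \<alpha> \<beta> 1 (0::real) p) p = 0"
    using degree_sol_1_0[of "p - 1"] p_pos by (intro coeff_eq_0) (simp del: sol.simps)
  then have c: "coeff (disc :: real poly) p = 1 / (\<Prod>i=1..p. \<alpha> i)"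
    unfolding disc_def using coeff_sol_0_1[OF \<alpha>_pos, where k=p] by (simp del: sol.simps)
  then have "coeff (disc :: real poly) p \<noteq> 0" by simp
  from le_degree[OF this] show d: "degree (disc :: real poly) = p" using le by simp
  show "lead_coeff (disc :: real poly) > 0" unfolding d c using prod_\<alpha>_pos[of p] by simp
qed

lemma degree_bvp_dirichlet: "degree (bvp 0 (1::real)) = p - 1"
  and lead_coeff_bvp_dirichlet: "lead_coeff (bvp 0 (1::real)) = - (\<alpha> 0 / (\<Prod>i=1..p. \<alpha> i))"
proof -
  have bvp: "bvp 0 (1::real) = - sol \<alpha> \<beta> 0 1 p" by (simp add: bvp_def)
  have le: "degree (bvp 0 (1::real)) \<le> p - 1"
    using degree_sol_0_1[of \<alpha> \<beta> "p - 1"] p_pos by (simp add: bvp del: sol.simps)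
  have c: "coeff (bvp 0 (1::real)) (p - 1) = - (\<alpha> 0 / (\<Prod>i=1..p. \<alpha> i))"
    unfolding bvp coeff_minus lead_normalisation by simp
  then have "coeff (bvp 0 (1::real)) (p - 1) \<noteq> 0" by simp
  from le_degree[OF this] show d: "degree (bvp 0 (1::real)) = p - 1" using le by simp
  show "lead_coeff (bvp 0 (1::real)) = - (\<alpha> 0 / (\<Prod>i=1..p. \<alpha> i))" unfolding d c ..
qed

text \<open>The two terms with \<open>\<alpha> 0\<close> stem from the solution with values 1, 0 at
  site \<open>Suc p\<close> and the one with values 0, 1 at site p, both of degree p - 1. After
  division by the leading coefficient they become \<open>\<alpha> 0 * (t + 1 / t)\<close>, up to
  sign.\<close>

lemma coeff_bvp_mixed:
  fixes t :: real
  shows "coeff (bvp 1 t) p = t / (\<Prod>i=1..p. \<alpha> i)"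
    and "coeff (bvp 1 t) (p - 1) = - (t * (\<Sum>i=1..p. \<beta> i) + \<alpha> 0 + t\<^sup>2 * \<alpha> 0) / (\<Prod>i=1..p. \<alpha> i)"
proof -
  obtain q where q: "p = Suc q" using p_pos by (cases p) auto
  have bvp: "bvp 1 t = sol \<alpha> \<beta> 1 0 (Suc p) + smult t (sol \<alpha> \<beta> 0 1 (Suc p))
      - smult t (sol \<alpha> \<beta> 1 0 p) - smult (t\<^sup>2) (sol \<alpha> \<beta> 0 1 p)"
    unfolding bvp_def
    by (subst (1 2) sol_linear) (simp add: smult_add_right power2_eq_square del: sol.simps)
  have z: "coeff (sol \<alpha> \<beta> 1 (0::real) (Suc p)) p = 0" "coeff (sol \<alpha> \<beta> 1 (0::real) p) p = 0"
      "coeff (sol \<alpha> \<beta> 0 (1::real) p) p = 0"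
    using degree_sol_1_0[of p] degree_sol_1_0[of q] degree_sol_0_1[of \<alpha> \<beta> q] p_pos
    by (intro coeff_eq_0; simp add: q del: sol.simps)+
  show "coeff (bvp 1 t) p = t / (\<Prod>i=1..p. \<alpha> i)"
    unfolding bvp using coeff_sol_0_1[OF \<alpha>_pos, where k=p] by (simp add: z del: sol.simps)
  have z': "coeff (sol \<alpha> \<beta> 1 (0::real) p) (p - 1) = 0"
  proof (cases q)
    case 0
    then show ?thesis by (simp add: q)
  next
    case (Suc r)
    then show ?thesis using degree_sol_1_0[of q] by (intro coeff_eq_0) (simp add: q del: sol.simps)
  qed
  have "coeff (sol \<alpha> \<beta> 0 (1::real) (Suc p)) (p - 1) = - (\<Sum>i=1..p. \<beta> i) / (\<Prod>i=1..p. \<alpha> i)"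
    using coeff_sol_0_1_second[OF \<alpha>_pos, where k=q] by (simp add: q del: sol.simps)
  then have "coeff (bvp 1 t) (p - 1) = - \<alpha> 0 / (\<Prod>i=1..p. \<alpha> i)
      + t * (- (\<Sum>i=1..p. \<beta> i) / (\<Prod>i=1..p. \<alpha> i)) - t\<^sup>2 * (\<alpha> 0 / (\<Prod>i=1..p. \<alpha> i))"
    unfolding bvp coeff_add coeff_diff coeff_smult lead_normalisation z' by simp
  moreover have "- a / P + t * (- S / P) - t\<^sup>2 * (a / P) = - (t * S + a + t\<^sup>2 * a) / P" for a S P
    by (cases "P = 0") (simp_all add: field_simps)
  ultimately show "coeff (bvp 1 t) (p - 1) = - (t * (\<Sum>i=1..p. \<beta> i) + \<alpha> 0 + t\<^sup>2 * \<alpha> 0) / (\<Prod>i=1..p. \<alpha> i)"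
    by (simp only:)
qed

lemma degree_bvp_mixed: "degree (bvp 1 (t::real)) = p" if "t \<noteq> 0"
proof -
  obtain q where q: "p = Suc q" using p_pos by (cases p) auto
  have "degree (sol \<alpha> \<beta> 1 t (Suc p)) \<le> p" "degree (sol \<alpha> \<beta> 1 t p) \<le> p"
    unfolding sol_linear[of _ _ 1 t]
    using degree_sol_1_0[of p] degree_sol_1_0[of q] degree_sol_0_1[of \<alpha> \<beta> q] degree_sol_0_1[of \<alpha> \<beta> p] q
    by (auto intro!: degree_add_le order_trans[OF degree_smult_le] simp del: sol.simps)
  then have "degree (bvp 1 t) \<le> p"
    unfolding bvp_def by (intro degree_diff_le order_trans[OF degree_smult_le]) auto
  moreover have "coeff (bvp 1 t) p \<noteq> 0" using coeff_bvp_mixed(1)[of t] that by simp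
  ultimately show ?thesis using le_degree[of "bvp 1 t" p] by (intro antisym) auto
qed

text \<open>For s = 0 the boundary value polynomial is, up to a constant factor, the characteristic
  polynomial of the truncation to the sites 1 to p - 1, so its roots add up to the trace of that
  truncation.\<close>

lemma dirichlet_points:
  obtains e where "strict_mono_on {..<p - 1} e"
    and "\<And>i. i < p - 1 \<Longrightarrow> 2 \<le> (-1) ^ (p - 1 - i) * poly disc (e i)"
    and "\<And>x. poly (sol \<alpha> \<beta> 0 1 p) x = 0 \<Longrightarrow> \<exists>i<p - 1. x = e i"
    and "(\<Sum>i<p - 1. e i) = (\<Sum>i=1..p - 1. \<beta> i)"
proof -
  let ?Q = "bvp 0 (1::real)"
  have lc: "lead_coeff ?Q < 0" using lead_coeff_bvp_dirichlet prod_\<alpha>_pos[of p] \<alpha>_pos[of 0] by simp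
  then have Q0: "?Q \<noteq> 0" by auto
  obtain e where e: "strict_mono_on {..<p - 1} e"
    and Q: "?Q = smult (lead_coeff ?Q) (\<Prod>i<p - 1. [:- e i, 1:])"
    and D: "\<And>i. i < p - 1 \<Longrightarrow> 2 \<le> sgn (lead_coeff ?Q) * (-1) ^ (p - 1 - 1 - i) * poly disc (e i)"
    using bvp_roots_enum[of 0 "1::real"] Q0 unfolding degree_bvp_dirichlet by auto
  show thesis
  proof (rule that[OF e])
    fix i assume i: "i < p - 1"
    \<comment> \<open>The negative leading coefficient makes up for the degree p - 1 in place of p,
      so the sign pattern is that of the p - 1 lowest eigenvalues of a mixed problem with t >
      0.\<close>
    have "p - 1 - i = Suc (p - 1 - 1 - i)" using i by linarith
    then have "(-1) ^ (p - 1 - i) = sgn (lead_coeff ?Q) * (-1) ^ (p - 1 - 1 - i)" using lc by simp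
    then show "2 \<le> (-1) ^ (p - 1 - i) * poly disc (e i)" using D[OF i] by simp
  next
    fix x :: real assume "poly (sol \<alpha> \<beta> 0 1 p) x = 0"
    then have "poly ?Q x = 0" by (simp add: bvp_def)
    then have "(\<Prod>i<p - 1. x - e i) = 0" using Q0 by (subst (asm) Q) (simp add: poly_prod)
    then show "\<exists>i<p - 1. x = e i" by auto
  next
    show "(\<Sum>i<p - 1. e i) = (\<Sum>i=1..p - 1. \<beta> i)"
    proof (cases "p - 1")
      case (Suc k)
      have p: "p = Suc (Suc k)" using Suc p_pos by simp
      have "coeff ?Q k = - lead_coeff ?Q * (\<Sum>i<Suc k. e i)"
        by (subst Q) (simp only: Suc coeff_smult coeff_prod_linear_second)
      moreover have bvp: "?Q = - sol \<alpha> \<beta> 0 1 p" by (simp add: bvp_def)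
      have "coeff ?Q k = (\<Sum>i=1..Suc k. \<beta> i) / (\<Prod>i=1..Suc k. \<alpha> i)"
        unfolding bvp unfolding p coeff_minus coeff_sol_0_1_second[of \<alpha>, OF \<alpha>_pos]
        by (simp only: minus_divide_left minus_minus)
      moreover have "- lead_coeff ?Q = 1 / (\<Prod>i=1..Suc k. \<alpha> i)"
        unfolding degree_bvp_dirichlet unfolding bvp Suc unfolding p coeff_minus coeff_sol_0_1[of \<alpha>, OF \<alpha>_pos] by simp
      ultimately show ?thesis using prod_\<alpha>_pos[of "Suc k"] unfolding Suc by (simp add: field_simps)
    qed simp
  qed
qed

text \<open>Both signs of t are kept: positive t enters the trace bounds, negative t is used to
  refute a negative ratio of the ground state.\<close>

lemma mixed_points:
  fixes t :: real
  assumes "t \<noteq> 0"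
  obtains e where "strict_mono_on {..<p} e"
    and "\<And>i. i < p \<Longrightarrow> 2 \<le> sgn t * (-1) ^ (p - 1 - i) * poly disc (e i)"
    and "\<And>x. poly (bvp 1 t) x = 0 \<Longrightarrow> \<exists>i<p. x = e i"
    and "(\<Sum>i<p. e i) = (\<Sum>i=1..p. \<beta> i) + \<alpha> 0 * (t + 1 / t)"
proof -
  let ?Q = "bvp 1 t"
  note deg = degree_bvp_mixed[OF assms]
  define L where "L = 1 / (\<Prod>i=1..p. \<alpha> i)"
  have L: "L > 0" unfolding L_def using prod_\<alpha>_pos[of p] by simp
  have lc: "lead_coeff ?Q = t * L" unfolding deg coeff_bvp_mixed L_def by simp
  then have Q0: "?Q \<noteq> 0" using assms L by auto
  obtain e where e: "strict_mono_on {..<p} e"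
    and Q: "?Q = smult (lead_coeff ?Q) (\<Prod>i<p. [:- e i, 1:])"
    and D: "\<And>i. i < p \<Longrightarrow> 2 \<le> sgn (lead_coeff ?Q) * (-1) ^ (p - 1 - i) * poly disc (e i)"
    using bvp_roots_enum[of 1 t] Q0 unfolding deg by auto
  show thesis
  proof (rule that[OF e])
    fix i assume i: "i < p"
    have "sgn (lead_coeff ?Q) = sgn t" using L by (simp add: lc sgn_mult)
    then show "2 \<le> sgn t * (-1) ^ (p - 1 - i) * poly disc (e i)" using D[OF i] by simp
  next
    fix x :: real assume "poly ?Q x = 0"
    then have "(\<Prod>i<p. x - e i) = 0" using assms L by (subst (asm) Q) (simp add: poly_prod lc)
    then show "\<exists>i<p. x = e i" by auto
  next
    obtain k where k: "p = Suc k" using p_pos by (cases p) auto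
    have "coeff (\<Prod>i<p. [:- e i, 1:]) (p - 1) = - (\<Sum>i<p. e i)"
      unfolding k by (simp only: coeff_prod_linear_second diff_Suc_1)
    then have "coeff ?Q (p - 1) = - (t * L) * (\<Sum>i<p. e i)"
      using arg_cong[OF Q, of "\<lambda>q. coeff q (p - 1)"] unfolding lc by simp
    moreover have "coeff ?Q (p - 1) = - (L * (t * (\<Sum>i=1..p. \<beta> i) + \<alpha> 0 + t\<^sup>2 * \<alpha> 0))"
      unfolding coeff_bvp_mixed L_def by (simp only: times_divide_eq_left mult_1_left minus_divide_left)
    ultimately have "L * (t * (\<Sum>i<p. e i)) = L * (t * (\<Sum>i=1..p. \<beta> i) + \<alpha> 0 + t\<^sup>2 * \<alpha> 0)"
      by (simp only: neg_equal_iff_equal mult_minus_left mult_ac)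
    then have "t * (\<Sum>i<p. e i) = t * (\<Sum>i=1..p. \<beta> i) + \<alpha> 0 + t\<^sup>2 * \<alpha> 0" using L by simp
    then show "(\<Sum>i<p. e i) = (\<Sum>i=1..p. \<beta> i) + \<alpha> 0 * (t + 1 / t)"
      using assms by (simp add: field_simps power2_eq_square)
  qed
qed

section \<open>Position of the eigenvalues relative to the gaps, and the resulting trace
  bounds\<close>

lemma disc_oscillates: "\<exists>l u. oscillates p disc l u"
proof -
  obtain d where d: "strict_mono_on {..<p - 1} d"
    "\<And>i. i < p - 1 \<Longrightarrow> 2 \<le> (-1) ^ (p - 1 - i) * poly disc (d i)"
    "\<And>x. poly (sol \<alpha> \<beta> 0 1 p) x = 0 \<Longrightarrow> \<exists>i<p - 1. x = d i"
    "(\<Sum>i<p - 1. d i) = (\<Sum>i=1..p - 1. \<beta> i)"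
    by (rule dirichlet_points) (rule that)
  \<comment> \<open>The p - 1 Dirichlet eigenvalues serve as the alternating points.\<close>
  show ?thesis by (rule oscillates_exists[OF degree_disc p_pos lead_coeff_disc d(1,2)])
qed

lemma gap_below_top:
  assumes osc: "oscillates p disc l u" and i: "i < p - 1"
  shows "u (Suc i) < l p"
proof -
  have le: "u m \<le> u (p - 1)" if "m \<le> p - 1" "1 \<le> m" for m
    using that
  proof (induction m rule: inc_induct)
    case (step m)
    then have "m < p" "1 \<le> Suc m" "Suc m < p" by linarith+
    then have "u m < l (Suc m)" "l (Suc m) \<le> u (Suc m)"
      using oscillatesD(1,2)[OF osc] by auto
    with step.IH show ?case by simp
  qed simp
  have "u (p - 1) < l p" using oscillatesD(1)[OF osc, of "p - 1"] p_pos by simp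
  then show ?thesis using le[of "Suc i"] i by simp
qed

text \<open>Every Dirichlet eigenvalue lies at or below the upper edge of an interior gap, hence
  strictly below \<open>l p\<close>.\<close>

lemma dirichlet_nonzero_top:
  assumes osc: "oscillates p disc l u"
  shows "poly (sol \<alpha> \<beta> 0 1 p) (l p) \<noteq> 0"
proof
  obtain d where d: "strict_mono_on {..<p - 1} d"
    "\<And>i. i < p - 1 \<Longrightarrow> 2 \<le> (-1) ^ (p - 1 - i) * poly disc (d i)"
    "\<And>x. poly (sol \<alpha> \<beta> 0 1 p) x = 0 \<Longrightarrow> \<exists>i<p - 1. x = d i"
    "(\<Sum>i<p - 1. d i) = (\<Sum>i=1..p - 1. \<beta> i)"
    by (rule dirichlet_points) (rule that)
  assume "poly (sol \<alpha> \<beta> 0 1 p) (l p) = 0"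
  then obtain i where i: "i < p - 1" "l p = d i" using d(3) by blast
  then have "l p \<le> u (Suc i)" using oscillates_alternating_points(2)[OF osc _ _ d(1,2)] by simp
  then show False using gap_below_top[OF osc i(1)] by simp
qed

text \<open>At the top of the spectrum the periodic solution is a ground state, so its boundary ratio
  \<open>\<tau>\<close> at the chosen site must be positive: otherwise a boundary value problem would have its
  largest eigenvalue at or above \<open>l p\<close>, where the discriminant is at least \<open>2\<close>, although it is at
  most \<open>-2\<close> there.\<close>

lemma ground_state_ratio:
  assumes osc: "oscillates p disc l u"
  obtains \<tau> where "0 < \<tau>" "poly (bvp 1 \<tau>) (l p) = 0"
proof -
  let ?x = "l p"
  have "1\<^sup>2 - poly disc ?x * 1 + 1 = 0" using oscillatesD(7)[OF osc] by simp
  then obtain s t where st: "s \<noteq> 0 \<or> t \<noteq> 0"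
    "poly (sol \<alpha> \<beta> s t p) ?x = 1 * s" "poly (sol \<alpha> \<beta> s t (Suc p)) ?x = 1 * t"
    using monodromy_eigenvector_exists by blast
  have s: "s \<noteq> 0"
  proof
    assume "s = 0"
    then have "t \<noteq> 0" "t * poly (sol \<alpha> \<beta> 0 1 p) ?x = 0"
      using st(1,2) poly_sol_linear[of s t p ?x] by simp_all
    then show False using dirichlet_nonzero_top[OF osc] by simp
  qed
  define \<tau> where "\<tau> = t / s"
  have scale: "poly (sol \<alpha> \<beta> 1 \<tau> k) ?x = poly (sol \<alpha> \<beta> s t k) ?x / s" for k
    using poly_sol_linear[of 1 \<tau> k ?x] poly_sol_linear[of s t k ?x] s
    by (simp add: \<tau>_def add_divide_distrib del: sol.simps)
  have root: "poly (bvp 1 \<tau>) ?x = 0" unfolding bvp_def poly_diff poly_smult scale st by (simp add: \<tau>_def)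
  \<comment> \<open>A ratio 0 is a Dirichlet condition one site further: the solution vanishes at
    sites 1 and \<open>Suc p\<close>. After shifting the cut by one this is excluded like s = 0
    above.\<close>
  have "\<tau> \<noteq> 0"
  proof
    assume \<tau>0: "\<tau> = 0"
    interpret S: periodic_rec "\<lambda>i. \<alpha> (Suc i)" "\<lambda>i. \<beta> (Suc i)" p by (rule shift)
    have "poly (sol \<alpha> \<beta> 1 0 (Suc p)) ?x = 0" using root by (simp add: \<tau>0 bvp_def del: sol.simps)
    then have "poly (sol (\<lambda>i. \<alpha> (Suc i)) (\<lambda>i. \<beta> (Suc i)) 0 1 p) ?x = 0"
      using sol_const_shift[of \<alpha> \<beta> p, where 'a=real] by (simp del: sol.simps)
    moreover have "oscillates p S.disc l u" using osc by (simp only: disc_shift)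
    ultimately show False using S.dirichlet_nonzero_top by blast
  qed
  moreover have "\<not> \<tau> < 0"
  proof
    assume neg: "\<tau> < 0"
    then have "\<tau> \<noteq> 0" by simp
    then obtain e where e: "strict_mono_on {..<p} e"
      "\<And>i. i < p \<Longrightarrow> 2 \<le> sgn \<tau> * (-1) ^ (p - 1 - i) * poly disc (e i)"
      "\<And>x. poly (bvp 1 \<tau>) x = 0 \<Longrightarrow> \<exists>i<p. x = e i"
      "(\<Sum>i<p. e i) = (\<Sum>i=1..p. \<beta> i) + \<alpha> 0 * (\<tau> + 1 / \<tau>)"
      by (rule mixed_points) (rule that)
    obtain i where i: "i < p" "?x = e i" using e(3)[OF root] by blast
    then have "i = p - 1 \<or> i < p - 1 \<and> p - 1 < p" by linarith
    then have "?x \<le> e (p - 1)"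
      using strict_mono_onD[OF e(1), of i "p - 1"] i by auto
    then have "2 \<le> poly disc (e (p - 1))" by (rule oscillatesD(5)[OF osc])
    then show False using e(2)[of "p - 1"] neg p_pos by simp
  qed
  ultimately show thesis using that[of \<tau>] root by linarith
qed

text \<open>The topmost mixed eigenvalue has no gap edge above it. At t = 1 only lower bounds are
  used, so this does no harm. For the upper bound it is pinned to \<open>l p\<close> by the ground
  state ratio \<tau>, and \<open>\<tau> + 1 / \<tau> \<ge> 2\<close> points in the required
  direction.\<close>

lemma trace_bounds:
  assumes osc: "oscillates p disc l u"
  shows "(\<Sum>i<p - 1. l (Suc i)) \<le> (\<Sum>i=1..p - 1. \<beta> i)"
    and "(\<Sum>i=1..p - 1. \<beta> i) \<le> (\<Sum>i<p - 1. u (Suc i))"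
    and "l p + (\<Sum>i<p - 1. l (Suc i)) \<le> (\<Sum>i=1..p. \<beta> i) + 2 * \<alpha> 0"
    and "(\<Sum>i=1..p. \<beta> i) + 2 * \<alpha> 0 \<le> l p + (\<Sum>i<p - 1. u (Suc i))"
proof -
  obtain q where q: "p = Suc q" using p_pos by (cases p) auto
  obtain d where d: "strict_mono_on {..<p - 1} d"
    "\<And>i. i < p - 1 \<Longrightarrow> 2 \<le> (-1) ^ (p - 1 - i) * poly disc (d i)"
    "\<And>x. poly (sol \<alpha> \<beta> 0 1 p) x = 0 \<Longrightarrow> \<exists>i<p - 1. x = d i"
    "(\<Sum>i<p - 1. d i) = (\<Sum>i=1..p - 1. \<beta> i)"
    by (rule dirichlet_points) (rule that)
  note dl = oscillates_alternating_points[OF osc _ _ d(1) d(2)]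
  show "(\<Sum>i<p - 1. l (Suc i)) \<le> (\<Sum>i=1..p - 1. \<beta> i)"
    unfolding d(4)[symmetric] by (intro sum_mono dl(1)) auto
  show "(\<Sum>i=1..p - 1. \<beta> i) \<le> (\<Sum>i<p - 1. u (Suc i))"
    unfolding d(4)[symmetric] by (intro sum_mono dl(2)) auto
  show "l p + (\<Sum>i<p - 1. l (Suc i)) \<le> (\<Sum>i=1..p. \<beta> i) + 2 * \<alpha> 0"
  proof -
    obtain e where e: "strict_mono_on {..<p} e"
      "\<And>i. i < p \<Longrightarrow> 2 \<le> sgn 1 * (-1) ^ (p - 1 - i) * poly disc (e i)"
      "\<And>x. poly (bvp 1 1) x = 0 \<Longrightarrow> \<exists>i<p. x = e i"
      "(\<Sum>i<p. e i) = (\<Sum>i=1..p. \<beta> i) + \<alpha> 0 * (1 + 1 / 1)"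
      by (rule mixed_points[OF one_neq_zero]) (rule that)
    have "(\<Sum>i<p. l (Suc i)) \<le> (\<Sum>i<p. e i)"
      using oscillates_alternating_points(1)[OF osc _ _ e(1)] e(2) by (intro sum_mono) auto
    then show ?thesis unfolding e(4) by (simp add: q mult.commute)
  qed
  show "(\<Sum>i=1..p. \<beta> i) + 2 * \<alpha> 0 \<le> l p + (\<Sum>i<p - 1. u (Suc i))"
  proof -
    obtain \<tau> where \<tau>: "0 < \<tau>" "poly (bvp 1 \<tau>) (l p) = 0" using ground_state_ratio[OF osc] by blast
    from \<tau>(1) have "\<tau> \<noteq> 0" by simp
    then obtain e where e: "strict_mono_on {..<p} e"
      "\<And>i. i < p \<Longrightarrow> 2 \<le> sgn \<tau> * (-1) ^ (p - 1 - i) * poly disc (e i)"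
      "\<And>x. poly (bvp 1 \<tau>) x = 0 \<Longrightarrow> \<exists>i<p. x = e i"
      "(\<Sum>i<p. e i) = (\<Sum>i=1..p. \<beta> i) + \<alpha> 0 * (\<tau> + 1 / \<tau>)"
      by (rule mixed_points) (rule that)
    have eu: "e i \<le> u (Suc i)" if "i < p - 1" for i
      using oscillates_alternating_points(2)[OF osc _ _ e(1) _ that] e(2) \<tau>(1) by simp
    obtain i where i: "i < p" "l p = e i" using e(3)[OF \<tau>(2)] by blast
    \<comment> \<open>All lower eigenvalues lie in the interior gaps, below \<open>l p\<close>, so
      \<open>l p\<close> can only be the last one.\<close>
    have "\<not> i < p - 1" using eu[of i] gap_below_top[OF osc, of i] i(2) by force
    then have top: "e q = l p" using i by (simp add: q less_Suc_eq)
    have "2 \<le> \<tau> + 1 / \<tau>"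
    proof -
      have "0 \<le> (\<tau> - 1)\<^sup>2 / \<tau>" using \<tau>(1) by simp
      also have "\<dots> = \<tau> + 1 / \<tau> - 2" using \<tau>(1) by (simp add: field_simps power2_eq_square)
      finally show ?thesis by simp
    qed
    then have "(\<Sum>i=1..p. \<beta> i) + 2 * \<alpha> 0 \<le> (\<Sum>i<p. e i)"
      unfolding e(4) using \<alpha>_pos[of 0] by (simp add: mult.commute)
    also have "\<dots> = l p + (\<Sum>i<p - 1. e i)" unfolding top[symmetric] by (simp add: q)
    also have "\<dots> \<le> l p + (\<Sum>i<p - 1. u (Suc i))" by (intro add_left_mono sum_mono eu) auto
    finally show ?thesis .
  qed
qed

end

section \<open>Convolution-dominated kernels\<close>

lemma ell2_finite_support:
  assumes "finite F" "\<And>n. n \<notin> F \<Longrightarrow> y n = 0"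
  shows "y \<in> ell2" and "(ell2_norm y)\<^sup>2 = (\<Sum>n\<in>F. (cmod (y n))\<^sup>2)"
proof -
  have "((\<lambda>n. (cmod (y n))\<^sup>2) has_sum (\<Sum>n\<in>F. (cmod (y n))\<^sup>2)) UNIV"
    using has_sum_finite[OF assms(1), of "\<lambda>n. (cmod (y n))\<^sup>2"]
    by (subst has_sum_cong_neutral[where T=F and g="\<lambda>n. (cmod (y n))\<^sup>2"]) (auto simp: assms(2))
  note h = this
  show "y \<in> ell2" using h unfolding ell2_def by (auto simp: summable_on_def)
  show "(ell2_norm y)\<^sup>2 = (\<Sum>n\<in>F. (cmod (y n))\<^sup>2)"
    unfolding ell2_norm_def infsumI[OF h] by (simp add: sum_nonneg)
qed

lemma ell2_norm_nonneg [simp]: "0 \<le> ell2_norm y"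
  unfolding ell2_norm_def by (simp add: infsum_nonneg)

lemma ell2_norm_sq: "(ell2_norm y)\<^sup>2 = (\<Sum>\<^sub>\<infinity>n. (cmod (y n))\<^sup>2)"
  unfolding ell2_norm_def by (simp add: infsum_nonneg)

lemma ell2_finite_sum_le: "y \<in> ell2 \<Longrightarrow> finite F \<Longrightarrow> (\<Sum>n\<in>F. (cmod (y n))\<^sup>2) \<le> (ell2_norm y)\<^sup>2"
  unfolding ell2_norm_sq ell2_def by (intro finite_sum_le_infsum) auto

lemma ell2I:
  assumes "\<And>F. finite F \<Longrightarrow> (\<Sum>n\<in>F. (cmod (y n))\<^sup>2) \<le> C\<^sup>2" "0 \<le> C"
  shows "y \<in> ell2" and "ell2_norm y \<le> C"
proof -
  have s: "(\<lambda>n. (cmod (y n))\<^sup>2) summable_on UNIV"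
    by (rule nonneg_bdd_above_summable_on) (auto intro!: bdd_aboveI2[where M="C\<^sup>2"] assms)
  then show "y \<in> ell2" by (simp add: ell2_def)
  have "(ell2_norm y)\<^sup>2 \<le> C\<^sup>2"
    unfolding ell2_norm_sq by (rule infsum_le_finite_sums[OF s]) (use assms in auto)
  then show "ell2_norm y \<le> C" using assms(2) by (rule power2_le_imp_le)
qed

lemma ell2_coordinate_le: "y \<in> ell2 \<Longrightarrow> cmod (y n) \<le> ell2_norm y"
  using ell2_finite_sum_le[of y "{n}"] by (auto intro: power2_le_imp_le)

lemma summable_on_int_abs_power:
  fixes r :: real
  assumes "0 \<le> r" "r < 1"
  shows "(\<lambda>j::int. r ^ nat \<bar>j\<bar>) summable_on UNIV"
proof -
  have "summable (\<lambda>n. norm (r ^ n))" using assms by (simp add: summable_geometric)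
  then have "(\<lambda>n. r ^ n) summable_on (UNIV::nat set)" by (rule norm_summable_imp_summable_on)
  then have nat: "(\<lambda>j. r ^ nat \<bar>j\<bar>) summable_on range f" if "inj f" "\<And>n. nat \<bar>f n\<bar> = n" for f :: "nat \<Rightarrow> int"
    by (subst summable_on_reindex) (use that in \<open>auto simp: o_def\<close>)
  have "(\<lambda>j. r ^ nat \<bar>j\<bar>) summable_on range int" by (rule nat) (auto simp: inj_def)
  moreover have "(\<lambda>j. r ^ nat \<bar>j\<bar>) summable_on range (\<lambda>n. - int n) - range int"
    by (rule summable_on_subset_banach[OF nat[of "\<lambda>n. - int n"]]) (auto simp: inj_def)
  ultimately have "(\<lambda>j. r ^ nat \<bar>j\<bar>) summable_on (range int \<union> (range (\<lambda>n. - int n) - range int))"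
    by (intro summable_on_Un_disjoint) auto
  moreover have "range int \<union> (range (\<lambda>n. - int n) - range int) = UNIV"
  proof -
    have "j \<in> range int \<or> j \<in> range (\<lambda>n. - int n)" for j
      by (cases j rule: int_cases2) auto
    then show ?thesis by auto
  qed
  ultimately show ?thesis by simp
qed

text \<open>Young's inequality for kernels dominated by a summable function of \<open>n - k\<close>:
  the operator norm is at most the total mass of that function. Positivity at 0 allows division by
  the mass.\<close>

locale convolution_bound =
  fixes G :: "int \<Rightarrow> int \<Rightarrow> complex" and g :: "int \<Rightarrow> real"
  assumes le: "\<And>n k. cmod (G n k) \<le> g (n - k)"
    and summable: "g summable_on UNIV"
    and pos: "0 < g 0"
begin

definition op :: "(int \<Rightarrow> complex) \<Rightarrow> int \<Rightarrow> complex" where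
  "op y n = (\<Sum>\<^sub>\<infinity>k. G n k * y k)"

lemma nonneg: "0 \<le> g j"
  using le[of j 0] order_trans[OF norm_ge_zero] by force

lemma kernel_row: "(\<lambda>k. g (n - k)) summable_on UNIV" "(\<Sum>\<^sub>\<infinity>k. g (n - k)) = (\<Sum>\<^sub>\<infinity>j. g j)"
proof -
  have bij: "bij_betw (\<lambda>k. n - k) UNIV (UNIV::int set)"
    by (rule bij_betwI[where g="\<lambda>k. n - k"]) auto
  show "(\<lambda>k. g (n - k)) summable_on UNIV"
    using summable_on_reindex_bij_betw[OF bij, of g] summable by simp
  show "(\<Sum>\<^sub>\<infinity>k. g (n - k)) = (\<Sum>\<^sub>\<infinity>j. g j)"
    by (rule infsum_reindex_bij_betw[OF bij])
qed

lemma abs_summable: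
  assumes "\<And>k. cmod (x k) \<le> B"
  shows "(\<lambda>k. norm (G n k * x k)) summable_on UNIV"
proof (rule Infinite_Sum.abs_summable_on_comparison_test')
  show "(\<lambda>k. g (n - k) * B) summable_on UNIV" by (rule summable_on_cmult_left[OF kernel_row(1)])
  show "norm (G n k * x k) \<le> g (n - k) * B" for k
    unfolding norm_mult using le[of n k] assms[of k] nonneg by (intro mult_mono) auto
qed

lemma summable_bounded: "(\<And>k. cmod (x k) \<le> B) \<Longrightarrow> (\<lambda>k. G n k * x k) summable_on UNIV"
  by (rule abs_summable_summable) (rule abs_summable)

definition mass :: real where "mass = (\<Sum>\<^sub>\<infinity>j. g j)"

lemma mass_pos: "0 < mass"
  unfolding mass_def using finite_sum_le_infsum[OF summable, of "{0}"] pos nonneg by simp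

lemma op_pointwise:
  assumes y: "y \<in> ell2"
  shows "(\<lambda>k. g (n - k) * (cmod (y k))\<^sup>2) summable_on UNIV"
    and "(cmod (op y n))\<^sup>2 \<le> mass * (\<Sum>\<^sub>\<infinity>k. g (n - k) * (cmod (y k))\<^sup>2)"
proof -
  define Y where "Y = ell2_norm y"
  have Y: "cmod (y k) \<le> Y" for k unfolding Y_def by (rule ell2_coordinate_le[OF y])
  have s1: "(\<lambda>k. g (n - k) * cmod (y k)) summable_on UNIV"
    by (rule summable_on_comparison_test[OF summable_on_cmult_left[OF kernel_row(1)[of n], of Y]])
      (use Y nonneg in \<open>auto intro!: mult_left_mono\<close>)
  have Y2: "(cmod (y k))\<^sup>2 \<le> Y\<^sup>2" for k using Y by (intro power_mono) auto
  show s2: "(\<lambda>k. g (n - k) * (cmod (y k))\<^sup>2) summable_on UNIV"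
    by (rule summable_on_comparison_test[OF summable_on_cmult_left[OF kernel_row(1)[of n], of "Y\<^sup>2"]])
      (use Y2 nonneg in \<open>auto intro!: mult_left_mono\<close>)
  define X where "X = (\<Sum>\<^sub>\<infinity>k. g (n - k) * cmod (y k))"
  define S where "S = (\<Sum>\<^sub>\<infinity>k. g (n - k) * (cmod (y k))\<^sup>2)"
  have X0: "0 \<le> X" unfolding X_def by (intro infsum_nonneg) (auto simp: nonneg)
  have abs: "(\<lambda>k. norm (G n k * y k)) summable_on UNIV" by (rule abs_summable[OF Y])
  have "cmod (op y n) \<le> (\<Sum>\<^sub>\<infinity>k. norm (G n k * y k))"
    unfolding op_def using norm_infsum_bound[OF abs] .
  also have "\<dots> \<le> X" unfolding X_def
    by (rule infsum_mono[OF abs s1]) (auto simp: norm_mult intro!: mult_right_mono le)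
  finally have opX: "cmod (op y n) \<le> X" .
  define t where "t = X / mass"
  \<comment> \<open>Cauchy-Schwarz with weight g: expanding this nonnegative quadratic at its
    minimiser \<open>t = X / mass\<close> gives \<open>X\<^sup>2 \<le> mass * S\<close>.\<close>
  have "0 \<le> (\<Sum>\<^sub>\<infinity>k. g (n - k) * (cmod (y k) - t)\<^sup>2)"
    by (intro infsum_nonneg mult_nonneg_nonneg) (auto simp: nonneg)
  also have "(\<lambda>k. g (n - k) * (cmod (y k) - t)\<^sup>2) =
      (\<lambda>k. g (n - k) * (cmod (y k))\<^sup>2 + ((- 2 * t) * (g (n - k) * cmod (y k)) + t\<^sup>2 * g (n - k)))"
    by (auto simp: power2_eq_square algebra_simps)
  also have "infsum \<dots> UNIV = S + ((- 2 * t) * X + t\<^sup>2 * mass)"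
    unfolding S_def X_def mass_def kernel_row(2)[of n, symmetric]
    by (subst infsum_add infsum_cmult_right'; (intro summable_on_add summable_on_cmult_right s1 s2 kernel_row(1))?)+ simp
  also have "\<dots> = S - X\<^sup>2 / mass"
    using mass_pos by (simp add: t_def field_simps power2_eq_square)
  finally have "X\<^sup>2 \<le> mass * S" using mass_pos by (simp add: field_simps)
  moreover have "(cmod (op y n))\<^sup>2 \<le> X\<^sup>2" using opX by (intro power_mono) auto
  ultimately show "(cmod (op y n))\<^sup>2 \<le> mass * (\<Sum>\<^sub>\<infinity>k. g (n - k) * (cmod (y k))\<^sup>2)"
    unfolding S_def by linarith
qed

lemma finite_column: "finite F \<Longrightarrow> (\<Sum>n\<in>F. g (n - k)) \<le> mass"
proof -
  assume F: "finite F"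
  have "(\<Sum>n\<in>F. g (n - k)) = (\<Sum>j\<in>(\<lambda>n. n - k) ` F. g j)"
    by (subst sum.reindex) (auto simp: inj_on_def)
  also have "\<dots> \<le> mass" unfolding mass_def
    by (rule finite_sum_le_infsum[OF summable]) (use F nonneg in auto)
  finally show ?thesis .
qed

lemma op_ell2:
  assumes y: "y \<in> ell2"
  shows "op y \<in> ell2" and "ell2_norm (op y) \<le> mass * ell2_norm y"
proof -
  have sy: "(\<lambda>k. (cmod (y k))\<^sup>2) summable_on UNIV" using y by (simp add: ell2_def)
  have "(\<Sum>n\<in>F. (cmod (op y n))\<^sup>2) \<le> (mass * ell2_norm y)\<^sup>2" if F: "finite F" for F
  proof -
    \<comment> \<open>Only finitely many rows are summed, so the interchange is additivity of
      convergent sums; column sums then obey the same bound \<open>mass\<close> as row sums.\<close>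
    have swap: "((\<lambda>k. (\<Sum>n\<in>F. g (n - k)) * (cmod (y k))\<^sup>2) has_sum
        (\<Sum>n\<in>F. \<Sum>\<^sub>\<infinity>k. g (n - k) * (cmod (y k))\<^sup>2)) UNIV"
      using F
    proof (induction F)
      case (insert n F)
      have "((\<lambda>k. g (n - k) * (cmod (y k))\<^sup>2) has_sum (\<Sum>\<^sub>\<infinity>k. g (n - k) * (cmod (y k))\<^sup>2)) UNIV"
        using op_pointwise(1)[OF y] by simp
      from has_sum_add[OF this insert.IH] show ?case using insert.hyps by (simp add: algebra_simps)
    qed simp
    have "(\<Sum>n\<in>F. (cmod (op y n))\<^sup>2) \<le> (\<Sum>n\<in>F. mass * (\<Sum>\<^sub>\<infinity>k. g (n - k) * (cmod (y k))\<^sup>2))"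
      by (intro sum_mono op_pointwise y)
    also have "\<dots> = mass * (\<Sum>\<^sub>\<infinity>k. (\<Sum>n\<in>F. g (n - k)) * (cmod (y k))\<^sup>2)"
      unfolding infsumI[OF swap] sum_distrib_left ..
    also have "\<dots> \<le> mass * (\<Sum>\<^sub>\<infinity>k. mass * (cmod (y k))\<^sup>2)"
    proof (intro mult_left_mono infsum_mono)
      show "(\<lambda>k. (\<Sum>n\<in>F. g (n - k)) * (cmod (y k))\<^sup>2) summable_on UNIV"
        using swap by (auto simp: summable_on_def)
    qed (use mass_pos finite_column[OF F] sy in \<open>auto intro!: mult_right_mono summable_on_cmult_right\<close>)
    also have "\<dots> = (mass * ell2_norm y)\<^sup>2"
      by (simp add: infsum_cmult_right' power_mult_distrib ell2_norm_sq power2_eq_square[of mass])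
    finally show ?thesis .
  qed
  from ell2I[OF this] show "op y \<in> ell2" "ell2_norm (op y) \<le> mass * ell2_norm y"
    using mass_pos by auto
qed

lemma bounded_operator_op: "bounded_operator_ell2 op"
  unfolding bounded_operator_ell2_def
proof (intro conjI ballI allI)
  fix x y :: "int \<Rightarrow> complex" assume x: "x \<in> ell2" and y: "y \<in> ell2"
  show "op (\<lambda>n. x n + y n) = (\<lambda>n. op x n + op y n)"
  proof
    fix n
    show "op (\<lambda>n. x n + y n) n = op x n + op y n"
      unfolding op_def distrib_left
      by (rule infsum_add) (rule summable_bounded, rule ell2_coordinate_le, fact)+
  qed
next
  fix c x
  show "op (\<lambda>n. c * x n) = (\<lambda>n. c * op x n)"
    unfolding op_def by (simp add: mult.left_commute infsum_cmult_right')
qed (use op_ell2 in auto)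

end

section \<open>Bloch solutions\<close>

lemma periodic_shift:
  assumes "periodic p c"
  shows "c (q * int p + j) = c j"
proof (induction q rule: int_induct[where k=0])
  case (step1 q)
  then show ?case using assms[unfolded periodic_def, rule_format, of "q * int p + j"]
    by (simp add: algebra_simps)
next
  case (step2 q)
  then show ?case using assms[unfolded periodic_def, rule_format, of "(q - 1) * int p + j"]
    by (simp add: algebra_simps)
qed simp

lemma periodic_mod:
  assumes "periodic p c"
  shows "c j = c (j mod int p)"
  using periodic_shift[OF assms, of "j div int p" "j mod int p"] by (simp add: mult.commute)

lemma periodic_bounded:
  assumes "periodic p c" "0 < p"
  obtains B where "0 \<le> B" "\<And>j. \<bar>c j\<bar> \<le> B"
proof (rule that)
  let ?B = "Max ((\<lambda>j. \<bar>c j\<bar>) ` {0..<int p})"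
  show B: "\<bar>c j\<bar> \<le> ?B" for j
    unfolding periodic_mod[OF assms(1), of j] by (rule Max_ge) (use assms(2) in auto)
  show "0 \<le> ?B" using B[of 0] by linarith
qed

locale periodic_jacobi =
  fixes a b :: "int \<Rightarrow> real" and p :: nat
  assumes p_pos: "0 < p"
    and a_pos: "\<And>j. a j > 0"
    and a_per: "periodic p a"
    and b_per: "periodic p b"
begin

lemma rec: "periodic_rec (\<lambda>k. a (n + int k)) (\<lambda>k. b (n + int k)) p"
proof
  show "a (n + int (k + p)) = a (n + int k)" "b (n + int (k + p)) = b (n + int k)" for k
    using a_per b_per unfolding periodic_def by (metis add.assoc of_nat_add)+
qed (use p_pos a_pos in auto)

definition Delta :: "'a::real_normed_field poly" where
  "Delta = periodic_rec.disc (\<lambda>k. a (int k)) (\<lambda>k. b (int k)) p"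

lemma disc_eq_Delta: "periodic_rec.disc (\<lambda>k. a (n + int k)) (\<lambda>k. b (n + int k)) p = (Delta :: 'a::real_normed_field poly)"
proof -
  have step: "periodic_rec.disc (\<lambda>k. a (n + 1 + int k)) (\<lambda>k. b (n + 1 + int k)) p =
      (periodic_rec.disc (\<lambda>k. a (n + int k)) (\<lambda>k. b (n + int k)) p :: 'a poly)" for n
    using periodic_rec.disc_shift[OF rec[of n], where 'a='a] by (simp add: add.assoc)
  show ?thesis
  proof (induction n rule: int_induct[where k=0])
    case (step2 n)
    then show ?case using step[of "n - 1"] by simp
  qed (simp_all add: Delta_def step)
qed

interpretation R: periodic_rec "\<lambda>k. a (int k)" "\<lambda>k. b (int k)" p
  using rec[of 0] by simp

lemma Delta_of_real: "poly (Delta :: 'a::real_normed_field poly) (of_real x) = of_real (poly Delta x)"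
  unfolding Delta_def by (rule R.disc_of_real)

lemma oscillates_Delta: "\<exists>l u. oscillates p Delta l u"
  unfolding Delta_def by (rule R.disc_oscillates)

text \<open>An eigenvector of the monodromy matrix is solved forward over one period and continued
  to all periods by powers of m; m is nonzero as the product of the two multipliers is 1, so
  negative powers are available.\<close>

lemma bloch_solution:
  fixes z m :: complex
  assumes m: "m\<^sup>2 - poly Delta z * m + 1 = 0"
  obtains \<psi> where "jacobi a b \<psi> = (\<lambda>n. z * \<psi> n)"
    and "\<And>n. \<psi> (n + int p) = m * \<psi> n"
    and "\<psi> 0 \<noteq> 0 \<or> \<psi> 1 \<noteq> 0"
    and "poly (sol (\<lambda>k. a (int k)) (\<lambda>k. b (int k)) (\<psi> 0) (\<psi> 1) p) z = m * \<psi> 0"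
    and "poly (sol (\<lambda>k. a (int k)) (\<lambda>k. b (int k)) (\<psi> 0) (\<psi> 1) (Suc p)) z = m * \<psi> 1"
proof -
  have m0: "m \<noteq> 0" using m by auto
  obtain s t where st: "s \<noteq> 0 \<or> t \<noteq> 0"
    and y_p: "poly (sol (\<lambda>k. a (int k)) (\<lambda>k. b (int k)) s t p) z = m * s"
    and y_Sp: "poly (sol (\<lambda>k. a (int k)) (\<lambda>k. b (int k)) s t (Suc p)) z = m * t"
    using R.monodromy_eigenvector_exists[OF m[unfolded Delta_def]] by blast
  define y where "y k = poly (sol (\<lambda>k. a (int k)) (\<lambda>k. b (int k)) s t k) z" for k
  define \<psi> where "\<psi> n = m powi (n div int p) * y (nat (n mod int p))" for n
  have y0: "y 0 = s" "y 1 = t" "y (Suc 0) = t" by (simp_all add: y_def)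
  have yp: "y p = m * s" "y (Suc p) = m * t" using y_p y_Sp by (simp_all add: y_def)
  have base: "\<psi> (q * int p + int k) = m powi q * y k" if "k < p" for q k
    using that p_pos by (simp add: \<psi>_def)
  \<comment> \<open>The formula is needed up to \<open>Suc p\<close> because the equation at the
    last site of a block involves the first site of the next. For \<open>p = 1\<close> the site
    \<open>Suc p\<close> is already two periods on, hence the separate case.\<close>
  have ext: "\<psi> (q * int p + int k) = m powi q * y k" if k: "k \<le> Suc p" for q k
  proof -
    have powS: "m powi (q + 1) = m * m powi q" "m powi (1 + q) = m * m powi q" for q
      using m0 by (simp_all add: power_int_add)
    have at_p: "\<psi> (q * int p + int p) = m powi q * y p" for q
      using base[of 0 "q + 1"] p_pos by (simp add: powS y0 yp algebra_simps)
    consider "k < p" | "k = p" | "k = Suc p" using k by linarith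
    then show ?thesis
    proof cases
      case 3
      show ?thesis
      proof (cases "p = 1")
        case True
        then have "y p = t" using y0 by simp
        then have "m * s = t" using yp by simp
        moreover have "\<psi> (q * int p + int k) = m powi (q + 1) * y p"
          using at_p[of "q + 1"] 3 True by (simp add: algebra_simps)
        ultimately show ?thesis using 3 by (simp add: powS yp)
      next
        case False
        then show ?thesis
          using base[of 1 "q + 1"] 3 p_pos by (simp add: powS y0 yp algebra_simps)
      qed
    qed (use base at_p in auto)
  qed
  have rec_y: "of_real (a (int (Suc k))) * y (Suc (Suc k)) =
      (z - of_real (b (int (Suc k)))) * y (Suc k) - of_real (a (int k)) * y k" for k
    using R.jacobi_rec_sol'[of z s t] unfolding jacobi_rec_def y_def by blast
  show thesis
  proof (rule that)
    show "jacobi a b \<psi> = (\<lambda>n. z * \<psi> n)"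
    proof
      fix n
      define q where "q = (n - 1) div int p"
      define k where "k = nat ((n - 1) mod int p)"
      have k: "k < p" using p_pos by (simp add: k_def nat_less_iff)
      have "n - 1 = q * int p + int k" using p_pos by (simp add: q_def k_def)
      then have n: "n - 1 = q * int p + int k" "n = q * int p + int (Suc k)" "n + 1 = q * int p + int (Suc (Suc k))"
        by simp_all
      have e: "k \<le> Suc p" "Suc k \<le> Suc p" "Suc (Suc k) \<le> Suc p" using k by auto
      have \<psi>n: "\<psi> (n - 1) = m powi q * y k" "\<psi> n = m powi q * y (Suc k)" "\<psi> (n + 1) = m powi q * y (Suc (Suc k))"
        using ext[OF e(1), of q, folded n(1)] ext[OF e(2), of q, folded n(2)] ext[OF e(3), of q, folded n(3)]
        by auto
      have c: "a (n - 1) = a (int k)" "a n = a (int (Suc k))" "b n = b (int (Suc k))"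
        using periodic_shift[OF a_per, of q "int k", folded n(1)] periodic_shift[OF a_per, of q "int (Suc k)", folded n(2)]
          periodic_shift[OF b_per, of q "int (Suc k)", folded n(2)] by auto
      have "jacobi a b \<psi> n = m powi q * (of_real (a (int k)) * y k + of_real (b (int (Suc k))) * y (Suc k)
          + of_real (a (int (Suc k))) * y (Suc (Suc k)))"
        unfolding jacobi_def \<psi>n c by (simp add: algebra_simps)
      also have "\<dots> = z * \<psi> n" unfolding rec_y \<psi>n by (simp add: algebra_simps)
      finally show "jacobi a b \<psi> n = z * \<psi> n" .
    qed
    show "\<psi> (n + int p) = m * \<psi> n" for n
      using p_pos m0 by (simp add: \<psi>_def power_int_add)
    have \<psi>0: "\<psi> 0 = s" "\<psi> 1 = t"
      using ext[of 0 0] ext[of 1 0] y0 p_pos by simp_all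
    show "\<psi> 0 \<noteq> 0 \<or> \<psi> 1 \<noteq> 0" using st \<psi>0 by simp
    show "poly (sol (\<lambda>k. a (int k)) (\<lambda>k. b (int k)) (\<psi> 0) (\<psi> 1) p) z = m * \<psi> 0"
      "poly (sol (\<lambda>k. a (int k)) (\<lambda>k. b (int k)) (\<psi> 0) (\<psi> 1) (Suc p)) z = m * \<psi> 1"
      unfolding \<psi>0 by (rule y_p, rule y_Sp)
  qed
qed

lemma bloch_independent:
  fixes z :: complex
  assumes v: "s \<noteq> 0 \<or> t \<noteq> 0"
    "poly (sol (\<lambda>k. a (int k)) (\<lambda>k. b (int k)) s t p) z = m * s"
    "poly (sol (\<lambda>k. a (int k)) (\<lambda>k. b (int k)) s t (Suc p)) z = m * t"
    and w: "s' \<noteq> 0 \<or> t' \<noteq> 0"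
    "poly (sol (\<lambda>k. a (int k)) (\<lambda>k. b (int k)) s' t' p) z = m' * s'"
    "poly (sol (\<lambda>k. a (int k)) (\<lambda>k. b (int k)) s' t' (Suc p)) z = m' * t'"
    and ne: "m \<noteq> m'"
  shows "s' * t - t' * s \<noteq> 0"
proof
  assume dep: "s' * t - t' * s = 0"
  have "\<exists>c. s' = c * s \<and> t' = c * t"
  proof (cases "s = 0")
    case True
    then show ?thesis using v(1) dep by (intro exI[of _ "t' / t"]) auto
  next
    case False
    then show ?thesis using dep by (intro exI[of _ "s' / s"]) (auto simp: field_simps)
  qed
  then obtain c where c: "s' = c * s" "t' = c * t" by blast
  have "poly (sol (\<lambda>k. a (int k)) (\<lambda>k. b (int k)) s' t' k) z =
      c * poly (sol (\<lambda>k. a (int k)) (\<lambda>k. b (int k)) s t k) z" for k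
    using R.poly_sol_linear[of s t k z] R.poly_sol_linear[of s' t' k z] by (simp add: c algebra_simps)
  then have "m * s' = m' * s'" "m * t' = m' * t'"
    using v(2,3) w(2,3) by (simp_all add: c)
  then show False using ne w(1) by auto
qed

text \<open>Dividing the modulus by \<open>r powi n\<close> leaves a periodic, hence bounded,
  sequence.\<close>

lemma floquet_exponential_bound:
  assumes q: "\<And>n. \<psi> (n + int p) = m * \<psi> n" and r: "0 < r" "r ^ p = cmod m"
  obtains B where "0 \<le> B" "\<And>n. cmod (\<psi> n) \<le> B * r powi n"
proof -
  define c where "c n = cmod (\<psi> n) / r powi n" for n
  have "periodic p c"
    unfolding periodic_def c_def
    using r by (auto simp: q norm_mult power_int_add divide_simps)
  then obtain B where B: "0 \<le> B" "\<And>n. \<bar>c n\<bar> \<le> B" using periodic_bounded[OF _ p_pos] by blast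
  have "cmod (\<psi> n) \<le> B * r powi n" for n
    using B(2)[of n] r by (simp add: c_def divide_simps power_int_not_zero abs_mult)
  with B(1) that show thesis by blast
qed

end

section \<open>Weyl sequences\<close>

lemma resolvent_bound:
  assumes "z \<notin> spectrum_ell2 T"
  obtains C where "0 < C"
    and "\<And>y. y \<in> ell2 \<Longrightarrow> (\<lambda>n. T y n - z * y n) \<in> ell2 \<Longrightarrow>
      ell2_norm y \<le> C * ell2_norm (\<lambda>n. T y n - z * y n)"
proof -
  obtain R where R: "bounded_operator_ell2 R" "\<And>y. y \<in> ell2 \<Longrightarrow> R (\<lambda>n. T y n - z * y n) = y"
    using assms unfolding spectrum_ell2_def by blast
  then obtain C where C: "\<And>x. x \<in> ell2 \<Longrightarrow> ell2_norm (R x) \<le> C * ell2_norm x"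
    unfolding bounded_operator_ell2_def by blast
  show thesis
  proof (rule that[of "\<bar>C\<bar> + 1"])
    fix y assume y: "y \<in> ell2" "(\<lambda>n. T y n - z * y n) \<in> ell2"
    have "ell2_norm y \<le> C * ell2_norm (\<lambda>n. T y n - z * y n)" using C[OF y(2)] R(2)[OF y(1)] by simp
    also have "\<dots> \<le> (\<bar>C\<bar> + 1) * ell2_norm (\<lambda>n. T y n - z * y n)" by (intro mult_right_mono) auto
    finally show "ell2_norm y \<le> (\<bar>C\<bar> + 1) * ell2_norm (\<lambda>n. T y n - z * y n)" .
  qed simp
qed

lemma jacobi_finite_support:
  assumes "finite {n. y n \<noteq> 0}"
  shows "finite {n. jacobi a b y n - z * y n \<noteq> 0}"
proof -
  let ?S = "{n. y n \<noteq> 0}"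
  have "{n. jacobi a b y n - z * y n \<noteq> 0} \<subseteq> ?S \<union> (\<lambda>n. n + 1) ` ?S \<union> (\<lambda>n. n - 1) ` ?S"
  proof
    fix n assume "n \<in> {n. jacobi a b y n - z * y n \<noteq> 0}"
    then have "y n \<noteq> 0 \<or> y (n - 1) \<noteq> 0 \<or> y (n + 1) \<noteq> 0" by (auto simp: jacobi_def)
    then show "n \<in> ?S \<union> (\<lambda>n. n + 1) ` ?S \<union> (\<lambda>n. n - 1) ` ?S"
      by (auto simp: image_iff intro: exI[of _ "n - 1"] exI[of _ "n + 1"])
  qed
  then show ?thesis by (rule finite_subset) (use assms in auto)
qed

lemma finite_support_ell2: "finite {n. y n \<noteq> 0} \<Longrightarrow> y \<in> ell2"
  by (rule ell2_finite_support(1)) auto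

context periodic_jacobi
begin

text \<open>Cutting off \<open>\<psi>\<close> after N periods leaves a residual at the sites -1, 0,
  M - 1, M only, bounded independently of N, while the squared norm grows at least linearly in N.
  Periodicity is asked of the modulus alone, which admits plane waves of any phase.\<close>

lemma weyl_sequence:
  fixes z :: complex
  assumes sol: "jacobi a b \<psi> = (\<lambda>n. z * \<psi> n)"
    and per: "\<And>n. cmod (\<psi> (n + int p)) = cmod (\<psi> n)"
    and nz: "\<psi> 0 \<noteq> 0 \<or> \<psi> 1 \<noteq> 0" and \<epsilon>: "0 < \<epsilon>"
  obtains y where "finite {n. y n \<noteq> 0}" "0 < ell2_norm y"
    "ell2_norm (\<lambda>n. jacobi a b y n - z * y n) \<le> \<epsilon> * ell2_norm y"
proof -
  define c where "c n = cmod (\<psi> n)" for n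
  have cper: "periodic p c" unfolding periodic_def c_def using per by simp
  obtain B where B: "0 \<le> B" "\<And>n. cmod (\<psi> n) \<le> B"
    using periodic_bounded[OF cper p_pos] unfolding c_def by auto
  obtain K where K: "0 \<le> K" "\<And>n. \<bar>a n\<bar> \<le> K"
    using periodic_bounded[OF a_per p_pos] by blast
  obtain j where "\<psi> j \<noteq> 0" using nz by blast
  define n0 where "n0 = j mod int p"
  define \<delta> where "\<delta> = c n0"
  have n0: "0 \<le> n0" "n0 < int p" using p_pos by (simp_all add: n0_def)
  have "0 < c j" using \<open>\<psi> j \<noteq> 0\<close> by (simp add: c_def)
  then have \<delta>: "0 < \<delta>" unfolding \<delta>_def n0_def periodic_mod[OF cper, of j, symmetric] .
  \<comment> \<open>Four boundary sites, each with residual at most 2 K B, give 16 (K B)^2 in total;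
    each of the N periods contributes at least \<open>\<delta>\<^sup>2\<close> to the squared norm
    of the truncation.\<close>
  obtain N0 :: nat where N0: "16 * (K * B)\<^sup>2 / (\<epsilon>\<^sup>2 * \<delta>\<^sup>2) < real N0" using reals_Archimedean2 by blast
  define N where "N = Suc N0"
  define M where "M = int N * int p"
  define y where "y n = (if 0 \<le> n \<and> n < M then \<psi> n else 0)" for n
  define r where "r n = jacobi a b y n - z * y n" for n
  have M: "0 < M" using p_pos by (simp add: M_def N_def)
  have y_supp: "y n = 0" if "n \<notin> {0..<M}" for n using that by (auto simp: y_def)
  have fin: "finite {n. y n \<noteq> 0}" by (rule finite_subset[of _ "{0..<M}"]) (use y_supp in blast, simp)
  have diff: "cmod (y n - \<psi> n) \<le> B" "cmod (y n) \<le> B" for n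
    using B by (auto simp: y_def)
  have r_in: "r n = of_real (a (n - 1)) * (y (n - 1) - \<psi> (n - 1)) + of_real (a n) * (y (n + 1) - \<psi> (n + 1))"
    if "0 \<le> n" "n < M" for n
    using that fun_cong[OF sol, of n] by (simp add: r_def jacobi_def y_def[of n] algebra_simps)
  have r_out: "r n = of_real (a (n - 1)) * y (n - 1) + of_real (a n) * y (n + 1)"
    if "\<not> (0 \<le> n \<and> n < M)" for n
  proof -
    have "y n = 0" using that by (auto simp: y_def)
    then show ?thesis by (simp add: r_def jacobi_def)
  qed
  have two: "cmod (of_real (a (n - 1)) * u + of_real (a n) * v) \<le> 2 * (K * B)"
    if "cmod u \<le> B" "cmod v \<le> B" for n u v
  proof -
    have "cmod (of_real (a (n - 1)) * u) \<le> K * B" "cmod (of_real (a n) * v) \<le> K * B"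
      unfolding norm_mult norm_of_real using K B that by (intro mult_mono; simp)+
    then show ?thesis using norm_triangle_ineq[of "of_real (a (n - 1)) * u" "of_real (a n) * v"] by linarith
  qed
  have r_le: "cmod (r n) \<le> 2 * (K * B)" for n
    by (cases "0 \<le> n \<and> n < M") (simp_all add: r_in r_out two diff)
  let ?E = "{- 1, 0, M - 1, M}"
  have r_supp: "r n = 0" if "n \<notin> ?E" for n
    by (cases "0 \<le> n \<and> n < M") (use that in \<open>simp_all add: r_in r_out, auto simp: y_def\<close>)
  have "(ell2_norm r)\<^sup>2 = (\<Sum>n\<in>?E. (cmod (r n))\<^sup>2)"
    by (rule ell2_finite_support(2)[OF _ r_supp]) simp_all
  also have "\<dots> \<le> of_nat (card ?E) * (2 * (K * B))\<^sup>2"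
    by (rule sum_bounded_above) (intro power_mono r_le norm_ge_zero)
  also have "\<dots> \<le> 4 * (2 * (K * B))\<^sup>2"
  proof (intro mult_right_mono)
    have "card ?E \<le> 4" by (simp add: card_insert_if)
    then show "real (card ?E) \<le> 4" by simp
  qed simp
  also have "\<dots> = 16 * (K * B)\<^sup>2" by (simp add: power_mult_distrib)
  also have "\<dots> \<le> \<epsilon>\<^sup>2 * (real N * \<delta>\<^sup>2)"
  proof -
    have "16 * (K * B)\<^sup>2 < real N0 * (\<epsilon>\<^sup>2 * \<delta>\<^sup>2)" using N0 \<epsilon> \<delta> by (simp add: divide_less_eq)
    also have "\<dots> \<le> real N * (\<epsilon>\<^sup>2 * \<delta>\<^sup>2)" by (intro mult_right_mono) (simp_all add: N_def)
    finally show ?thesis by (simp add: mult_ac)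
  qed
  also have "\<dots> \<le> \<epsilon>\<^sup>2 * (ell2_norm y)\<^sup>2"
  proof (intro mult_left_mono)
    define f where "f i = int i * int p + n0" for i :: nat
    have inj: "inj_on f {..<N}" using p_pos by (auto simp: inj_on_def f_def)
    have sub: "f ` {..<N} \<subseteq> {0..<M}"
    proof
      fix x assume "x \<in> f ` {..<N}"
      then obtain i where i: "i < N" "x = f i" by auto
      have "(int i + 1) * int p \<le> int N * int p" using i by (intro mult_right_mono) auto
      then show "x \<in> {0..<M}" using n0 i by (simp add: f_def M_def algebra_simps)
    qed
    have "cmod (y (f i)) = \<delta>" if "i < N" for i
    proof -
      have "f i \<in> {0..<M}" using sub that by auto
      then have "cmod (y (f i)) = c (f i)" by (simp add: y_def c_def)
      also have "\<dots> = \<delta>" unfolding f_def \<delta>_def by (rule periodic_shift[OF cper])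
      finally show ?thesis .
    qed
    then have "real N * \<delta>\<^sup>2 = (\<Sum>i<N. (cmod (y (f i)))\<^sup>2)" by simp
    also have "\<dots> = (\<Sum>n\<in>f ` {..<N}. (cmod (y n))\<^sup>2)" by (simp add: sum.reindex[OF inj])
    also have "\<dots> \<le> (ell2_norm y)\<^sup>2" by (rule ell2_finite_sum_le[OF finite_support_ell2[OF fin]]) simp
    finally show "real N * \<delta>\<^sup>2 \<le> (ell2_norm y)\<^sup>2" .
  qed simp
  finally have "ell2_norm r \<le> \<epsilon> * ell2_norm y"
    using \<epsilon> by (intro power2_le_imp_le[of "ell2_norm r"]) (simp_all add: power_mult_distrib)
  moreover have "0 < ell2_norm y"
  proof -
    have "int p \<le> M" unfolding M_def using mult_right_mono[of 1 "int N" "int p"] by (simp add: N_def)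
    then have "y n0 = \<psi> n0" using n0 by (simp add: y_def)
    moreover have "\<psi> n0 \<noteq> 0" using \<delta> by (auto simp: \<delta>_def c_def)
    ultimately have "y n0 \<noteq> 0" by simp
    then have "0 < cmod (y n0)" by simp
    also have "\<dots> \<le> ell2_norm y" by (rule ell2_coordinate_le[OF finite_support_ell2[OF fin]])
    finally show ?thesis .
  qed
  ultimately show thesis using that[OF fin] unfolding r_def[abs_def] by blast
qed

lemma unimodular_multiplier_in_spectrum:
  assumes m: "m\<^sup>2 - poly Delta z * m + 1 = 0" and "cmod m = 1"
  shows "z \<in> spectrum_ell2 (jacobi a b)"
proof (rule ccontr)
  assume "z \<notin> spectrum_ell2 (jacobi a b)"
  then obtain C where C: "0 < C" "\<And>y. y \<in> ell2 \<Longrightarrow> (\<lambda>n. jacobi a b y n - z * y n) \<in> ell2 \<Longrightarrow>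
      ell2_norm y \<le> C * ell2_norm (\<lambda>n. jacobi a b y n - z * y n)"
    using resolvent_bound by blast
  obtain \<psi> where \<psi>: "jacobi a b \<psi> = (\<lambda>n. z * \<psi> n)" "\<And>n. \<psi> (n + int p) = m * \<psi> n" "\<psi> 0 \<noteq> 0 \<or> \<psi> 1 \<noteq> 0"
    using bloch_solution[OF m] by blast
  have "cmod (\<psi> (n + int p)) = cmod (\<psi> n)" for n using \<psi>(2) assms(2) by (simp add: norm_mult)
  then obtain y where y: "finite {n. y n \<noteq> 0}" "0 < ell2_norm y"
      "ell2_norm (\<lambda>n. jacobi a b y n - z * y n) \<le> (1 / (2 * C)) * ell2_norm y"
    using weyl_sequence[OF \<psi>(1) _ \<psi>(3), of "1 / (2 * C)"] C(1) by auto
  have "ell2_norm y \<le> C * ell2_norm (\<lambda>n. jacobi a b y n - z * y n)"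
    by (intro C finite_support_ell2 jacobi_finite_support y)
  also have "\<dots> \<le> C * ((1 / (2 * C)) * ell2_norm y)" using y(3) C(1) by (intro mult_left_mono) auto
  also have "\<dots> = ell2_norm y / 2" using C(1) by simp
  finally show False using y(2) by simp
qed

end

section \<open>Resolvent and spectrum\<close>

lemma has_sum_diff:
  fixes f g :: "'b \<Rightarrow> 'a::topological_ab_group_add"
  assumes "(f has_sum x) A" "(g has_sum y) A"
  shows "((\<lambda>i. f i - g i) has_sum (x - y)) A"
  using has_sum_add[OF assms(1), of "\<lambda>i. - g i" "- y"] assms(2) by (simp add: has_sum_uminus)

lemma has_sum_int_shift:
  fixes f :: "int \<Rightarrow> 'a::{comm_monoid_add,topological_space}"
  assumes "(f has_sum v) UNIV"
  shows "((\<lambda>n. f (n + k)) has_sum v) UNIV" and "((\<lambda>n. f (n - k)) has_sum v) UNIV"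
proof -
  have "bij_betw (\<lambda>n. n + k) UNIV UNIV" "bij_betw (\<lambda>n. n - k) UNIV UNIV"
    by (rule bij_betwI[where g="\<lambda>n. n - k"], auto, rule bij_betwI[where g="\<lambda>n. n + k"], auto)
  then show "((\<lambda>n. f (n + k)) has_sum v) UNIV" "((\<lambda>n. f (n - k)) has_sum v) UNIV"
    using assms has_sum_reindex_bij_betw[of _ UNIV UNIV f v] by blast+
qed

context periodic_jacobi
begin

lemma wronskian_const:
  assumes \<phi>: "jacobi a b \<phi> = (\<lambda>n. z * \<phi> n)" and \<psi>: "jacobi a b \<psi> = (\<lambda>n. z * \<psi> n)"
  shows "of_real (a n) * (\<phi> n * \<psi> (n + 1) - \<phi> (n + 1) * \<psi> n) = of_real (a 0) * (\<phi> 0 * \<psi> 1 - \<phi> 1 * \<psi> 0)"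
proof -
  define w where "w n = of_real (a n) * (\<phi> n * \<psi> (n + 1) - \<phi> (n + 1) * \<psi> n)" for n
  have "w n = w (n - 1)" for n
  proof -
    have s: "of_real (a n) * f (n + 1) = (z - of_real (b n)) * f n - of_real (a (n - 1)) * f (n - 1)"
      if "jacobi a b f = (\<lambda>n. z * f n)" for f
      using fun_cong[OF that, of n] by (simp add: jacobi_def algebra_simps)
    have "w n = \<phi> n * (of_real (a n) * \<psi> (n + 1)) - (of_real (a n) * \<phi> (n + 1)) * \<psi> n"
      by (simp add: w_def algebra_simps)
    also have "\<dots> = w (n - 1)" unfolding s[OF \<phi>] s[OF \<psi>] by (simp add: w_def algebra_simps)
    finally show ?thesis .
  qed
  note step = this
  have "w n = w 0"
  proof (induction n rule: int_induct[where k=0])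
    case (step1 i)
    then show ?case using step[of "i + 1"] by simp
  next
    case (step2 i)
    then show ?case using step[of i] by simp
  qed simp
  then show ?thesis by (simp add: w_def)
qed

text \<open>Away from the diagonal the kernel is a multiple of one of the two solutions. On the
  diagonal, the mismatch between \<open>\<phi> (n + 1) * \<psi> n\<close> and
  \<open>\<phi> n * \<psi> (n + 1)\<close> is exactly the Wronskian, which w normalises to
  1.\<close>

lemma green_kernel:
  assumes \<phi>: "jacobi a b \<phi> = (\<lambda>n. z * \<phi> n)" and \<psi>: "jacobi a b \<psi> = (\<lambda>n. z * \<psi> n)"
    and w: "w = of_real (a 0) * (\<phi> 0 * \<psi> 1 - \<phi> 1 * \<psi> 0)" "w \<noteq> 0"
  defines "G \<equiv> \<lambda>n k. \<phi> (min n k) * \<psi> (max n k) / w"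
  shows "of_real (a (n - 1)) * G (n - 1) k + of_real (b n) * G n k + of_real (a n) * G (n + 1) k - z * G n k
    = (if n = k then 1 else 0)"
proof -
  have s\<phi>: "of_real (a (n - 1)) * \<phi> (n - 1) + of_real (b n) * \<phi> n + of_real (a n) * \<phi> (n + 1) = z * \<phi> n"
    using fun_cong[OF \<phi>, of n] by (simp add: jacobi_def)
  have s\<psi>: "of_real (a (n - 1)) * \<psi> (n - 1) + of_real (b n) * \<psi> n + of_real (a n) * \<psi> (n + 1) = z * \<psi> n"
    using fun_cong[OF \<psi>, of n] by (simp add: jacobi_def)
  have wn: "of_real (a n) * (\<phi> n * \<psi> (n + 1) - \<phi> (n + 1) * \<psi> n) = w"
    unfolding w(1) by (rule wronskian_const[OF \<phi> \<psi>])
  consider "n < k" | "n = k" | "k < n" by linarith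
  then show ?thesis
  proof cases
    case 1
    then have "min (n - 1) k = n - 1" "max (n - 1) k = k" "min n k = n" "max n k = k"
      "min (n + 1) k = n + 1" "max (n + 1) k = k" by auto
    then have "of_real (a (n - 1)) * G (n - 1) k + of_real (b n) * G n k + of_real (a n) * G (n + 1) k - z * G n k
      = (of_real (a (n - 1)) * \<phi> (n - 1) + of_real (b n) * \<phi> n + of_real (a n) * \<phi> (n + 1) - z * \<phi> n) * \<psi> k / w"
      unfolding G_def by (simp add: add_divide_distrib diff_divide_distrib algebra_simps)
    then show ?thesis using 1 s\<phi> by simp
  next
    case 3
    then have "max (n - 1) k = n - 1" "min (n - 1) k = k" "max n k = n" "min n k = k"
      "max (n + 1) k = n + 1" "min (n + 1) k = k" by auto
    then have "of_real (a (n - 1)) * G (n - 1) k + of_real (b n) * G n k + of_real (a n) * G (n + 1) k - z * G n k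
      = (of_real (a (n - 1)) * \<psi> (n - 1) + of_real (b n) * \<psi> n + of_real (a n) * \<psi> (n + 1) - z * \<psi> n) * \<phi> k / w"
      unfolding G_def by (simp add: add_divide_distrib diff_divide_distrib algebra_simps)
    then show ?thesis using 3 s\<psi> by simp
  next
    case 2
    then have "min (n - 1) k = n - 1" "max (n - 1) k = n" "min n k = n" "max n k = n"
      "min (n + 1) k = n" "max (n + 1) k = n + 1" by auto
    then have "of_real (a (n - 1)) * G (n - 1) k + of_real (b n) * G n k + of_real (a n) * G (n + 1) k - z * G n k
      = ((of_real (a (n - 1)) * \<phi> (n - 1) + of_real (b n) * \<phi> n + of_real (a n) * \<phi> (n + 1) - z * \<phi> n) * \<psi> n
          + of_real (a n) * (\<phi> n * \<psi> (n + 1) - \<phi> (n + 1) * \<psi> n)) / w"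
      unfolding G_def by (simp add: add_divide_distrib diff_divide_distrib algebra_simps)
    then show ?thesis using 2 s\<phi> wn w(2) by simp
  qed
qed

text \<open>The Bloch solution for m decays to the right and the one for 1 / m to the left. Their
  Green kernel decays exponentially in \<open>|n - k|\<close> and is a bounded two-sided
  inverse.\<close>

lemma hyperbolic_multiplier_resolvent:
  assumes m: "m\<^sup>2 - poly Delta z * m + 1 = 0" and m1: "cmod m < 1"
  shows "z \<notin> spectrum_ell2 (jacobi a b)"
proof -
  have m0: "m \<noteq> 0" using m by auto
  have m': "(inverse m)\<^sup>2 - poly Delta z * inverse m + 1 = 0"
  proof -
    have "(inverse m)\<^sup>2 - poly Delta z * inverse m + 1 = (m\<^sup>2 - poly Delta z * m + 1) / m\<^sup>2"
      using m0 by (simp add: field_simps power2_eq_square)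
    then show ?thesis using m by simp
  qed
  obtain \<psi> where \<psi>: "jacobi a b \<psi> = (\<lambda>n. z * \<psi> n)" "\<And>n. \<psi> (n + int p) = m * \<psi> n" "\<psi> 0 \<noteq> 0 \<or> \<psi> 1 \<noteq> 0"
    "poly (sol (\<lambda>k. a (int k)) (\<lambda>k. b (int k)) (\<psi> 0) (\<psi> 1) p) z = m * \<psi> 0"
    "poly (sol (\<lambda>k. a (int k)) (\<lambda>k. b (int k)) (\<psi> 0) (\<psi> 1) (Suc p)) z = m * \<psi> 1"
    by (rule bloch_solution[OF m]) (rule that)
  obtain \<phi> where \<phi>: "jacobi a b \<phi> = (\<lambda>n. z * \<phi> n)" "\<And>n. \<phi> (n + int p) = inverse m * \<phi> n" "\<phi> 0 \<noteq> 0 \<or> \<phi> 1 \<noteq> 0"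
    "poly (sol (\<lambda>k. a (int k)) (\<lambda>k. b (int k)) (\<phi> 0) (\<phi> 1) p) z = inverse m * \<phi> 0"
    "poly (sol (\<lambda>k. a (int k)) (\<lambda>k. b (int k)) (\<phi> 0) (\<phi> 1) (Suc p)) z = inverse m * \<phi> 1"
    by (rule bloch_solution[OF m']) (rule that)
  have "m \<noteq> inverse m"
  proof
    assume "m = inverse m"
    then have "m * m = 1" using m0 by (metis right_inverse)
    then have "cmod m * cmod m = 1" by (metis norm_mult norm_one)
    then show False using m1 mult_strict_mono[of "cmod m" 1 "cmod m" 1] by simp
  qed
  then have indep: "\<phi> 0 * \<psi> 1 - \<phi> 1 * \<psi> 0 \<noteq> 0"
    by (rule bloch_independent[OF \<psi>(3-5) \<phi>(3-5)])
  define w where "w = of_real (a 0) * (\<phi> 0 * \<psi> 1 - \<phi> 1 * \<psi> 0)"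
  have w0: "w \<noteq> 0" using indep a_pos[of 0] by (simp add: w_def)
  define r where "r = root p (cmod m)"
  have r: "0 < r" "r < 1" "r ^ p = cmod m"
    using p_pos m0 m1 by (simp_all add: r_def)
  obtain B where B: "0 \<le> B" "\<And>n. cmod (\<psi> n) \<le> B * r powi n"
    using floquet_exponential_bound[of \<psi> m r, OF \<psi>(2) r(1,3)] by blast
  obtain B' where B': "0 \<le> B'" "\<And>n. cmod (\<phi> n) \<le> B' * inverse r powi n"
  proof -
    have "0 < inverse r" "inverse r ^ p = cmod (inverse m)"
      using r by (simp_all add: power_inverse norm_inverse)
    from floquet_exponential_bound[of \<phi> "inverse m" "inverse r", OF \<phi>(2) this] that show thesis by blast
  qed
  define G where "G n k = \<phi> (min n k) * \<psi> (max n k) / w" for n k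
  \<comment> \<open>The summand 1 keeps \<open>g 0\<close> positive even if one of the bounds is
    0.\<close>
  define C where "C = (B * B' + 1) / cmod w"
  define g where "g j = C * r ^ nat \<bar>j\<bar>" for j :: int
  have G_le: "cmod (G n k) \<le> g (n - k)" for n k
  proof -
    have "cmod (\<phi> (min n k)) * cmod (\<psi> (max n k)) \<le> (B' * inverse r powi (min n k)) * (B * r powi (max n k))"
      using B B' r by (intro mult_mono) auto
    also have "\<dots> = B * B' * r powi (max n k - min n k)"
      using r(1) by (simp add: power_int_diff power_int_inverse field_simps)
    also have "max n k - min n k = int (nat \<bar>n - k\<bar>)" by (auto simp: max_def min_def)
    also have "B * B' * r powi int (nat \<bar>n - k\<bar>) \<le> (B * B' + 1) * r ^ nat \<bar>n - k\<bar>"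
      unfolding power_int_of_nat using r(1) by (intro mult_right_mono) auto
    finally show ?thesis
      using w0 by (simp add: G_def g_def C_def norm_mult norm_divide divide_right_mono)
  qed
  interpret convolution_bound G g
  proof
    show "g summable_on UNIV"
      unfolding g_def using r by (intro summable_on_cmult_right summable_on_int_abs_power) auto
    show "0 < g 0" using B B' w0 by (simp add: g_def C_def add_nonneg_pos)
  qed (rule G_le)
  have kernel: "of_real (a (n - 1)) * G (n - 1) k + of_real (b n) * G n k + of_real (a n) * G (n + 1) k - z * G n k
      = (if n = k then 1 else 0)" for n k
    unfolding G_def by (rule green_kernel[OF \<phi>(1) \<psi>(1) w_def w0])
  have sym: "G n k = G k n" for n k by (simp add: G_def min.commute max.commute)
  obtain K where K: "0 \<le> K" "\<And>n. \<bar>a n\<bar> \<le> K" using periodic_bounded[OF a_per p_pos] by blast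
  obtain K' where K': "0 \<le> K'" "\<And>n. \<bar>b n\<bar> \<le> K'" using periodic_bounded[OF b_per p_pos] by blast
  have deltaI: "v = y n" if "((\<lambda>k. (if n = k then 1 else 0) * y k) has_sum v) UNIV"
    for v n and y :: "int \<Rightarrow> complex"
  proof -
    have "(\<Sum>\<^sub>\<infinity>k. (if n = k then 1 else 0) * y k) = (\<Sum>\<^sub>\<infinity>k\<in>{n}. y k)"
      by (rule infsum_cong_neutral) auto
    then show ?thesis using infsumI[OF that] by simp
  qed
  have right: "(\<lambda>n. jacobi a b (op y) n - z * op y n) = y" if y: "y \<in> ell2" for y
  proof
    fix n
    have s: "(\<lambda>k. G n k * y k) summable_on UNIV" for n
      by (rule summable_bounded[OF ell2_coordinate_le[OF y]])
    have "((\<lambda>k. of_real (a (n - 1)) * (G (n - 1) k * y k) + of_real (b n) * (G n k * y k)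
        + of_real (a n) * (G (n + 1) k * y k) - z * (G n k * y k)) has_sum
      (of_real (a (n - 1)) * op y (n - 1) + of_real (b n) * op y n + of_real (a n) * op y (n + 1) - z * op y n)) UNIV"
      unfolding op_def by (intro has_sum_add has_sum_diff has_sum_cmult_right has_sum_infsum s)
    also have "(\<lambda>k. of_real (a (n - 1)) * (G (n - 1) k * y k) + of_real (b n) * (G n k * y k)
        + of_real (a n) * (G (n + 1) k * y k) - z * (G n k * y k)) = (\<lambda>k. (if n = k then 1 else 0) * y k)"
      by (rule ext, subst kernel[symmetric]) (simp only: distrib_right left_diff_distrib mult.assoc)
    finally show "jacobi a b (op y) n - z * op y n = y n"
      unfolding jacobi_def by (rule deltaI)
  qed
  \<comment> \<open>Shifting the off-diagonal sums by one site moves the Jacobi operator onto the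
    second argument of \<open>G\<close>; by the symmetry of \<open>G\<close> the kernel equation
    then applies.\<close>
  have left: "op (\<lambda>n. jacobi a b y n - z * y n) = y" if y: "y \<in> ell2" for y
  proof
    fix n
    define Y where "Y = ell2_norm y"
    have Y: "cmod (y k) \<le> Y" for k unfolding Y_def by (rule ell2_coordinate_le[OF y])
    have Y0: "0 \<le> Y" by (simp add: Y_def)
    have aY: "cmod (of_real (a i) * y k) \<le> K * Y" for i k
      unfolding norm_mult norm_of_real using K Y by (intro mult_mono) auto
    have bY: "cmod (of_real (b i) * y k) \<le> K' * Y" for i k
      unfolding norm_mult norm_of_real using K' Y by (intro mult_mono) auto
    have s1: "((\<lambda>k. G n k * (of_real (a (k - 1)) * y (k - 1))) has_sum (\<Sum>\<^sub>\<infinity>k. G n k * (of_real (a (k - 1)) * y (k - 1)))) UNIV"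
      by (intro has_sum_infsum summable_bounded[OF aY])
    have s2: "((\<lambda>k. G n k * (of_real (a k) * y (k + 1))) has_sum (\<Sum>\<^sub>\<infinity>k. G n k * (of_real (a k) * y (k + 1)))) UNIV"
      by (intro has_sum_infsum summable_bounded[OF aY])
    note s1' = has_sum_int_shift(1)[OF s1, of 1] and s2' = has_sum_int_shift(2)[OF s2, of 1]
    have s3: "((\<lambda>k. G n k * (of_real (b k) * y k)) has_sum (\<Sum>\<^sub>\<infinity>k. G n k * (of_real (b k) * y k))) UNIV"
      by (intro has_sum_infsum summable_bounded[OF bY])
    have s4: "((\<lambda>k. G n k * y k) has_sum (\<Sum>\<^sub>\<infinity>k. G n k * y k)) UNIV"
      by (intro has_sum_infsum summable_bounded[OF Y])
    let ?S = "(\<Sum>\<^sub>\<infinity>k. G n k * (of_real (a (k - 1)) * y (k - 1))) + (\<Sum>\<^sub>\<infinity>k. G n k * (of_real (b k) * y k))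
      + (\<Sum>\<^sub>\<infinity>k. G n k * (of_real (a k) * y (k + 1))) - z * (\<Sum>\<^sub>\<infinity>k. G n k * y k)"
    have "((\<lambda>k. G n (k + 1) * (of_real (a (k + 1 - 1)) * y (k + 1 - 1)) + G n k * (of_real (b k) * y k)
        + G n (k - 1) * (of_real (a (k - 1)) * y (k - 1 + 1)) - z * (G n k * y k)) has_sum ?S) UNIV"
      by (intro has_sum_add has_sum_diff has_sum_cmult_right s1' s2' s3 s4)
    moreover have "(\<lambda>k. G n (k + 1) * (of_real (a (k + 1 - 1)) * y (k + 1 - 1)) + G n k * (of_real (b k) * y k)
        + G n (k - 1) * (of_real (a (k - 1)) * y (k - 1 + 1)) - z * (G n k * y k)) = (\<lambda>k. (if n = k then 1 else 0) * y k)"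
    proof
      fix k
      have e: "(if n = k then 1 else 0) = of_real (a (k - 1)) * G n (k - 1) + of_real (b k) * G n k
          + of_real (a k) * G n (k + 1) - z * G n k"
        using kernel[of k n] unfolding sym[of _ n] by (simp add: eq_commute[of k n])
      show "G n (k + 1) * (of_real (a (k + 1 - 1)) * y (k + 1 - 1)) + G n k * (of_real (b k) * y k)
        + G n (k - 1) * (of_real (a (k - 1)) * y (k - 1 + 1)) - z * (G n k * y k) = (if n = k then 1 else 0) * y k"
        unfolding e by (simp add: algebra_simps)
    qed
    ultimately have "((\<lambda>k. (if n = k then 1 else 0) * y k) has_sum ?S) UNIV" by (simp only:)
    then have S: "?S = y n" by (rule deltaI)
    have "((\<lambda>k. G n k * (of_real (a (k - 1)) * y (k - 1)) + G n k * (of_real (b k) * y k)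
        + G n k * (of_real (a k) * y (k + 1)) - z * (G n k * y k)) has_sum ?S) UNIV"
      by (intro has_sum_add has_sum_diff has_sum_cmult_right s1 s2 s3 s4)
    then have "((\<lambda>k. G n k * (jacobi a b y k - z * y k)) has_sum ?S) UNIV"
      by (simp add: jacobi_def algebra_simps)
    then show "op (\<lambda>n. jacobi a b y n - z * y n) n = y n"
      unfolding op_def S by (rule infsumI)
  qed
  show ?thesis
    unfolding spectrum_ell2_def using bounded_operator_op left right by blast
qed

section \<open>Identification of the spectrum by the discriminant\<close>

lemma unimodular_multiplier:
  assumes x: "\<bar>poly Delta x\<bar> \<le> 2"
  obtains m :: complex where "m\<^sup>2 - poly Delta (of_real x) * m + 1 = 0" "cmod m = 1"
proof -
  define c where "c = poly Delta x / 2"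
  define m where "m = Complex c (sqrt (1 - c\<^sup>2))"
  have "\<bar>c\<bar> \<le> 1" using x by (simp add: c_def)
  then have c: "c\<^sup>2 \<le> 1" by (simp add: abs_square_le_1)
  then have "cmod m = 1" by (simp add: m_def cmod_def)
  moreover have "m\<^sup>2 - poly Delta (of_real x) * m + 1 = 0"
  proof -
    have "poly (Delta :: complex poly) (of_real x) = of_real (2 * c)" unfolding Delta_of_real by (simp add: c_def)
    then show ?thesis using c by (simp add: complex_eq_iff m_def power2_eq_square algebra_simps)
  qed
  ultimately show thesis by (rule that[rotated])
qed

text \<open>The two multipliers are m and 1 / m. Off the unit circle one of them has modulus below 1
  and provides a resolvent; on it, z is real and \<open>Delta\<close> equals m + 1 / m, of modulus
  at most 2.\<close>

lemma spectrum_eq: "spectrum_ell2 (jacobi a b) = of_real ` {x. \<bar>poly Delta x\<bar> \<le> 2}"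
proof (intro equalityI subsetI)
  fix z assume z: "z \<in> spectrum_ell2 (jacobi a b)"
  obtain m where m: "m\<^sup>2 - poly Delta z * m + 1 = 0"
  proof -
    let ?P = "[:1, - poly Delta z, 1:]"
    have "\<not> constant (poly ?P)" by (subst constant_degree) simp
    then obtain m where "poly ?P m = 0" using fundamental_theorem_of_algebra by blast
    then show thesis by (intro that[of m]) (simp add: algebra_simps power2_eq_square)
  qed
  have m0: "m \<noteq> 0" using m by auto
  have m': "(inverse m)\<^sup>2 - poly Delta z * inverse m + 1 = 0"
  proof -
    have "(inverse m)\<^sup>2 - poly Delta z * inverse m + 1 = (m\<^sup>2 - poly Delta z * m + 1) / m\<^sup>2"
      using m0 by (simp add: field_simps power2_eq_square)
    then show ?thesis using m by simp
  qed
  have "\<not> cmod m < 1" using hyperbolic_multiplier_resolvent[OF m] z by blast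
  moreover have "\<not> cmod (inverse m) < 1" using hyperbolic_multiplier_resolvent[OF m'] z by blast
  ultimately have m1: "cmod m = 1" using m0 by (simp add: norm_inverse not_less inverse_le_1_iff one_le_inverse_iff)
  obtain \<psi> where \<psi>: "\<psi> 0 \<noteq> 0 \<or> \<psi> (1::int) \<noteq> 0"
    "poly (sol (\<lambda>k. a (int k)) (\<lambda>k. b (int k)) (\<psi> 0) (\<psi> 1) p) z = m * \<psi> 0"
    "poly (sol (\<lambda>k. a (int k)) (\<lambda>k. b (int k)) (\<psi> 0) (\<psi> 1) (Suc p)) z = m * \<psi> 1"
    using bloch_solution[OF m] by metis
  have "z \<in> \<real>"
    using periodic_rec.quasiperiodic_imp_real[OF rec[of 0, simplified], of "\<psi> 0" "\<psi> 1" z m] \<psi> m1 by simp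
  then obtain x where x: "z = of_real x" by (auto elim: Reals_cases)
  have "poly Delta z = m + inverse m"
  proof -
    have "poly Delta z * m = (m + inverse m) * m" using m m0 by (simp add: algebra_simps power2_eq_square)
    then show ?thesis using m0 mult_right_cancel by blast
  qed
  then have "cmod (poly Delta z) \<le> 2" using norm_triangle_ineq[of m "inverse m"] m1 by (simp add: norm_inverse)
  then show "z \<in> of_real ` {x. \<bar>poly Delta x\<bar> \<le> 2}" unfolding x Delta_of_real norm_of_real by simp
next
  fix z assume "z \<in> complex_of_real ` {x. \<bar>poly Delta x\<bar> \<le> 2}"
  then obtain x where x: "z = of_real x" "\<bar>poly Delta x\<bar> \<le> 2" by auto
  then show "z \<in> spectrum_ell2 (jacobi a b)"
    using unimodular_multiplier[OF x(2)] unimodular_multiplier_in_spectrum by blast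
qed

end

section \<open>Quadratic forms on finitely supported sequences\<close>

lemma ell2_norm_triangle:
  assumes "x \<in> ell2" "y \<in> ell2"
  shows "(\<lambda>n. x n + y n) \<in> ell2" and "ell2_norm (\<lambda>n. x n + y n) \<le> ell2_norm x + ell2_norm y"
proof -
  have "(\<Sum>n\<in>F. (cmod (x n + y n))\<^sup>2) \<le> (ell2_norm x + ell2_norm y)\<^sup>2" if F: "finite F" for F
  proof -
    have le: "L2_set (\<lambda>n. cmod (v n)) F \<le> ell2_norm v" if "v \<in> ell2" for v
      unfolding L2_set_def using ell2_finite_sum_le[OF that F] by (simp add: real_le_lsqrt)
    have "L2_set (\<lambda>n. cmod (x n + y n)) F \<le> L2_set (\<lambda>n. cmod (x n) + cmod (y n)) F"
      by (intro L2_set_mono norm_triangle_ineq) auto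
    also have "\<dots> \<le> L2_set (\<lambda>n. cmod (x n)) F + L2_set (\<lambda>n. cmod (y n)) F" by (rule L2_set_triangle_ineq)
    also have "\<dots> \<le> ell2_norm x + ell2_norm y" using le assms by (intro add_mono) auto
    finally have "(L2_set (\<lambda>n. cmod (x n + y n)) F)\<^sup>2 \<le> (ell2_norm x + ell2_norm y)\<^sup>2"
      by (intro power_mono L2_set_nonneg)
    then show ?thesis by (simp add: L2_set_def sum_nonneg)
  qed
  from ell2I[OF this] show "(\<lambda>n. x n + y n) \<in> ell2" "ell2_norm (\<lambda>n. x n + y n) \<le> ell2_norm x + ell2_norm y"
    by simp_all
qed

lemma ell2_weighted_shift:
  assumes y: "y \<in> ell2" and d: "\<And>n. cmod (d n) \<le> D"
  shows "(\<lambda>n. d n * y (n + k)) \<in> ell2" and "ell2_norm (\<lambda>n. d n * y (n + k)) \<le> D * ell2_norm y"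
proof -
  have D: "0 \<le> D" using d[of 0] norm_ge_zero order_trans by blast
  have "(\<Sum>n\<in>F. (cmod (d n * y (n + k)))\<^sup>2) \<le> (D * ell2_norm y)\<^sup>2" if F: "finite F" for F
  proof -
    have "(\<Sum>n\<in>F. (cmod (d n * y (n + k)))\<^sup>2) \<le> (\<Sum>n\<in>F. D\<^sup>2 * (cmod (y (n + k)))\<^sup>2)"
      unfolding norm_mult power_mult_distrib by (intro sum_mono mult_right_mono power_mono d) auto
    also have "\<dots> = D\<^sup>2 * (\<Sum>n\<in>(\<lambda>n. n + k) ` F. (cmod (y n))\<^sup>2)"
      by (subst sum.reindex) (auto simp: inj_on_def sum_distrib_left)
    also have "\<dots> \<le> D\<^sup>2 * (ell2_norm y)\<^sup>2"
      by (intro mult_left_mono ell2_finite_sum_le y finite_imageI F) simp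
    finally show ?thesis by (simp add: power_mult_distrib)
  qed
  from ell2I[OF this] D show "(\<lambda>n. d n * y (n + k)) \<in> ell2"
    "ell2_norm (\<lambda>n. d n * y (n + k)) \<le> D * ell2_norm y" by simp_all
qed

lemma jacobi_bounded:
  assumes y: "y \<in> ell2" and A: "\<And>n. \<bar>a n\<bar> \<le> A" and B: "\<And>n. \<bar>b n\<bar> \<le> B"
  shows "jacobi a b y \<in> ell2" and "ell2_norm (jacobi a b y) \<le> (2 * A + B) * ell2_norm y"
proof -
  have 1: "(\<lambda>n. of_real (a (n - 1)) * y (n - 1)) \<in> ell2"
    "ell2_norm (\<lambda>n. of_real (a (n - 1)) * y (n - 1)) \<le> A * ell2_norm y"
    using ell2_weighted_shift[OF y, of "\<lambda>n. of_real (a (n - 1))" A "- 1"] A by simp_all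
  have 2: "(\<lambda>n. of_real (b n) * y n) \<in> ell2" "ell2_norm (\<lambda>n. of_real (b n) * y n) \<le> B * ell2_norm y"
    using ell2_weighted_shift[OF y, of "\<lambda>n. of_real (b n)" B 0] B by simp_all
  have 3: "(\<lambda>n. of_real (a n) * y (n + 1)) \<in> ell2" "ell2_norm (\<lambda>n. of_real (a n) * y (n + 1)) \<le> A * ell2_norm y"
    using ell2_weighted_shift[OF y, of "\<lambda>n. of_real (a n)" A 1] A by simp_all
  note 12 = ell2_norm_triangle[OF 1(1) 2(1)]
  note 123 = ell2_norm_triangle[OF 12(1) 3(1)]
  show "jacobi a b y \<in> ell2" unfolding jacobi_def by (rule 123(1))
  have "ell2_norm (jacobi a b y) \<le> A * ell2_norm y + B * ell2_norm y + A * ell2_norm y"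
    unfolding jacobi_def using 123(2) 12(2) 1(2) 2(2) 3(2) by linarith
  then show "ell2_norm (jacobi a b y) \<le> (2 * A + B) * ell2_norm y" by (simp add: algebra_simps)
qed

lemma jacobi_minus_scalar: "(\<lambda>n. jacobi a b y n - of_real c * y n) = jacobi a (\<lambda>n. b n - c) y"
  by (simp add: jacobi_def algebra_simps)

lemma jacobi_minus_jacobi: "(\<lambda>n. jacobi a b y n - jacobi a' b' y n) = jacobi (\<lambda>n. a n - a' n) (\<lambda>n. b n - b' n) y"
  by (simp add: jacobi_def algebra_simps)

lemma jacobi_linear: "jacobi a b (\<lambda>n. x n - t * y n) = (\<lambda>n. jacobi a b x n - t * jacobi a b y n)"
  by (simp add: jacobi_def algebra_simps)

lemma jacobi_finite_support': "finite {n. y n \<noteq> 0} \<Longrightarrow> finite {n. jacobi a b y n \<noteq> 0}"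
  using jacobi_finite_support[of y a b 0] by simp

lemma finite_support_diff:
  fixes x y :: "int \<Rightarrow> complex"
  assumes "finite {n. x n \<noteq> 0}" "finite {n. y n \<noteq> 0}"
  shows "finite {n. x n - t * y n \<noteq> 0}"
  by (rule finite_subset[of _ "{n. x n \<noteq> 0} \<union> {n. y n \<noteq> 0}"]) (use assms in auto)

section \<open>Inner product and symmetry of the Jacobi operator\<close>

definition cinner2 :: "(int \<Rightarrow> complex) \<Rightarrow> (int \<Rightarrow> complex) \<Rightarrow> complex" where
  "cinner2 x y = (\<Sum>\<^sub>\<infinity>n. x n * cnj (y n))"

lemma has_sum_finite_support:
  fixes f :: "int \<Rightarrow> 'a::{comm_monoid_add,t2_space}"
  assumes "finite {n. f n \<noteq> 0}"
  shows "(f has_sum (\<Sum>\<^sub>\<infinity>n. f n)) UNIV"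
proof -
  have "f summable_on {n. f n \<noteq> 0}" using assms by simp
  then have "f summable_on UNIV" by (subst summable_on_cong_neutral[where T="{n. f n \<noteq> 0}" and g=f]) auto
  then show ?thesis by simp
qed

lemma has_sum_cinner2:
  assumes "finite {n. x n \<noteq> 0}"
  shows "((\<lambda>n. x n * cnj (y n)) has_sum cinner2 x y) UNIV"
  unfolding cinner2_def
  by (rule has_sum_finite_support) (rule finite_subset[OF _ assms], auto)

lemma cinner2_self:
  assumes "finite {n. x n \<noteq> 0}"
  shows "cinner2 x x = of_real ((ell2_norm x)\<^sup>2)"
proof -
  have "(\<lambda>n. (cmod (x n))\<^sup>2) summable_on UNIV" using finite_support_ell2[OF assms] by (simp add: ell2_def)
  then have "((\<lambda>n. complex_of_real ((cmod (x n))\<^sup>2)) has_sum of_real ((ell2_norm x)\<^sup>2)) UNIV"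
    unfolding ell2_norm_sq by (intro has_sum_of_real has_sum_infsum)
  then have "((\<lambda>n. x n * cnj (x n)) has_sum of_real ((ell2_norm x)\<^sup>2)) UNIV"
    by (simp add: complex_mult_cnj cmod_def flip: of_real_power)
  then show ?thesis unfolding cinner2_def by (rule infsumI)
qed

lemma cinner2_diff_left:
  assumes "finite {n. x n \<noteq> 0}" "finite {n. y n \<noteq> 0}"
  shows "cinner2 (\<lambda>n. x n - t * y n) v = cinner2 x v - t * cinner2 y v"
proof -
  have "((\<lambda>n. x n * cnj (v n) - t * (y n * cnj (v n))) has_sum (cinner2 x v - t * cinner2 y v)) UNIV"
    by (intro has_sum_diff has_sum_cmult_right has_sum_cinner2 assms)
  then show ?thesis unfolding cinner2_def[of "\<lambda>n. x n - t * y n"]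
    by (intro infsumI) (simp add: algebra_simps)
qed

lemma cinner2_cnj: "cinner2 y x = cnj (cinner2 x y)"
  unfolding cinner2_def by (simp flip: infsum_cnj add: mult.commute)

text \<open>Summation by parts: a shift by one site exchanges the two off-diagonal sums. Finite
  support of \<open>x\<close> settles all convergence, and Jacobi operators preserve finite support,
  so powers of them can be handled in the same way.\<close>

lemma jacobi_symmetric:
  assumes x: "finite {n. x n \<noteq> 0}"
  shows "cinner2 (jacobi a b x) y = cinner2 x (jacobi a b y)"
proof -
  have f1: "finite {n. x (n - 1) \<noteq> 0}"
    using finite_vimageI[OF x, of "\<lambda>n. n - 1"] by (simp add: vimage_def inj_def)
  have f2: "finite {n. x (n + 1) \<noteq> 0}"
    using finite_vimageI[OF x, of "\<lambda>n. n + 1"] by (simp add: vimage_def inj_def)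
  let ?f1 = "\<lambda>n. of_real (a (n - 1)) * x (n - 1) * cnj (y n)"
  let ?f2 = "\<lambda>n. of_real (a n) * x (n + 1) * cnj (y n)"
  let ?f3 = "\<lambda>n. of_real (b n) * x n * cnj (y n)"
  have h1: "(?f1 has_sum infsum ?f1 UNIV) UNIV"
    by (rule has_sum_finite_support) (rule finite_subset[OF _ f1], auto)
  have h2: "(?f2 has_sum infsum ?f2 UNIV) UNIV"
    by (rule has_sum_finite_support) (rule finite_subset[OF _ f2], auto)
  have h3: "(?f3 has_sum infsum ?f3 UNIV) UNIV"
    by (rule has_sum_finite_support) (rule finite_subset[OF _ x], auto)
  note h1' = has_sum_int_shift(1)[OF h1, of 1] and h2' = has_sum_int_shift(2)[OF h2, of 1]
  have "((\<lambda>n. ?f1 n + ?f3 n + ?f2 n) has_sum (infsum ?f1 UNIV + infsum ?f3 UNIV + infsum ?f2 UNIV)) UNIV"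
    by (intro has_sum_add h1 h2 h3)
  then have 1: "cinner2 (jacobi a b x) y = infsum ?f1 UNIV + infsum ?f3 UNIV + infsum ?f2 UNIV"
    unfolding cinner2_def jacobi_def by (intro infsumI) (simp add: distrib_right)
  have "((\<lambda>n. ?f2 (n - 1) + ?f3 n + ?f1 (n + 1)) has_sum (infsum ?f2 UNIV + infsum ?f3 UNIV + infsum ?f1 UNIV)) UNIV"
    by (intro has_sum_add h1' h2' h3)
  then have "cinner2 x (jacobi a b y) = infsum ?f2 UNIV + infsum ?f3 UNIV + infsum ?f1 UNIV"
    unfolding cinner2_def jacobi_def by (intro infsumI) (simp add: algebra_simps)
  with 1 show ?thesis by simp
qed

lemma ell2_norm_diff_sq:
  fixes t :: real
  assumes x: "finite {n. x n \<noteq> 0}" and y: "finite {n. y n \<noteq> 0}"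
  shows "(ell2_norm (\<lambda>n. x n - of_real t * y n))\<^sup>2 =
    (ell2_norm x)\<^sup>2 - 2 * t * Re (cinner2 x y) + t\<^sup>2 * (ell2_norm y)\<^sup>2"
proof -
  let ?v = "\<lambda>n. x n - of_real t * y n"
  have v: "finite {n. ?v n \<noteq> 0}" by (rule finite_support_diff[OF x y])
  have "complex_of_real ((ell2_norm ?v)\<^sup>2) = cinner2 x ?v - of_real t * cinner2 y ?v"
    unfolding cinner2_self[OF v, symmetric] by (rule cinner2_diff_left[OF x y])
  also have "cinner2 x ?v = of_real ((ell2_norm x)\<^sup>2) - of_real t * cinner2 x y"
    unfolding cinner2_cnj[of x ?v] cinner2_diff_left[OF x y] cinner2_self[OF x] cinner2_cnj[of y x] by simp
  also have "cinner2 y ?v = cnj (cinner2 x y) - of_real t * of_real ((ell2_norm y)\<^sup>2)"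
    unfolding cinner2_cnj[of y ?v] cinner2_diff_left[OF x y] cinner2_self[OF y] cinner2_cnj[of y x] by simp
  finally have "Re (complex_of_real ((ell2_norm ?v)\<^sup>2)) = Re (of_real ((ell2_norm x)\<^sup>2) - of_real t * cinner2 x y
      - of_real t * (cnj (cinner2 x y) - of_real t * of_real ((ell2_norm y)\<^sup>2)))" by simp
  then show ?thesis by (simp add: power2_eq_square algebra_simps)
qed

text \<open>For the quadratic form \<open>F x = \<parallel>A x\<parallel>\<^sup>2 - \<rho> \<parallel>x\<parallel>\<^sup>2\<close> of \<open>B = A\<^sup>2 - \<rho>\<close> with \<open>A = J - c\<close>:
  evaluating \<open>0 \<le> F (x - t B x)\<close> at \<open>t = 1 / M\<^sup>2\<close> bounds \<open>\<parallel>B x\<parallel>\<^sup>2\<close> by \<open>M\<^sup>2 F x\<close>.\<close>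

lemma positive_form_bound:
  fixes \<alpha> \<beta> :: "int \<Rightarrow> real"
  defines "A \<equiv> jacobi \<alpha> \<beta>"
  assumes M: "0 < M" "\<And>y. finite {n. y n \<noteq> 0} \<Longrightarrow> ell2_norm (A y) \<le> M * ell2_norm y"
    and \<rho>: "0 \<le> \<rho>" "\<And>y. finite {n. y n \<noteq> 0} \<Longrightarrow> \<rho> * (ell2_norm y)\<^sup>2 \<le> (ell2_norm (A y))\<^sup>2"
    and x: "finite {n. x n \<noteq> 0}"
  shows "(ell2_norm (\<lambda>n. A (A x) n - of_real \<rho> * x n))\<^sup>2 \<le> M\<^sup>2 * ((ell2_norm (A x))\<^sup>2 - \<rho> * (ell2_norm x)\<^sup>2)"
proof -
  define B where "B = (\<lambda>n. A (A x) n - of_real \<rho> * x n)"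
  have Ax: "finite {n. A x n \<noteq> 0}" unfolding A_def by (rule jacobi_finite_support'[OF x])
  have AAx: "finite {n. A (A x) n \<noteq> 0}" using Ax unfolding A_def by (rule jacobi_finite_support')
  have Bf: "finite {n. B n \<noteq> 0}" unfolding B_def by (rule finite_support_diff[OF AAx x])
  have AB: "finite {n. A B n \<noteq> 0}" unfolding A_def by (rule jacobi_finite_support'[OF Bf])
  define t where "t = 1 / M\<^sup>2"
  define N where "N = (ell2_norm B)\<^sup>2"
  have "\<rho> * (ell2_norm (\<lambda>n. x n - of_real t * B n))\<^sup>2 \<le> (ell2_norm (\<lambda>n. A x n - of_real t * A B n))\<^sup>2"
    using \<rho>(2)[OF finite_support_diff[OF x Bf, of "of_real t"]] unfolding A_def jacobi_linear .
  then have 1: "0 \<le> (ell2_norm (A x))\<^sup>2 - \<rho> * (ell2_norm x)\<^sup>2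
      - 2 * t * (Re (cinner2 (A x) (A B)) - \<rho> * Re (cinner2 x B))
      + t\<^sup>2 * ((ell2_norm (A B))\<^sup>2 - \<rho> * (ell2_norm B)\<^sup>2)"
    unfolding ell2_norm_diff_sq[OF x Bf] ell2_norm_diff_sq[OF Ax AB] by (simp add: algebra_simps)
  \<comment> \<open>The linear term in t is the polarised form at x and B; moving one
    \<open>A\<close> across turns it into the squared norm of \<open>B\<close>.\<close>
  have "cinner2 (A x) (A B) = cinner2 (A (A x)) B"
    unfolding A_def by (rule jacobi_symmetric[symmetric, OF Ax[unfolded A_def]])
  moreover have "cinner2 B B = cinner2 (A (A x)) B - of_real \<rho> * cinner2 x B"
    by (subst (1) B_def) (rule cinner2_diff_left[OF AAx x])
  ultimately have "cinner2 (A x) (A B) - of_real \<rho> * cinner2 x B = cinner2 B B" by simp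
  also have "\<dots> = of_real N" unfolding N_def by (rule cinner2_self[OF Bf])
  finally have "Re (cinner2 (A x) (A B) - of_real \<rho> * cinner2 x B) = N" by simp
  then have "Re (cinner2 (A x) (A B)) - \<rho> * Re (cinner2 x B) = N" by simp
  moreover have "(ell2_norm (A B))\<^sup>2 - \<rho> * (ell2_norm B)\<^sup>2 \<le> M\<^sup>2 * N"
  proof -
    have "(ell2_norm (A B))\<^sup>2 \<le> (M * ell2_norm B)\<^sup>2" by (intro power_mono M Bf) simp
    moreover have "0 \<le> \<rho> * (ell2_norm B)\<^sup>2" using \<rho>(1) by simp
    ultimately show ?thesis by (simp add: N_def power_mult_distrib)
  qed
  then have "t\<^sup>2 * ((ell2_norm (A B))\<^sup>2 - \<rho> * (ell2_norm B)\<^sup>2) \<le> t\<^sup>2 * (M\<^sup>2 * N)" by (intro mult_left_mono) auto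
  ultimately have "0 \<le> (ell2_norm (A x))\<^sup>2 - \<rho> * (ell2_norm x)\<^sup>2 - 2 * t * N + t\<^sup>2 * (M\<^sup>2 * N)" using 1 by simp
  also have "t\<^sup>2 * (M\<^sup>2 * N) = t * N" using M(1) by (simp add: t_def power2_eq_square)
  finally have "t * N \<le> (ell2_norm (A x))\<^sup>2 - \<rho> * (ell2_norm x)\<^sup>2" by (simp add: algebra_simps)
  then show ?thesis unfolding B_def[symmetric] N_def[symmetric] t_def using M(1) by (simp add: field_simps)
qed

text \<open>If \<open>\<rho>\<close> is the infimum of \<open>\<parallel>A y\<parallel>\<^sup>2 / \<parallel>y\<parallel>\<^sup>2\<close>, then \<open>A\<^sup>2 - \<rho>\<close> is not bounded below, so one of
  its factors \<open>A - \<surd>\<rho>\<close> and \<open>A + \<surd>\<rho>\<close> is not, and \<open>c + \<surd>\<rho>\<close> or \<open>c - \<surd>\<rho>\<close> is in the spectrum.\<close>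

lemma spectral_gap_norm_bound:
  assumes ab: "\<And>n. \<bar>a n\<bar> \<le> K" "\<And>n. \<bar>b n\<bar> \<le> K'"
    and free: "\<And>x. \<bar>x - c\<bar> < d \<Longrightarrow> of_real x \<notin> spectrum_ell2 (jacobi a b)"
    and y: "finite {n. y n \<noteq> 0}"
  shows "d * ell2_norm y \<le> ell2_norm (\<lambda>n. jacobi a b y n - of_real c * y n)"
proof (cases "0 < d \<and> 0 < ell2_norm y")
  case False
  then have "d * ell2_norm y \<le> 0" using ell2_norm_nonneg[of y] by (auto simp: mult_le_0_iff not_less)
  then show ?thesis using ell2_norm_nonneg order_trans by blast
next
  case True
  define A where "A = jacobi a (\<lambda>n. b n - c)"
  have A: "(\<lambda>n. jacobi a b y n - of_real c * y n) = A y" for y unfolding A_def by (rule jacobi_minus_scalar)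
  define M where "M = 2 * K + (K' + \<bar>c\<bar>) + 1"
  have K: "0 \<le> K" "0 \<le> K'" using ab[of 0] abs_ge_zero order_trans by blast+
  have M: "0 < M" using K by (simp add: M_def)
  have AM: "ell2_norm (A y) \<le> M * ell2_norm y" if "finite {n. y n \<noteq> 0}" for y
  proof -
    have "\<bar>b n - c\<bar> \<le> K' + \<bar>c\<bar>" for n using ab(2)[of n] by linarith
    then have "ell2_norm (A y) \<le> (2 * K + (K' + \<bar>c\<bar>)) * ell2_norm y"
      unfolding A_def by (intro jacobi_bounded finite_support_ell2 that ab)
    also have "\<dots> \<le> M * ell2_norm y" by (intro mult_right_mono) (simp_all add: M_def)
    finally show ?thesis .
  qed
  define Q where "Q = {(ell2_norm (A x))\<^sup>2 / (ell2_norm x)\<^sup>2 | x. finite {n. x n \<noteq> 0} \<and> 0 < ell2_norm x}"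
  define \<rho> where "\<rho> = Inf Q"
  have Q: "Q \<noteq> {}" "bdd_below Q" using True y by (auto simp: Q_def intro!: bdd_belowI[of _ 0])
  have \<rho>0: "0 \<le> \<rho>" unfolding \<rho>_def by (rule cInf_greatest[OF Q(1)]) (auto simp: Q_def)
  have \<rho>: "\<rho> * (ell2_norm x)\<^sup>2 \<le> (ell2_norm (A x))\<^sup>2" if x: "finite {n. x n \<noteq> 0}" for x
  proof (cases "0 < ell2_norm x")
    case True
    then have "\<rho> \<le> (ell2_norm (A x))\<^sup>2 / (ell2_norm x)\<^sup>2"
      unfolding \<rho>_def by (intro cInf_lower Q) (use x in \<open>auto simp: Q_def\<close>)
    then show ?thesis using True by (simp add: field_simps)
  next
    case False
    then have "ell2_norm x = 0" using ell2_norm_nonneg[of x] by linarith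
    then show ?thesis by simp
  qed
  have "d\<^sup>2 \<le> \<rho>"
  proof (rule ccontr)
    assume "\<not> d\<^sup>2 \<le> \<rho>"
    then have sq: "sqrt \<rho> < d" using True by (intro real_less_lsqrt) (auto simp: \<rho>0)
    define s where "s = sqrt \<rho>"
    have s: "0 \<le> s" "s < d" "s\<^sup>2 = \<rho>" using sq \<rho>0 by (simp_all add: s_def)
    have res: "\<exists>C>0. \<forall>v. finite {n. v n \<noteq> 0} \<longrightarrow> ell2_norm v \<le> C * ell2_norm (\<lambda>n. A v n - of_real r * v n)"
      if "\<bar>r\<bar> < d" for r
    proof -
      have "of_real (c + r) \<notin> spectrum_ell2 (jacobi a b)" using free[of "c + r"] that by simp
      then obtain C where C: "0 < C" "\<And>v. v \<in> ell2 \<Longrightarrow> (\<lambda>n. jacobi a b v n - of_real (c + r) * v n) \<in> ell2 \<Longrightarrow>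
          ell2_norm v \<le> C * ell2_norm (\<lambda>n. jacobi a b v n - of_real (c + r) * v n)"
        using resolvent_bound by blast
      have "(\<lambda>n. jacobi a b v n - of_real (c + r) * v n) = (\<lambda>n. A v n - of_real r * v n)" for v
        unfolding A[symmetric] by (simp add: algebra_simps)
      then show ?thesis
        using C by (metis finite_support_ell2 jacobi_finite_support)
    qed
    obtain C1 where C1: "0 < C1" "\<And>v. finite {n. v n \<noteq> 0} \<Longrightarrow> ell2_norm v \<le> C1 * ell2_norm (\<lambda>n. A v n - of_real s * v n)"
      using res[of s] s by auto
    obtain C2 where C2: "0 < C2" "\<And>v. finite {n. v n \<noteq> 0} \<Longrightarrow> ell2_norm v \<le> C2 * ell2_norm (\<lambda>n. A v n - of_real (- s) * v n)"
      using res[of "- s"] s by auto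
    \<comment> \<open>If \<open>s < d\<close>, the factors A - s and A + s are bounded below with
      constants 1 / \<open>C1\<close> and 1 / \<open>C2\<close>, hence so is their product A^2 -
      \<rho>. Through \<open>positive_form_bound\<close> every Rayleigh quotient then exceeds its
      infimum \<rho> by \<kappa>, which is absurd.\<close>
    define \<kappa> where "\<kappa> = 1 / ((C2 * C1)\<^sup>2 * M\<^sup>2)"
    have \<kappa>: "0 < \<kappa>" using C1 C2 M by (simp add: \<kappa>_def)
    have "\<rho> + \<kappa> \<le> q" if q: "q \<in> Q" for q
    proof -
      obtain x where x: "finite {n. x n \<noteq> 0}" "0 < ell2_norm x" "q = (ell2_norm (A x))\<^sup>2 / (ell2_norm x)\<^sup>2"
        using q by (auto simp: Q_def)
      define v where "v = (\<lambda>n. A x n - of_real (- s) * x n)"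
      have Ax: "finite {n. A x n \<noteq> 0}" unfolding A_def by (rule jacobi_finite_support'[OF x(1)])
      have v: "finite {n. v n \<noteq> 0}" unfolding v_def by (rule finite_support_diff[OF Ax x(1)])
      have "A v = (\<lambda>n. A (A x) n - of_real (- s) * A x n)" unfolding v_def A_def by (rule jacobi_linear)
      then have "(\<lambda>n. A v n - of_real s * v n) = (\<lambda>n. A (A x) n - of_real \<rho> * x n)"
        unfolding s(3)[symmetric] by (simp add: v_def algebra_simps power2_eq_square)
      then have "ell2_norm v \<le> C1 * ell2_norm (\<lambda>n. A (A x) n - of_real \<rho> * x n)"
        using C1(2)[OF v] by (simp only:)
      from mult_left_mono[OF this, of C2] C2(1)
      have "ell2_norm x \<le> C2 * (C1 * ell2_norm (\<lambda>n. A (A x) n - of_real \<rho> * x n))"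
        using C2(2)[OF x(1)] unfolding v_def[symmetric] by linarith
      then have "(ell2_norm x)\<^sup>2 \<le> (C2 * (C1 * ell2_norm (\<lambda>n. A (A x) n - of_real \<rho> * x n)))\<^sup>2"
        by (intro power_mono) auto
      also have "\<dots> = (C2 * C1)\<^sup>2 * (ell2_norm (\<lambda>n. A (A x) n - of_real \<rho> * x n))\<^sup>2"
        by (simp add: power_mult_distrib)
      also have "\<dots> \<le> (C2 * C1)\<^sup>2 * (M\<^sup>2 * ((ell2_norm (A x))\<^sup>2 - \<rho> * (ell2_norm x)\<^sup>2))"
        unfolding A_def
        by (intro mult_left_mono positive_form_bound M AM[unfolded A_def] \<rho>0 \<rho>[unfolded A_def] x) simp_all
      finally have "\<kappa> * (ell2_norm x)\<^sup>2 \<le> (ell2_norm (A x))\<^sup>2 - \<rho> * (ell2_norm x)\<^sup>2"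
        using C1(1) C2(1) M by (simp add: \<kappa>_def divide_le_eq mult_ac)
      then show ?thesis using x(2) by (simp add: x(3) le_divide_eq algebra_simps)
    qed
    then have "\<rho> + \<kappa> \<le> \<rho>" unfolding \<rho>_def by (intro cInf_greatest[OF Q(1)]) auto
    then show False using \<kappa> by simp
  qed
  then have "(d * ell2_norm y)\<^sup>2 \<le> (ell2_norm (A y))\<^sup>2"
    using \<rho>[OF y] mult_right_mono[of "d\<^sup>2" \<rho> "(ell2_norm y)\<^sup>2"] by (simp add: power_mult_distrib)
  then show ?thesis unfolding A by (rule power2_le_imp_le) simp
qed

section \<open>Elementary bounds for the variation\<close>

lemma variation_upper:
  assumes "periodic p c" "0 < p"
  shows "c i - c j \<le> variation c"
proof -
  obtain B where B: "\<And>j. \<bar>c j\<bar> \<le> B" using periodic_bounded[OF assms] by blast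
  have "bdd_above (range (\<lambda>(i, j). c i - c j))"
  proof (rule bdd_aboveI2)
    fix x :: "int \<times> int"
    show "(case x of (i, j) \<Rightarrow> c i - c j) \<le> 2 * B"
      using B[of "fst x"] B[of "snd x"] by (cases x) (auto simp: abs_le_iff)
  qed
  from cSUP_upper[OF UNIV_I this, of "(i, j)"] show ?thesis by (simp add: variation_def)
qed

lemma variation_least: "(\<And>i j. c i - c j \<le> B) \<Longrightarrow> variation c \<le> B"
  unfolding variation_def by (rule cSUP_least) auto

section \<open>Gap lengths and variations\<close>

context periodic_jacobi
begin

lemma band_edges_spectrum:
  assumes "oscillates p Delta l u"
  shows "band_edges p (spectrum_ell2 (jacobi a b)) l u"
  unfolding band_edges_def spectrum_eq oscillatesD(8)[OF assms]
  using oscillatesD(1,2)[OF assms] by (auto simp: image_UN)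

lemma period_sum: "(\<Sum>i=1..p. b (n + int i)) = (\<Sum>i=1..p. b (int i))"
proof -
  define T where "T n = (\<Sum>i=1..p. b (n + int i))" for n
  have step: "T (n + 1) = T n" for n
  proof -
    have per: "b (n + 1 + int p) = b (n + 1 + int 0)" using b_per by (simp add: periodic_def)
    have T: "T n = (\<Sum>i<p. b (n + 1 + int i))" for n
      unfolding T_def
      by (rule sum.reindex_bij_witness[where i="\<lambda>i. i + 1" and j="\<lambda>i. i - 1"]) (auto simp: algebra_simps)
    have "T (n + 1) = (\<Sum>i<p. b (n + 1 + int (Suc i)))" unfolding T by (simp add: algebra_simps)
    also have "\<dots> = (\<Sum>i<Suc p. b (n + 1 + int i)) - b (n + 1 + int 0)"
      unfolding sum.lessThan_Suc_shift by simp
    also have "\<dots> = T n" unfolding T sum.lessThan_Suc per by simp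
    finally show ?thesis .
  qed
  have "T n = T 0"
  proof (induction n rule: int_induct[where k=0])
    case (step2 i)
    then show ?case using step[of "i - 1"] by simp
  qed (simp_all add: step)
  then show ?thesis by (simp add: T_def)
qed

text \<open>The sum of \<open>b\<close> over a period is independent of the site, so the trace
  bounds confine each \<open>b n\<close>, and likewise each \<open>2 * a n\<close>, to an interval
  of length \<open>W\<close> whose ends do not depend on n.\<close>

lemma entry_differences:
  assumes osc: "oscillates p Delta l u"
  defines "W \<equiv> (\<Sum>i<p - 1. u (Suc i) - l (Suc i))"
  shows "b i - b j \<le> W" and "2 * (a i - a j) \<le> W"
proof -
  define T where "T = (\<Sum>i=1..p. b (int i))"
  obtain q where q: "p = Suc q" using p_pos by (cases p) auto
  have osc': "oscillates p (periodic_rec.disc (\<lambda>k. a (n + int k)) (\<lambda>k. b (n + int k)) p) l u" for n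
    using osc by (simp only: disc_eq_Delta)
  note tb = periodic_rec.trace_bounds[OF rec osc']
  have T: "T = (\<Sum>i=1..p - 1. b (n + int i)) + b n" for n
  proof -
    have "T = (\<Sum>i=1..p. b (n + int i))" unfolding T_def period_sum ..
    also have "\<dots> = (\<Sum>i=1..p - 1. b (n + int i)) + b (n + int p)" by (simp add: q)
    also have "b (n + int p) = b n" using b_per by (simp add: periodic_def)
    finally show ?thesis .
  qed
  have W: "W = (\<Sum>i<p - 1. u (Suc i)) - (\<Sum>i<p - 1. l (Suc i))"
    unfolding W_def by (rule sum_subtractf)
  show "b i - b j \<le> W"
    using tb(2)[of i] tb(1)[of j] tb(1)[of i] tb(2)[of j] T[of i] T[of j] unfolding W by linarith
  have "(\<Sum>k=1..p. b (i + int k)) = (\<Sum>k=1..p. b (j + int k))"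
    using period_sum[of i] period_sum[of j] by simp
  then show "2 * (a i - a j) \<le> W"
    using tb(4)[of i] tb(3)[of j] unfolding W by simp
qed

lemma spectrum_weyl:
  assumes x: "of_real x \<in> spectrum_ell2 (jacobi a b)" and "0 < \<epsilon>"
  obtains y where "finite {n. y n \<noteq> 0}" "0 < ell2_norm y"
    "ell2_norm (\<lambda>n. jacobi a b y n - of_real x * y n) \<le> \<epsilon> * ell2_norm y"
proof -
  have "\<bar>poly Delta x\<bar> \<le> 2" using x unfolding spectrum_eq by auto
  then obtain m :: complex where m: "m\<^sup>2 - poly Delta (of_real x) * m + 1 = 0" "cmod m = 1"
    by (rule unimodular_multiplier)
  obtain \<psi> where \<psi>: "jacobi a b \<psi> = (\<lambda>n. of_real x * \<psi> n)" "\<And>n. \<psi> (n + int p) = m * \<psi> n" "\<psi> 0 \<noteq> 0 \<or> \<psi> 1 \<noteq> 0"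
    using bloch_solution[OF m(1)] by blast
  have "cmod (\<psi> (n + int p)) = cmod (\<psi> n)" for n using \<psi>(2) m(2) by (simp add: norm_mult)
  from weyl_sequence[OF \<psi>(1) this \<psi>(3) assms(2)] that show thesis by blast
qed

text \<open>Comparison with the constant matrix with entries \<open>a 0\<close>, \<open>b 0\<close>, whose spectrum is the
  interval \<open>[b 0 - 2 a 0, b 0 + 2 a 0]\<close>: either the midpoint of the gap lies in this interval, or
  an end point of the gap is at distance at least half the gap length from it.\<close>

lemma gap_le_variation:
  assumes osc: "oscillates p Delta l u" and j: "j \<in> {1..<p}"
  shows "u j - l j \<le> 2 * variation b + 4 * variation a"
proof (cases "l j < u j")
  case False
  have "0 \<le> variation b" "0 \<le> variation a"
    using variation_upper[OF b_per p_pos, of 0 0] variation_upper[OF a_per p_pos, of 0 0] by simp_all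
  then show ?thesis using False by simp
next
  case True
  \<comment> \<open>A bound for the norm of the difference from the constant matrix: its two
    off-diagonals are bounded by the variation of \<open>a\<close>, its diagonal by that of
    \<open>b\<close>.\<close>
  define h where "h = 2 * variation a + variation b"
  define c where "c = (l j + u j) / 2"
  define d where "d = (u j - l j) / 2"
  let ?S = "spectrum_ell2 (jacobi a b)"
  note B = band_edges_spectrum[OF osc]
  obtain i where i: "j = Suc i" using j by (cases j) auto
  have lS: "complex_of_real (l j) \<in> ?S"
    unfolding band_edges_mem[OF B] using oscillatesD(1)[OF osc, of i] i j by (intro exI[of _ i]) auto
  have uS: "complex_of_real (u j) \<in> ?S"
    unfolding band_edges_mem[OF B] using oscillatesD(1)[OF osc, of j] j by (intro exI[of _ j]) auto
  have free: "of_real x \<notin> ?S" if x: "\<bar>x - c\<bar> < d" for x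
  proof
    assume "complex_of_real x \<in> ?S"
    then obtain k where k: "k < p" "u k \<le> x" "x \<le> l (Suc k)" unfolding band_edges_mem[OF B] by blast
    have x': "l j < x" "x < u j" using x unfolding c_def d_def by (auto simp: abs_less_iff field_simps)
    show False
    proof (cases "k < j")
      case True
      then have "l (Suc k) \<le> l j"
        using band_edges_mono[OF B, of i k] oscillatesD(1)[OF osc, of i] i j by (cases "k = i") auto
      then show False using k x' by linarith
    next
      case False
      then have "u j \<le> u k"
        using band_edges_mono[OF B, of k j] oscillatesD(1)[OF osc, of j] j k by (cases "k = j") auto
      then show False using k x' by linarith
    qed
  qed
  obtain K where K: "\<And>n. \<bar>a n\<bar> \<le> K" using periodic_bounded[OF a_per p_pos] by blast
  obtain K' where K': "\<And>n. \<bar>b n\<bar> \<le> K'" using periodic_bounded[OF b_per p_pos] by blast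
  let ?J = "jacobi a b" and ?const = "jacobi (\<lambda>_. a 0) (\<lambda>_. b 0)"
  have pert: "ell2_norm (jacobi (\<lambda>n. a n - a 0) (\<lambda>n. b n - b 0) y) \<le> h * ell2_norm y"
    if "finite {n. y n \<noteq> 0}" for y
  proof -
    have v: "\<bar>a n - a 0\<bar> \<le> variation a" "\<bar>b n - b 0\<bar> \<le> variation b" for n
      using variation_upper[OF a_per p_pos, of n 0] variation_upper[OF a_per p_pos, of 0 n]
        variation_upper[OF b_per p_pos, of n 0] variation_upper[OF b_per p_pos, of 0 n] by linarith+
    show ?thesis unfolding h_def by (intro jacobi_bounded finite_support_ell2 that v)
  qed
  have "d \<le> h + \<epsilon>" if \<epsilon>: "0 < \<epsilon>" for \<epsilon>
  proof (cases "\<bar>c - b 0\<bar> \<le> 2 * a 0")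
    case True
    interpret J0: periodic_jacobi "\<lambda>_. a 0" "\<lambda>_. b 0" p
      using p_pos a_pos by unfold_locales (auto simp: periodic_def)
    \<comment> \<open>The midpoint c is then an energy of the constant matrix, with a plane wave of
      phase \<theta> per site as its generalised eigenfunction.\<close>
    define \<theta> where "\<theta> = arccos ((c - b 0) / (2 * a 0))"
    have "\<bar>(c - b 0) / (2 * a 0)\<bar> \<le> 1" using True a_pos[of 0] unfolding abs_divide by simp
    then have "cos \<theta> = (c - b 0) / (2 * a 0)" unfolding \<theta>_def by (simp add: cos_arccos_abs)
    then have c: "c = b 0 + 2 * a 0 * cos \<theta>" using a_pos[of 0] by (simp add: field_simps)
    define \<psi> where "\<psi> n = cis (\<theta> * of_int n)" for n
    have sol: "?const \<psi> = (\<lambda>n. of_real c * \<psi> n)"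
    proof
      fix n
      have "\<psi> (n - 1) = cis (- \<theta>) * \<psi> n" "\<psi> (n + 1) = cis \<theta> * \<psi> n"
        unfolding \<psi>_def cis_mult by (simp_all add: algebra_simps)
      then have "?const \<psi> n = (of_real (b 0) + of_real (a 0) * (cis (- \<theta>) + cis \<theta>)) * \<psi> n"
        unfolding jacobi_def by (simp only: distrib_left distrib_right mult.assoc add_ac)
      also have "cis (- \<theta>) + cis \<theta> = of_real (2 * cos \<theta>)" by (simp add: complex_eq_iff)
      finally show "?const \<psi> n = of_real c * \<psi> n" by (simp add: c)
    qed
    obtain y where y: "finite {n. y n \<noteq> 0}" "0 < ell2_norm y"
        "ell2_norm (\<lambda>n. ?const y n - of_real c * y n) \<le> \<epsilon> * ell2_norm y"
      by (rule J0.weyl_sequence[OF sol _ _ \<epsilon>]) (auto simp: \<psi>_def)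
    \<comment> \<open>The gap forces \<open>J - c\<close> to stretch \<open>y\<close> by at least d,
      whereas the constant matrix contributes at most \<epsilon> and the perturbation at most
      h.\<close>
    have "d * ell2_norm y \<le> ell2_norm (\<lambda>n. ?J y n - of_real c * y n)"
      by (rule spectral_gap_norm_bound[OF K K' free y(1)])
    also have "(\<lambda>n. ?J y n - of_real c * y n) =
        (\<lambda>n. jacobi (\<lambda>n. a n - a 0) (\<lambda>n. b n - b 0) y n + (?const y n - of_real c * y n))"
      unfolding jacobi_minus_jacobi[of a b y "\<lambda>_. a 0" "\<lambda>_. b 0", symmetric] by simp
    also have "ell2_norm \<dots> \<le> ell2_norm (jacobi (\<lambda>n. a n - a 0) (\<lambda>n. b n - b 0) y) + ell2_norm (\<lambda>n. ?const y n - of_real c * y n)"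
      by (intro ell2_norm_triangle finite_support_ell2 jacobi_finite_support' jacobi_finite_support y)
    also have "\<dots> \<le> (h + \<epsilon>) * ell2_norm y" using pert[OF y(1)] y(3) by (simp add: distrib_right)
    finally show ?thesis using y(2) by simp
  next
    case False
    \<comment> \<open>The gap edge farther from \<open>b 0\<close>: the midpoint is already more
      than \<open>2 * a 0\<close> away, and this edge lies d further out.\<close>
    define e where "e = (if b 0 \<le> c then u j else l j)"
    have e: "complex_of_real e \<in> ?S" "2 * a 0 + d \<le> \<bar>e - b 0\<bar>"
      using lS uS False True a_pos[of 0] unfolding e_def c_def d_def by (auto simp: abs_if field_simps split: if_splits)
    obtain y where y: "finite {n. y n \<noteq> 0}" "0 < ell2_norm y"
        "ell2_norm (\<lambda>n. ?J y n - of_real e * y n) \<le> \<epsilon> * ell2_norm y"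
      by (rule spectrum_weyl[OF e(1) \<epsilon>])
    have "\<bar>e - b 0\<bar> * ell2_norm y \<le> ell2_norm (\<lambda>n. of_real (e - b 0) * y n)"
    proof -
      have "ell2_norm (\<lambda>n. of_real (e - b 0) * y n) = \<bar>e - b 0\<bar> * ell2_norm y"
        unfolding ell2_norm_def by (simp add: norm_mult power_mult_distrib infsum_cmult_right' real_sqrt_mult del: of_real_diff)
      then show ?thesis by simp
    qed
    \<comment> \<open>An approximate eigenvector of \<open>J\<close> at e is split into the constant
      off-diagonal part of norm at most \<open>2 * a 0\<close>, the perturbation, and the
      residual.\<close>
    also have "(\<lambda>n. of_real (e - b 0) * y n) = (\<lambda>n. jacobi (\<lambda>_. a 0) (\<lambda>_. 0) y n +
        (jacobi (\<lambda>n. a n - a 0) (\<lambda>n. b n - b 0) y n + - 1 * (?J y n - of_real e * y n)))"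
      by (simp add: jacobi_def algebra_simps)
    also have "ell2_norm \<dots> \<le> ell2_norm (jacobi (\<lambda>_. a 0) (\<lambda>_. 0) y) + (ell2_norm (jacobi (\<lambda>n. a n - a 0) (\<lambda>n. b n - b 0) y)
        + ell2_norm (\<lambda>n. - 1 * (?J y n - of_real e * y n)))"
    proof -
      have m: "(\<lambda>n. - 1 * (?J y n - of_real e * y n)) \<in> ell2"
        by (rule finite_support_ell2, rule finite_subset[OF _ jacobi_finite_support[OF y(1), of a b "of_real e"]]) auto
      have k: "jacobi (\<lambda>n. a n - a 0) (\<lambda>n. b n - b 0) y \<in> ell2" "jacobi (\<lambda>_. a 0) (\<lambda>_. 0) y \<in> ell2"
        by (intro finite_support_ell2 jacobi_finite_support' y)+
      note t = ell2_norm_triangle[OF k(1) m]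
      show ?thesis using ell2_norm_triangle(2)[OF k(2) t(1)] t(2) by linarith
    qed
    also have "\<dots> \<le> (2 * a 0 + h + \<epsilon>) * ell2_norm y"
    proof -
      have "ell2_norm (jacobi (\<lambda>_. a 0) (\<lambda>_. 0) y) \<le> (2 * a 0 + 0) * ell2_norm y"
        using a_pos[of 0] by (intro jacobi_bounded finite_support_ell2 y) auto
      moreover have "ell2_norm (\<lambda>n. - 1 * (?J y n - of_real e * y n)) = ell2_norm (\<lambda>n. ?J y n - of_real e * y n)"
        unfolding ell2_norm_def by (simp add: norm_minus_commute)
      ultimately show ?thesis using pert[OF y(1)] y(3) by (simp add: distrib_right)
    qed
    finally have "\<bar>e - b 0\<bar> \<le> 2 * a 0 + h + \<epsilon>" using y(2) by simp
    then show ?thesis using e(2) by linarith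
  qed
  then have "d \<le> h" by (rule field_le_epsilon)
  then show ?thesis by (simp add: d_def h_def)
qed

end

theorem theorem0p1:
  fixes p :: nat and a b :: "int \<Rightarrow> real"
  assumes "p \<ge> 1"
    and "\<And>j. a j > 0"
    and "periodic p a"
    and "periodic p b"
  defines "\<gamma> \<equiv> max_gap p (spectrum_ell2 (jacobi a b))"
  shows "variation b \<le> real p * (real p - 1) / 2 * \<gamma> \<and>
         variation a \<le> (real p)\<^sup>2 * sqrt (real p) * \<gamma> \<and>
         variation b + variation a \<ge> \<gamma> / 4"
proof -
  interpret periodic_jacobi a b p using assms by unfold_locales auto
  obtain l u where osc: "oscillates p Delta l u" using oscillates_Delta by blast
  have \<gamma>: "\<gamma> = max_gap_length p l u"
    unfolding \<gamma>_def by (rule max_gap_eq[OF band_edges_spectrum[OF osc]])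
  have \<gamma>0: "0 \<le> \<gamma>" unfolding \<gamma> by (rule max_gap_length_nonneg)
  have gap: "u j - l j \<le> \<gamma>" if "j \<in> {1..<p}" for j
    unfolding \<gamma> max_gap_length_def using that by (intro Max_ge) auto
  define W where "W = (\<Sum>i<p - 1. u (Suc i) - l (Suc i))"
  have "W \<le> real (card {..<p - 1}) * \<gamma>" unfolding W_def
    by (rule sum_bounded_above) (use gap in auto)
  then have W: "W \<le> (real p - 1) * \<gamma>" using assms(1) by simp
  have "variation b \<le> W" using entry_differences(1)[OF osc] unfolding W_def by (rule variation_least)
  also note W
  \<comment> \<open>Both sides vanish for p = 1, and p / 2 is at least 1 otherwise.\<close>
  also have "(real p - 1) * \<gamma> \<le> real p * (real p - 1) / 2 * \<gamma>"
  proof (intro mult_right_mono \<gamma>0)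
    show "real p - 1 \<le> real p * (real p - 1) / 2"
    proof (cases "p = 1")
      case False
      then have "2 \<le> real p" using assms(1) by simp
      from mult_right_mono[OF this, of "real p - 1"] show ?thesis using assms(1) by simp
    qed simp
  qed
  finally have 1: "variation b \<le> real p * (real p - 1) / 2 * \<gamma>" .
  have "2 * (a i - a j) \<le> W" for i j using entry_differences(2)[OF osc] unfolding W_def .
  then have "variation a \<le> W / 2" by (intro variation_least) (simp add: field_simps)
  also have "\<dots> \<le> real p * \<gamma>"
  proof -
    have "(real p - 1) * \<gamma> = real p * \<gamma> - \<gamma>" by (simp add: algebra_simps)
    moreover have "0 \<le> real p * \<gamma>" using \<gamma>0 by simp
    ultimately show ?thesis using W \<gamma>0 by linarith
  qed
  also have "\<dots> \<le> (real p)\<^sup>2 * sqrt (real p) * \<gamma>"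
  proof (intro mult_right_mono \<gamma>0)
    have "real p * 1 * 1 \<le> real p * real p * sqrt (real p)" using assms(1) by (intro mult_mono) auto
    then show "real p \<le> (real p)\<^sup>2 * sqrt (real p)" by (simp add: power2_eq_square)
  qed
  finally have 2: "variation a \<le> (real p)\<^sup>2 * sqrt (real p) * \<gamma>" .
  have v: "0 \<le> variation b" "0 \<le> variation a"
    using variation_upper[OF b_per p_pos, of 0 0] variation_upper[OF a_per p_pos, of 0 0] by simp_all
  \<comment> \<open>Each gap is at most twice the variation of \<open>b\<close> plus four times that
    of \<open>a\<close>; the larger coefficient 4 gives the constant 1 / 4.\<close>
  have "\<gamma> \<le> 4 * (variation b + variation a)"
    unfolding \<gamma> max_gap_length_def
  proof (rule Max.boundedI)
    fix x assume "x \<in> insert 0 ((\<lambda>j. u j - l j) ` {1..<p})"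
    then consider "x = 0" | j where "j \<in> {1..<p}" "x = u j - l j" by blast
    then show "x \<le> 4 * (variation b + variation a)"
      using gap_le_variation[OF osc] v by cases fastforce+
  qed auto
  then show ?thesis using 1 2 by simp
qed

end
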